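(* Let $n\geq 3$ and let $p\in(1,\infty)$. There exists $\epsilon>0$ (depending only on $n$ and $p$) such that the following holds: if $K\subset\mathbb{R}^n$ is an origin-symmetric convex body with $d_{BM}(B,K)<1+\epsilon$, where $B$ is the unit Euclidean ball, and if there is a constant $c$ such that $c\,\Gamma_p K=K$, where $\Gamma_p K$ is the $p$-centroid body of $K$, then $K$ is an ellipsoid.
   Context: A convex body in $\mathbb{R}^n$ is a compact convex subset with non-empty interior; it is origin-symmetric if $-x\in K$ whenever $x\in K$. The support function of a convex body $K$ is $h_K(\theta)=\max\{x\cdot\theta : x\in K\}$ for $\theta$ in the unit sphere $S^{n-1}=\{x\in\mathbb{R}^n:|x|=1\}$. For a scalar $c$, $cL=\{cx:x\in L\}$. For $p\geq 1$, the $p$-centroid body $\Gamma_p K$ of a convex body $K$ is the convex body with support function $$h_{\Gamma_p K}(\theta)=\left(\frac{1}{\mathrm{vol}_n(K)}\int_K|\theta\cdot x|^p\,dx\right)^{1/p},\qquad \theta\in S^{n-1}.$$ The Banach-Mazur distance between origin-symmetric convex bodies $K,L\subset\mathbb{R}^n$ is $$d_{BM}(K,L)=\min\left\{\frac{1+\lambda}{1-\lambda}\geq 1 : (1-\lambda)K\subseteq TL\subseteq(1+\lambda)K \text{ for some } T\in GL_n(\mathbb{R})\right\},$$ so $d_{BM}(K,L)\ge 1$, with equality when $L$ is a linear image of $K$. An (origin-symmetric) ellipsoid is a set of the form $TB$ with $T\in GL_n(\mathbb{R})$. *)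

theory Defs
  imports "HOL-Analysis.Analysis"
begin

definition convex_body :: "(real ^ 'n) set \<Rightarrow> bool" where
  "convex_body K \<longleftrightarrow> compact K \<and> convex K \<and> interior K \<noteq> {}"

definition origin_symmetric :: "(real ^ 'n) set \<Rightarrow> bool" where
  "origin_symmetric K \<longleftrightarrow> (\<forall>x\<in>K. - x \<in> K)"

(* On convex bodies the supremum is attained, so it is the maximum. *)
definition support_function :: "(real ^ 'n) set \<Rightarrow> real ^ 'n \<Rightarrow> real" where
  "support_function K \<theta> = (SUP x\<in>K. x \<bullet> \<theta>)"

definition moment_function :: "real \<Rightarrow> (real ^ 'n) set \<Rightarrow> real ^ 'n \<Rightarrow> real" where
  "moment_function p K \<theta> =
     (1 / measure lborel K * (LINT x:K|lborel. \<bar>\<theta> \<bullet> x\<bar> powr p)) powr (1 / p)"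

(* The description determines exactly one body when p >= 1 and K is a convex body;
   see p_centroid_body_ex1 below. *)
definition p_centroid_body :: "real \<Rightarrow> (real ^ 'n) set \<Rightarrow> (real ^ 'n) set" where
  "p_centroid_body p K =
     (THE L. convex_body L \<and> (\<forall>\<theta>\<in>sphere 0 1. support_function L \<theta> = moment_function p K \<theta>))"

(* The condition (1 + r) / (1 - r) >= 1 amounts to 0 <= r < 1 (at r = 1 the quotient is 0).
   For origin-symmetric convex bodies the set is nonempty and attains its infimum. *)
definition banach_mazur_dist :: "(real ^ 'n) set \<Rightarrow> (real ^ 'n) set \<Rightarrow> real" where
  "banach_mazur_dist K L =
     Inf {(1 + r) / (1 - r) | r. (1 + r) / (1 - r) \<ge> 1 \<and>
       (\<exists>T :: real ^ 'n ^ 'n. invertible T \<and>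
          (\<lambda>x. (1 - r) *\<^sub>R x) ` K \<subseteq> (\<lambda>x. T *v x) ` L \<and>
          (\<lambda>x. T *v x) ` L \<subseteq> (\<lambda>x. (1 + r) *\<^sub>R x) ` K)}"

definition ellipsoid :: "(real ^ 'n) set \<Rightarrow> bool" where
  "ellipsoid E \<longleftrightarrow> (\<exists>T :: real ^ 'n ^ 'n. invertible T \<and> E = (\<lambda>x. T *v x) ` cball 0 1)"


lemma support_function_upper:
  assumes "convex_body L" "x \<in> L"
  shows "x \<bullet> u \<le> support_function L u"
proof -
  have "compact ((\<lambda>x. x \<bullet> u) ` L)"
    using assms by (auto simp: convex_body_def intro!: compact_continuous_image continuous_intros)
  then have "bdd_above ((\<lambda>x. x \<bullet> u) ` L)"
    by (intro bounded_imp_bdd_above compact_imp_bounded)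
  then show ?thesis
    unfolding support_function_def using assms(2) by (rule cSUP_upper[rotated])
qed

lemma convex_body_subsetI:
  fixes L M :: "(real ^ 'n) set"
  assumes L: "convex_body L" and M: "convex_body M"
    and le: "\<And>\<theta>. \<theta> \<in> sphere 0 1 \<Longrightarrow> support_function L \<theta> \<le> support_function M \<theta>"
  shows "L \<subseteq> M"
proof (rule subsetI, rule ccontr)
  fix x assume x: "x \<in> L" "x \<notin> M"
  have M': "closed M" "convex M" "M \<noteq> {}"
    using M by (auto simp: convex_body_def compact_imp_closed)
  obtain a b where ab: "a \<bullet> x < b" "\<And>y. y \<in> M \<Longrightarrow> a \<bullet> y > b"
    using separating_hyperplane_closed_point[OF M'(2,1) x(2)] by blast
  have a: "a \<noteq> 0" using ab M'(3) by force
  define \<theta> where "\<theta> = - (1 / norm a) *\<^sub>R a"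
  have th: "\<theta> \<in> sphere 0 1" using a by (simp add: \<theta>_def)
  have inn: "y \<bullet> \<theta> = - (a \<bullet> y) / norm a" for y
    by (simp add: \<theta>_def inner_commute)
  have "support_function M \<theta> \<le> - b / norm a"
    unfolding support_function_def inn
    by (rule cSUP_least) (use M'(3) ab(2) a in \<open>auto simp: divide_right_mono less_imp_le\<close>)
  also have "\<dots> < x \<bullet> \<theta>"
    unfolding inn using ab(1) a by (simp add: divide_strict_right_mono)
  also have "\<dots> \<le> support_function L \<theta>"
    by (rule support_function_upper[OF L x(1)])
  finally show False using le[OF th] by simp
qed

lemma sublinear_supporting_point:
  fixes h :: "'a::euclidean_space \<Rightarrow> real"
  assumes hom: "\<And>t u. t \<ge> 0 \<Longrightarrow> h (t *\<^sub>R u) = t * h u"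
    and sub: "\<And>u v. h (u + v) \<le> h u + h v"
  obtains x where "\<And>u. x \<bullet> u \<le> h u" "x \<bullet> \<theta> = h \<theta>"
proof -
  define T where "T = {z :: 'a \<times> real. h (fst z) < snd z}"
  have "convex T"
  proof (rule convexI)
    fix z w and a b :: real
    assume zw: "z \<in> T" "w \<in> T" "0 \<le> a" "0 \<le> b" "a + b = 1"
    have "h (a *\<^sub>R fst z + b *\<^sub>R fst w) \<le> a * h (fst z) + b * h (fst w)"
      using sub[of "a *\<^sub>R fst z" "b *\<^sub>R fst w"] zw by (simp add: hom)
    also have "\<dots> < a * snd z + b * snd w"
    proof (cases "a = 0")
      case True then show ?thesis using zw by (simp add: T_def)
    next
      case False
      then have "a * h (fst z) < a * snd z" using zw by (simp add: T_def)
      moreover have "b * h (fst w) \<le> b * snd w"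
        using zw by (intro mult_left_mono) (auto simp: T_def)
      ultimately show ?thesis by simp
    qed
    finally show "a *\<^sub>R z + b *\<^sub>R w \<in> T" by (simp add: T_def)
  qed
  moreover have "T \<noteq> {}"
  proof -
    have "(0, h 0 + 1) \<in> T" by (simp add: T_def)
    then show ?thesis by blast
  qed
  ultimately obtain c b where c: "c \<noteq> 0" "c \<bullet> (\<theta>, h \<theta>) \<le> b" "\<And>z. z \<in> T \<Longrightarrow> c \<bullet> z \<ge> b"
    using separating_hyperplane_sets[of "{(\<theta>, h \<theta>)}" T] by (auto simp: T_def)
  obtain v s where vs: "c = (v, s)" by (cases c)
  have ineq: "v \<bullet> \<theta> + s * h \<theta> \<le> v \<bullet> u + s * t" if "h u < t" for u t
    using c(2) c(3)[of "(u, t)"] that by (auto simp: vs T_def)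
  have s0: "s \<ge> 0"
    using ineq[of \<theta> "h \<theta> + 1"] by (simp add: algebra_simps)
  have s: "s > 0"
  proof (rule ccontr)
    assume "\<not> s > 0"
    then have "s = 0" using s0 by simp
    then have "v \<bullet> \<theta> \<le> v \<bullet> (\<theta> - v)"
      using ineq[of "\<theta> - v" "h (\<theta> - v) + 1"] by simp
    then have "v \<bullet> v \<le> 0" by (simp add: inner_diff_right)
    then have "v = 0" using inner_ge_zero[of v] by simp
    then show False using c(1) vs \<open>s = 0\<close> by (simp add: zero_prod_def)
  qed
  define x where "x = - (1 / s) *\<^sub>R v"
  have key: "h \<theta> - x \<bullet> \<theta> \<le> h u - x \<bullet> u" for u
  proof (rule field_le_epsilon)
    fix e :: real assume "e > 0"
    then have "v \<bullet> \<theta> + s * h \<theta> \<le> v \<bullet> u + s * (h u + e)"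
      by (intro ineq) simp
    then have "(v \<bullet> \<theta> + s * h \<theta>) / s \<le> (v \<bullet> u + s * (h u + e)) / s"
      using s by (intro divide_right_mono) auto
    then show "h \<theta> - x \<bullet> \<theta> \<le> h u - x \<bullet> u + e"
      using s by (simp add: x_def add_divide_distrib)
  qed
  have eq: "h \<theta> = x \<bullet> \<theta>"
    using key[of "2 *\<^sub>R \<theta>"] key[of "0 *\<^sub>R \<theta>"] hom[of 2 \<theta>] hom[of 0 \<theta>] by simp
  show ?thesis
    by (rule that[of x]) (use key eq in \<open>auto simp: algebra_simps\<close>)
qed

lemma convex_body_of_sublinear:
  fixes h :: "real ^ 'n \<Rightarrow> real"
  assumes hom: "\<And>t u. t \<ge> 0 \<Longrightarrow> h (t *\<^sub>R u) = t * h u"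
    and sub: "\<And>u v. h (u + v) \<le> h u + h v"
    and pos: "\<And>u. u \<noteq> 0 \<Longrightarrow> h u > 0"
  obtains L where "convex_body L" "\<And>u. support_function L u = h u"
proof -
  define L where "L = {x. \<forall>u. x \<bullet> u \<le> h u}"
  have h0: "h 0 = 0" using hom[of 0 0] by simp
  have L_Int: "L = (\<Inter>u. {x. x \<bullet> u \<le> h u})" by (auto simp: L_def)
  have "closed L" unfolding L_Int
    by (intro closed_INT ballI closed_Collect_le continuous_intros)
  have "convex L" unfolding L_Int
    by (intro convex_INT) (simp add: inner_commute[of _ "_ :: real ^ 'n"] convex_halfspace_le)
  have "bounded L"
  proof -
    have "\<bar>x \<bullet> b\<bar> \<le> \<bar>h b\<bar> + \<bar>h (- b)\<bar>" if "x \<in> L" for x b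
    proof -
      have "x \<bullet> b \<le> h b" "x \<bullet> (- b) \<le> h (- b)" using that unfolding L_def by blast+
      then show ?thesis by simp
    qed
    then have "norm x \<le> (\<Sum>b\<in>Basis. \<bar>h b\<bar> + \<bar>h (- b)\<bar>)" if "x \<in> L" for x
      using that by (intro order.trans[OF norm_le_l1] sum_mono)
    then show ?thesis unfolding bounded_iff by blast
  qed
  have "convex_on UNIV h"
  proof (rule convex_onI)
    fix t and x y :: "real ^ 'n" assume "0 < t" "t < (1::real)"
    then show "h ((1 - t) *\<^sub>R x + t *\<^sub>R y) \<le> (1 - t) * h x + t * h y"
      using sub[of "(1 - t) *\<^sub>R x" "t *\<^sub>R y"] by (simp add: hom)
  qed simp
  then have "continuous_on (sphere 0 1) h"
    using convex_on_continuous[OF open_UNIV] continuous_on_subset by blast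
  moreover have "sphere (0 :: real ^ 'n) 1 \<noteq> {}"
    by simp
  ultimately obtain u0 :: "real ^ 'n" where u0: "u0 \<in> sphere 0 1" "\<And>u. u \<in> sphere 0 1 \<Longrightarrow> h u0 \<le> h u"
    using continuous_attains_inf[OF compact_sphere] by metis
  have m: "h u0 > 0" using u0(1) by (intro pos) auto
  have "cball 0 (h u0) \<subseteq> L"
  proof
    fix x :: "real ^ 'n" assume x: "x \<in> cball 0 (h u0)"
    have "x \<bullet> u \<le> h u" for u
    proof (cases "u = 0")
      case False
      have "x \<bullet> u \<le> norm x * norm u" by (rule norm_cauchy_schwarz)
      also have "\<dots> \<le> h u0 * norm u" using x by (intro mult_right_mono) auto
      also have "\<dots> \<le> h ((1 / norm u) *\<^sub>R u) * norm u"
        using False by (intro mult_right_mono u0) auto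
      also have "\<dots> = h u" using False hom[of "1 / norm u" u] by simp
      finally show ?thesis .
    qed (simp add: h0)
    then show "x \<in> L" by (simp add: L_def)
  qed
  then have "0 \<in> interior L"
    using m by (meson ball_subset_cball centre_in_ball interior_maximal open_ball subset_iff)
  then have body: "convex_body L"
    using \<open>closed L\<close> \<open>convex L\<close> \<open>bounded L\<close> by (auto simp: convex_body_def compact_eq_bounded_closed)
  have "support_function L u = h u" for u
  proof (rule antisym)
    obtain x where x: "\<And>w. x \<bullet> w \<le> h w" "x \<bullet> u = h u"
      using sublinear_supporting_point[of h u] hom sub by metis
    then have "x \<in> L" by (simp add: L_def)
    show "support_function L u \<le> h u"
      unfolding support_function_def
      by (rule cSUP_least) (use \<open>x \<in> L\<close> in \<open>auto simp: L_def\<close>)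
    show "h u \<le> support_function L u"
      using support_function_upper[OF body \<open>x \<in> L\<close>, of u] x(2) by simp
  qed
  with body that show ?thesis by blast
qed

lemma powr_abs_convex:
  fixes a b t p :: real
  assumes p: "p \<ge> 1" and t: "0 < t" "t < 1"
  shows "\<bar>(1 - t) * a + t * b\<bar> powr p \<le> (1 - t) * \<bar>a\<bar> powr p + t * \<bar>b\<bar> powr p"
proof -
  have *: "(s * y) powr p \<le> s * y powr p" if "0 < s" "s < 1" "y \<ge> 0" for s y :: real
  proof -
    have "s powr p \<le> s powr 1" using that p by (intro powr_mono') auto
    then show ?thesis using that by (simp add: powr_mult mult_right_mono)
  qed
  have "\<bar>(1 - t) * a + t * b\<bar> powr p \<le> ((1 - t) * \<bar>a\<bar> + t * \<bar>b\<bar>) powr p"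
    using t p by (intro powr_mono2 order.trans[OF abs_triangle_ineq]) (auto simp: abs_mult)
  also have "\<dots> \<le> (1 - t) * \<bar>a\<bar> powr p + t * \<bar>b\<bar> powr p"
  proof (cases "a = 0 \<or> b = 0")
    case True
    then show ?thesis using *[of t "\<bar>b\<bar>"] *[of "1 - t" "\<bar>a\<bar>"] t p by auto
  next
    case False
    then show ?thesis
      using convex_onD[OF powr_convex[OF p], of t "\<bar>a\<bar>" "\<bar>b\<bar>"] t by simp
  qed
  finally show ?thesis .
qed

lemma moment_function_sublinear:
  fixes K :: "(real ^ 'n) set"
  assumes p: "p \<ge> 1" and K: "convex_body K"
  shows "\<And>t u. t \<ge> 0 \<Longrightarrow> moment_function p K (t *\<^sub>R u) = t * moment_function p K u"
    and "\<And>u v. moment_function p K (u + v) \<le> moment_function p K u + moment_function p K v"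
    and "\<And>u. u \<noteq> 0 \<Longrightarrow> moment_function p K u > 0"
proof -
  define V where "V = measure lborel K"
  define I where "I u = (LINT x:K|lborel. \<bar>u \<bullet> x\<bar> powr p)" for u :: "real ^ 'n"
  let ?h = "moment_function p K"
  have h_def: "?h u = (1 / V * I u) powr (1 / p)" for u
    by (simp add: moment_function_def V_def I_def)
  have cK: "compact K" and iK: "interior K \<noteq> {}" using K by (auto simp: convex_body_def)
  have Kb[measurable]: "K \<in> sets borel" using cK by (simp add: borel_closed compact_imp_closed)
  have int: "set_integrable lborel K (\<lambda>x. \<bar>u \<bullet> x\<bar> powr p)" for u :: "real ^ 'n"
    unfolding set_integrable_def using p
    by (intro borel_integrable_compact[OF cK] continuous_on_powr' continuous_intros) auto
  have not_neg: "\<not> negligible K"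
    using iK open_not_negligible[OF open_interior iK] negligible_subset[OF _ interior_subset] by blast
  have V: "V > 0"
  proof -
    have "V \<noteq> 0"
    proof
      assume "V = 0"
      then have "emeasure lborel K = 0"
        using emeasure_eq_ennreal_measure[of lborel K] emeasure_compact_finite[OF cK]
        by (simp add: V_def top.not_eq_extremum)
      then have "K \<in> null_sets lborel" using Kb by auto
      then show False using not_neg null_sets_completionI by (auto simp: negligible_iff_null_sets)
    qed
    then show ?thesis by (simp add: V_def order.not_eq_order_implies_strict)
  qed
  have I0: "I u \<ge> 0" for u
    unfolding I_def set_lebesgue_integral_def by (rule Bochner_Integration.integral_nonneg) simp
  have h0: "?h u \<ge> 0" for u by (simp add: h_def)
  show hom: "?h (t *\<^sub>R u) = t * ?h u" if t: "t \<ge> 0" for t u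
  proof -
    have "I (t *\<^sub>R u) = (LINT x:K|lborel. t powr p * \<bar>u \<bullet> x\<bar> powr p)"
      unfolding I_def using t by (simp add: abs_mult powr_mult)
    also have "\<dots> = t powr p * I u" by (simp add: I_def)
    finally have "?h (t *\<^sub>R u) = (t powr p * (1 / V * I u)) powr (1 / p)"
      by (simp add: h_def)
    also have "\<dots> = (t powr p) powr (1 / p) * ?h u"
      unfolding h_def by (rule powr_mult)
    also have "\<dots> = t * ?h u" using p t by (simp add: powr_powr)
    finally show ?thesis .
  qed
  show pos: "?h u > 0" if u: "u \<noteq> 0" for u
  proof -
    have "I u \<noteq> 0"
    proof
      assume "I u = 0"
      then have "AE x in lborel. indicator K x *\<^sub>R (\<bar>u \<bullet> x\<bar> powr p) = 0"
        using integral_nonneg_eq_0_iff_AE[of lborel "\<lambda>x. indicator K x *\<^sub>R (\<bar>u \<bullet> x\<bar> powr p)"]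
          int[of u] unfolding I_def set_lebesgue_integral_def set_integrable_def by simp
      then have "AE x in lebesgue. indicator K x *\<^sub>R (\<bar>u \<bullet> x\<bar> powr p) = 0"
        by (rule AE_completion)
      then have "AE x in lebesgue. x \<notin> K - {x. u \<bullet> x = 0}"
        by eventually_elim (auto simp: indicator_def split: if_splits)
      then have "K - {x. u \<bullet> x = 0} \<in> null_sets lebesgue"
        by (simp add: AE_iff_null_sets sets_completionI_sets)
      then have "negligible (K - {x. u \<bullet> x = 0})"
        by (simp add: negligible_iff_null_sets)
      moreover have "negligible {x. u \<bullet> x = 0}" using u by (intro negligible_hyperplane) auto
      ultimately have "negligible ((K - {x. u \<bullet> x = 0}) \<union> {x. u \<bullet> x = 0})"
        by (rule negligible_Un)
      then show False using not_neg negligible_subset by blast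
    qed
    then show ?thesis using V by (simp add: h_def)
  qed
  have I_h: "1 / V * I u = ?h u powr p" for u
    using p V I0[of u] by (simp add: h_def powr_powr)
  have conv: "?h ((1 - t) *\<^sub>R u + t *\<^sub>R v) powr p \<le> (1 - t) * ?h u powr p + t * ?h v powr p"
    if t: "0 < t" "t < 1" for t u v
  proof -
    have "I ((1 - t) *\<^sub>R u + t *\<^sub>R v) \<le>
        (LINT x:K|lborel. (1 - t) * \<bar>u \<bullet> x\<bar> powr p + t * \<bar>v \<bullet> x\<bar> powr p)"
      unfolding I_def
      by (rule set_integral_mono)
         (use int int[of "(1 - t) *\<^sub>R u + t *\<^sub>R v"] t p in \<open>auto simp: inner_add_left intro!: powr_abs_convex set_integral_add\<close>)
    also have "\<dots> = (1 - t) * I u + t * I v"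
      using int by (subst set_integral_add(2)) (auto simp: I_def)
    finally have "1 / V * I ((1 - t) *\<^sub>R u + t *\<^sub>R v) \<le> 1 / V * ((1 - t) * I u + t * I v)"
      using V by (intro mult_left_mono) auto
    also have "\<dots> = (1 - t) * (1 / V * I u) + t * (1 / V * I v)"
      using V by (simp add: field_simps)
    finally show ?thesis by (simp only: I_h)
  qed
  show "?h (u + v) \<le> ?h u + ?h v" for u v
  proof (cases "u = 0 \<or> v = 0")
    case True
    then show ?thesis using h0[of 0] by auto
  next
    case False
    define a b where "a = ?h u" and "b = ?h v"
    have ab: "a > 0" "b > 0" using False pos by (auto simp: a_def b_def)
    define t where "t = b / (a + b)"
    have t: "0 < t" "t < 1" "1 - t = a / (a + b)" using ab by (auto simp: t_def field_simps)
    have tab: "(1 - t) * (1 / a) = 1 / (a + b)" "t * (1 / b) = 1 / (a + b)"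
      unfolding t(3) using ab by (simp_all add: t_def)
    have "(1 - t) *\<^sub>R ((1 / a) *\<^sub>R u) + t *\<^sub>R ((1 / b) *\<^sub>R v) = (1 / (a + b)) *\<^sub>R (u + v)"
      by (simp only: scaleR_scaleR tab scaleR_add_right)
    then have "?h ((1 / (a + b)) *\<^sub>R (u + v)) powr p
        \<le> (1 - t) * ?h ((1 / a) *\<^sub>R u) powr p + t * ?h ((1 / b) *\<^sub>R v) powr p"
      using conv[OF t(1,2), of "(1 / a) *\<^sub>R u" "(1 / b) *\<^sub>R v"] by simp
    also have "?h ((1 / a) *\<^sub>R u) = 1" using ab hom[of "1 / a" u] by (simp add: a_def)
    also have "?h ((1 / b) *\<^sub>R v) = 1" using ab hom[of "1 / b" v] by (simp add: b_def)
    finally have "?h ((1 / (a + b)) *\<^sub>R (u + v)) powr p \<le> 1 powr p" by simp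
    then have "?h ((1 / (a + b)) *\<^sub>R (u + v)) \<le> 1"
      using p gr_one_powr[of "?h ((1 / (a + b)) *\<^sub>R (u + v))" p] by fastforce
    then have "?h (u + v) \<le> a + b"
      using ab by (subst (asm) hom) (auto simp: divide_le_eq)
    then show ?thesis by (simp only: a_def b_def)
  qed
qed

lemma p_centroid_body_ex1:
  fixes K :: "(real ^ 'n) set"
  assumes "p \<ge> 1" "convex_body K"
  shows "\<exists>!L. convex_body L \<and>
    (\<forall>\<theta>\<in>sphere 0 1. support_function L \<theta> = moment_function p K \<theta>)"
proof (rule ex_ex1I)
  show "\<exists>L. convex_body L \<and> (\<forall>\<theta>\<in>sphere 0 1. support_function L \<theta> = moment_function p K \<theta>)"
    using convex_body_of_sublinear[of "moment_function p K"]
      moment_function_sublinear[OF assms] by metis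
qed (intro equalityI; rule convex_body_subsetI; simp)

lemma p_centroid_body:
  fixes K :: "(real ^ 'n) set"
  assumes "p \<ge> 1" "convex_body K"
  shows "convex_body (p_centroid_body p K)"
    and "\<And>\<theta>. \<theta> \<in> sphere 0 1 \<Longrightarrow>
      support_function (p_centroid_body p K) \<theta> = moment_function p K \<theta>"
  using theI'[OF p_centroid_body_ex1[OF assms]] unfolding p_centroid_body_def by blast+

end

theory Submission
  imports Defs "HOL-Complex_Analysis.Great_Picard"
begin

text \<open>Let \<open>h\<close> and \<open>\<rho>\<close> be the support and radial functions of \<open>K\<close>. In polar form the equation \<open>c \<Gamma>\<^sub>p K = K\<close> reads
  \<open>h(\<theta>)^p = \<kappa> \<integral>|\<theta>\<cdot>u|^p \<rho>(u)^(n+p) d\<sigma>(u)\<close> with \<open>\<sigma>\<close> the uniform probability on the sphere, and it is invariant under linear maps.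
  Suppose \<open>|h - 1| \<le> r\<close>. The right-hand side gains a derivative, so \<open>h\<close> is \<open>O(r)\<close>-Lipschitz, and convexity turns this
  into \<open>h - O(r\<^sup>2) \<le> \<rho> \<le> h\<close>. Hence every limit \<open>f\<close> of \<open>(h - 1)/r\<close> as \<open>r\<close> tends to 0 (Arzela--Ascoli) solves the linear equation
  \<open>p f = \<beta> + (n+p) T f\<close>, where \<open>T\<close> is the normalized cosine transform.

  On polynomials of degree \<open>k\<close> modulo lower degree, \<open>T\<close> acts as a scalar \<open>\<lambda>\<^sub>k\<close>, proportional to
  \<open>\<integral>|u\<^sub>1|^p Re (u\<^sub>1 + i u\<^sub>2)^k d\<sigma>\<close>. Averaging over the rotations of the \<open>(u\<^sub>1,u\<^sub>2)\<close>-plane and integrating by parts on the circle give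
  \<open>\<lambda>\<^sub>2 = p/(n+p)\<close> and \<open>\<lambda>\<^sub>k < \<lambda>\<^sub>2\<close> for \<open>k \<noteq> 0, 2\<close>, so that \<open>f\<close> must be a quadratic form \<open>\<theta>\<cdot>S\<theta>\<close>.

  Applying the transpose of \<open>I - r S\<close> to \<open>K\<close> then replaces \<open>r\<close> by \<open>r/2\<close>. Choosing the linear image of \<open>K\<close> with the least \<open>r\<close>,
  which exists by compactness, forces \<open>r = 0\<close>.\<close>

section \<open>The uniform distribution on the sphere\<close>

text \<open>Quadratic forms must survive: every ellipsoid satisfies the equation, and a linear
  perturbation of the ball changes \<open>h\<close> by a quadratic form to first order. This forces
  the value \<open>p/(n+p)\<close> of \<open>\<lambda>\<^sub>2\<close>, and it is why the position
  of \<open>K\<close> has to be corrected. Constants solve the linear equation too, with a suitable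
  \<beta>, but on the sphere they are multiples of |\<theta>|^2. The obstacle is that closeness to
  the ball is only uniform: 1 - r \<le> \<rho> \<le> h \<le> 1 + r allows h - \<rho> of order r, the
  order of f itself, and then h and \<rho> could have different linear parts. A Lipschitz constant
  proportional to r, not merely bounded, makes h - \<rho> quadratic in r. Spherical harmonics are
  replaced by moments against powers of e.u: T is symmetric, and it maps such a power to a
  polynomial of at most the same degree in e.u. Once the moments of degree 0 and 2 have been
  subtracted, the inequality between the multipliers kills all the others by induction. Repeated
  halving of r would require an infinite product of linear maps to converge; a minimal position
  makes a single halving enough.\<close>

lemma continuous_on_linear: "linear g \<Longrightarrow> continuous_on S g"
  for g :: "'a::euclidean_space \<Rightarrow> 'b::real_normed_vector"
  by (simp add: linear_continuous_on linear_conv_bounded_linear)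

lemma borel_measurable_linear: "linear g \<Longrightarrow> g \<in> borel_measurable borel"
  for g :: "'a::euclidean_space \<Rightarrow> 'b::real_normed_vector"
  by (rule borel_measurable_continuous_onI[OF continuous_on_linear])

section \<open>Linear substitutions in Lebesgue integrals\<close>

lemma nn_integral_lborel_translate:
  fixes f :: "'a::euclidean_space \<Rightarrow> ennreal"
  assumes [measurable]: "f \<in> borel_measurable borel"
  shows "(\<integral>\<^sup>+x. f (a + x) \<partial>lborel) = (\<integral>\<^sup>+x. f x \<partial>lborel)"
proof -
  have "(\<integral>\<^sup>+x. f x \<partial>lborel) = (\<integral>\<^sup>+x. f x \<partial>distr lborel borel ((+) a))"
    by (simp add: lborel_distr_plus)
  also have "\<dots> = (\<integral>\<^sup>+x. f (a + x) \<partial>lborel)"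
    by (rule nn_integral_distr) auto
  finally show ?thesis by simp
qed

text \<open>Uniqueness of Haar measure, in the form needed here: unfolding
  \<open>(\<integral>F(g x)dx) (\<integral>1\<^sub>B(y)dy)\<close> by Fubini and translation invariance in both variables.\<close>

lemma nn_integral_lborel_linear:
  fixes g :: "'a::euclidean_space \<Rightarrow> 'a" and F :: "'a \<Rightarrow> ennreal"
  assumes g: "linear g" "bij g" and [measurable]: "F \<in> borel_measurable borel"
  shows "(\<integral>\<^sup>+x. F (g x) \<partial>lborel) * emeasure lborel (ball (0::'a) 1)
      = emeasure lborel (g -` ball 0 1) * (\<integral>\<^sup>+x. F x \<partial>lborel)"
proof -
  let ?B = "ball (0::'a) 1"
  have [measurable]: "g \<in> borel_measurable borel"
    by (rule borel_measurable_linear[OF g(1)])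
  have [measurable]: "?B \<in> sets borel" by simp
  have [measurable]: "g -` ?B \<in> sets borel"
    using measurable_sets_borel[of g borel ?B] by simp
  have inv: "g (inv g y) = y" for y
    using g(2) by (simp add: bij_is_surj surj_f_inv_f)
  have tr: "(\<integral>\<^sup>+x. G (g x) \<partial>lborel) = (\<integral>\<^sup>+x. G (y + g x) \<partial>lborel)"
    if [measurable]: "G \<in> borel_measurable borel" for G :: "'a \<Rightarrow> ennreal" and y
    using nn_integral_lborel_translate[of "\<lambda>x. G (g x)" "inv g y"]
    by (simp add: linear_add[OF g(1)] inv)
  have "(\<integral>\<^sup>+x. F (g x) \<partial>lborel) * emeasure lborel ?B
      = (\<integral>\<^sup>+y. (\<integral>\<^sup>+x. F (g x) \<partial>lborel) * indicator ?B y \<partial>lborel)"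
    by (simp add: nn_integral_cmult_indicator)
  also have "\<dots> = (\<integral>\<^sup>+y. (\<integral>\<^sup>+x. F (y + g x) * indicator ?B y \<partial>lborel) \<partial>lborel)"
  proof (rule nn_integral_cong)
    fix y
    show "(\<integral>\<^sup>+x. F (g x) \<partial>lborel) * indicator ?B y = (\<integral>\<^sup>+x. F (y + g x) * indicator ?B y \<partial>lborel)"
      by (subst tr[of F y]) (simp_all add: nn_integral_multc)
  qed
  also have "\<dots> = (\<integral>\<^sup>+x. (\<integral>\<^sup>+y. F (y + g x) * indicator ?B y \<partial>lborel) \<partial>lborel)"
    by (rule lborel_pair.Fubini') measurable
  also have "\<dots> = (\<integral>\<^sup>+x. (\<integral>\<^sup>+y. F y * indicator ?B (y - g x) \<partial>lborel) \<partial>lborel)"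
  proof (rule nn_integral_cong)
    fix x
    show "(\<integral>\<^sup>+y. F (y + g x) * indicator ?B y \<partial>lborel) = (\<integral>\<^sup>+y. F y * indicator ?B (y - g x) \<partial>lborel)"
      using nn_integral_lborel_translate[of "\<lambda>y. F y * indicator ?B (y - g x)" "g x"]
      by (simp add: add.commute)
  qed
  also have "\<dots> = (\<integral>\<^sup>+y. (\<integral>\<^sup>+x. F y * indicator ?B (y - g x) \<partial>lborel) \<partial>lborel)"
    by (rule lborel_pair.Fubini') measurable
  also have "\<dots> = (\<integral>\<^sup>+y. F y * (\<integral>\<^sup>+x. indicator ?B (g x) \<partial>lborel) \<partial>lborel)"
  proof (rule nn_integral_cong)
    fix y
    have "(\<integral>\<^sup>+x. F y * indicator ?B (y - g x) \<partial>lborel) = F y * (\<integral>\<^sup>+x. indicator ?B (y - g x) \<partial>lborel)"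
      by (rule nn_integral_cmult) measurable
    \<comment> \<open>Symmetry of the ball turns \<open>y - g x\<close> into
      \<open>- y + g x\<close>, so that the shift can again be absorbed by a translation of
      \<open>x\<close>.\<close>
    also have "(\<integral>\<^sup>+x. indicator ?B (y - g x) \<partial>lborel) = (\<integral>\<^sup>+x. indicator ?B (- y + g x) \<partial>lborel)"
      by (intro nn_integral_cong) (auto simp: indicator_def dist_norm norm_minus_commute)
    also have "\<dots> = (\<integral>\<^sup>+x. indicator ?B (g x) \<partial>lborel)"
      by (rule tr[symmetric]) measurable
    finally show "(\<integral>\<^sup>+x. F y * indicator ?B (y - g x) \<partial>lborel) = F y * (\<integral>\<^sup>+x. indicator ?B (g x) \<partial>lborel)" .
  qed
  also have "\<dots> = (\<integral>\<^sup>+x. indicator ?B (g x) \<partial>lborel) * (\<integral>\<^sup>+y. F y \<partial>lborel)"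
    by (simp add: nn_integral_multc mult.commute)
  also have "(\<integral>\<^sup>+x. indicator ?B (g x) \<partial>lborel) = (\<integral>\<^sup>+x. indicator (g -` ?B) x \<partial>lborel)"
    by (intro nn_integral_cong) (simp add: indicator_def)
  also have "\<dots> = emeasure lborel (g -` ?B)"
    by simp
  finally show ?thesis .
qed

lemma emeasure_lborel_open_pos:
  fixes S :: "'a::euclidean_space set"
  assumes "open S" "S \<noteq> {}"
  shows "emeasure lborel S > 0"
proof (rule ccontr)
  assume "\<not> emeasure lborel S > 0"
  then have "S \<in> null_sets lborel" using assms by auto
  then have "negligible S" by (simp add: negligible_iff_null_sets null_sets_completionI)
  then show False using assms open_not_negligible by blast
qed

text \<open>The constant is the reciprocal of the absolute determinant, but only its existence
  matters: it disappears into the unspecified factor of \<open>moment_fixed\<close>. It is a ratio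
  of two volumes, positive and finite because the preimage of the unit ball is open, contains 0 and
  is bounded.\<close>

lemma nn_integral_lborel_linear_const:
  fixes g :: "'a::euclidean_space \<Rightarrow> 'a"
  assumes g: "linear g" "bij g"
  obtains c :: real where "c > 0"
    "\<And>F :: 'a \<Rightarrow> ennreal. F \<in> borel_measurable borel \<Longrightarrow>
        (\<integral>\<^sup>+x. F (g x) \<partial>lborel) = ennreal c * (\<integral>\<^sup>+x. F x \<partial>lborel)"
proof -
  let ?B = "ball (0::'a) 1"
  define a b where "a = emeasure lborel ?B" and "b = emeasure lborel (g -` ?B)"
  have cont: "continuous_on UNIV g"
    by (rule continuous_on_linear[OF g(1)])
  have a: "0 < a" "a < \<infinity>"
    by (auto simp: a_def emeasure_lborel_open_pos intro!: emeasure_bounded_finite[simplified])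
  have "open (g -` ?B)" using cont by (simp add: open_vimage)
  moreover have "0 \<in> g -` ?B" using linear_0[OF g(1)] by simp
  ultimately have b0: "b > 0" unfolding b_def by (intro emeasure_lborel_open_pos) auto
  have "bounded (inv g ` ?B)"
    by (intro bounded_linear_image bounded_ball linear_conv_bounded_linear[THEN iffD1])
       (metis g bij_is_inj linear_inj_imp_surj inj_linear_imp_inv_linear)
  moreover have "g -` ?B = inv g ` ?B" using g(2) by (simp add: bij_vimage_eq_inv_image)
  ultimately have b1: "b < \<infinity>"
    using emeasure_bounded_finite[of "g -` ?B"] by (simp add: b_def)
  obtain a' b' where ab: "a = ennreal a'" "b = ennreal b'" "a' > 0" "b' > 0"
    using a b0 b1 by (metis ennreal_cases ennreal_less_zero_iff infinity_ennreal_def order_less_irrefl)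
  show ?thesis
  proof (rule that[of "b' / a'"])
    fix F :: "'a \<Rightarrow> ennreal" assume "F \<in> borel_measurable borel"
    from nn_integral_lborel_linear[OF g this]
    have "(\<integral>\<^sup>+x. F (g x) \<partial>lborel) * a = b * (\<integral>\<^sup>+x. F x \<partial>lborel)"
      by (simp add: a_def b_def)
    then have "(\<integral>\<^sup>+x. F (g x) \<partial>lborel) = b * (\<integral>\<^sup>+x. F x \<partial>lborel) / a"
      using a by (metis ennreal_mult_divide_eq infinity_ennreal_def less_irrefl)
    also have "\<dots> = (b / a) * (\<integral>\<^sup>+x. F x \<partial>lborel)"
      by (simp add: divide_ennreal_def ac_simps)
    also have "b / a = ennreal (b' / a')" using ab by (simp add: divide_ennreal)
    finally show "(\<integral>\<^sup>+x. F (g x) \<partial>lborel) = ennreal (b' / a') * (\<integral>\<^sup>+x. F x \<partial>lborel)" .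
  qed (use ab in simp)
qed

text \<open>An isometry preserves the unit ball, so the two volumes in
  \<open>nn_integral_lborel_linear\<close> cancel.\<close>

lemma nn_integral_lborel_orthogonal:
  fixes g :: "'a::euclidean_space \<Rightarrow> 'a" and F :: "'a \<Rightarrow> ennreal"
  assumes g: "orthogonal_transformation g" and F: "F \<in> borel_measurable borel"
  shows "(\<integral>\<^sup>+x. F (g x) \<partial>lborel) = (\<integral>\<^sup>+x. F x \<partial>lborel)"
proof -
  let ?B = "ball (0::'a) 1"
  have "g -` ?B = ?B"
    by (auto simp: orthogonal_transformation_norm[OF g])
  then have eq: "(\<integral>\<^sup>+x. F (g x) \<partial>lborel) * emeasure lborel ?B = (\<integral>\<^sup>+x. F x \<partial>lborel) * emeasure lborel ?B"
    using nn_integral_lborel_linear[OF _ orthogonal_transformation_bij[OF g] F]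
      orthogonal_transformation_linear[OF g] by (simp add: mult.commute)
  have "emeasure lborel ?B \<noteq> 0" "emeasure lborel ?B \<noteq> \<infinity>"
    using emeasure_lborel_open_pos[of ?B] emeasure_bounded_finite[of ?B] by auto
  with eq show ?thesis
    by (metis ennreal_mult_divide_eq infinity_ennreal_def)
qed

lemma nn_integral_lborel_scale:
  fixes F :: "'a::euclidean_space \<Rightarrow> ennreal"
  assumes c: "c > 0" and [measurable]: "F \<in> borel_measurable borel"
  shows "(\<integral>\<^sup>+x. F x \<partial>lborel) = ennreal (c ^ DIM('a)) * (\<integral>\<^sup>+x. F (c *\<^sub>R x) \<partial>lborel)"
proof -
  have "(\<integral>\<^sup>+x. F x \<partial>lborel) = (\<integral>\<^sup>+x. F x \<partial>density (distr lborel borel (\<lambda>x. 0 + c *\<^sub>R x)) (\<lambda>_. \<bar>c\<bar> ^ DIM('a)))"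
    using c by (subst lborel_affine[of c 0, symmetric]) auto
  also have "\<dots> = ennreal (c ^ DIM('a)) * (\<integral>\<^sup>+x. F (c *\<^sub>R x) \<partial>lborel)"
    using c by (simp add: nn_integral_density nn_integral_distr nn_integral_cmult)
  finally show ?thesis .
qed


text \<open>Radial projection of the uniform law of the ball, so every invariance is inherited from
  Lebesgue measure. The law lives on the whole space and charges only unit vectors; functions on the
  sphere are therefore Borel functions on the space with hypotheses at unit vectors only. The origin
  is sent to 0, a null event.\<close>

definition sphere_law :: "'a::euclidean_space measure" where
  "sphere_law = distr (uniform_measure lborel (cball 0 1)) borel (\<lambda>x. x /\<^sub>R norm x)"

abbreviation sphere_integral :: "('a::euclidean_space \<Rightarrow> 'b::{banach,second_countable_topology}) \<Rightarrow> 'b" (binder "\<integral>\<^sub>S" 10)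
  where "sphere_integral f \<equiv> integral\<^sup>L sphere_law f"

abbreviation cos_kernel :: "real \<Rightarrow> 'a::euclidean_space \<Rightarrow> 'a \<Rightarrow> real" where
  "cos_kernel p v u \<equiv> \<bar>v \<bullet> u\<bar> powr p"

lemma sets_sphere_law [simp, measurable_cong]: "sets sphere_law = sets borel"
  by (simp add: sphere_law_def)

lemma space_sphere_law [simp]: "space sphere_law = UNIV"
  by (simp add: sphere_law_def)

lemma emeasure_cball_01:
  "emeasure lborel (cball (0::'a::euclidean_space) 1) \<noteq> 0"
  "emeasure lborel (cball (0::'a::euclidean_space) 1) \<noteq> \<infinity>"
proof -
  have "emeasure lborel (ball (0::'a) 1) \<le> emeasure lborel (cball (0::'a) 1)"
    by (intro emeasure_mono) auto
  then show "emeasure lborel (cball (0::'a) 1) \<noteq> 0"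
    using emeasure_lborel_open_pos[of "ball (0::'a) 1"] by auto
  show "emeasure lborel (cball (0::'a) 1) \<noteq> \<infinity>"
    using emeasure_bounded_finite[of "cball (0::'a) 1"] by auto
qed

lemma nn_integral_sphere_law:
  fixes F :: "'a::euclidean_space \<Rightarrow> ennreal"
  assumes [measurable]: "F \<in> borel_measurable borel"
  shows "(\<integral>\<^sup>+u. F u \<partial>sphere_law) =
    (\<integral>\<^sup>+x. F (x /\<^sub>R norm x) * indicator (cball 0 1) x \<partial>lborel) / emeasure lborel (cball (0::'a) 1)"
  unfolding sphere_law_def
  by (subst nn_integral_distr) (auto simp: nn_integral_uniform_measure)

lemma emeasure_sphere_law_UNIV: "emeasure (sphere_law :: 'a::euclidean_space measure) UNIV = 1"
proof -
  have "emeasure (sphere_law :: 'a measure) UNIV = (\<integral>\<^sup>+u. 1 \<partial>(sphere_law :: 'a measure))" by simp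
  also have "\<dots> = emeasure lborel (cball (0::'a) 1) / emeasure lborel (cball (0::'a) 1)"
    by (subst nn_integral_sphere_law) auto
  also have "\<dots> = 1"
    using emeasure_cball_01[where 'a='a] by (simp add: ennreal_divide_self top.not_eq_extremum)
  finally show ?thesis .
qed

interpretation sphere_law: finite_measure "sphere_law :: 'a::euclidean_space measure"
  by standard (simp add: emeasure_sphere_law_UNIV)

lemma measure_sphere_law_UNIV [simp]: "measure (sphere_law :: 'a::euclidean_space measure) UNIV = 1"
  by (simp add: measure_def emeasure_sphere_law_UNIV)

lemma AE_sphere_law: "AE u in sphere_law :: 'a::euclidean_space measure. norm u = 1"
proof -
  have "AE x in lborel :: 'a measure. norm (x /\<^sub>R norm x) = 1"
    by (rule AE_I[of _ _ "{0}"]) (auto intro: ccontr)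
  then show ?thesis
    unfolding sphere_law_def
    by (subst AE_distr_iff) (auto simp: AE_uniform_measure emeasure_cball_01[simplified] top.not_eq_extremum[symmetric])
qed

lemma distr_sphere_law_orthogonal:
  fixes g :: "'a::euclidean_space \<Rightarrow> 'a"
  assumes g: "orthogonal_transformation g"
  shows "distr sphere_law borel g = sphere_law"
proof (rule measure_eqI)
  have lin: "linear g" by (rule orthogonal_transformation_linear[OF g])
  have [measurable]: "g \<in> borel_measurable borel"
    by (rule borel_measurable_linear[OF lin])
  fix A assume "A \<in> sets (distr (sphere_law :: 'a measure) borel g)"
  then have [measurable]: "A \<in> sets borel" by simp
  have [measurable]: "cball (0::'a) 1 \<in> sets borel" by simp
  let ?F = "\<lambda>x. indicator A (x /\<^sub>R norm x) * indicator (cball 0 1) x :: ennreal"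
  have "emeasure (distr sphere_law borel g) A = (\<integral>\<^sup>+u. indicator A (g u) \<partial>sphere_law)"
    by (simp add: nn_integral_distr nn_integral_indicator[symmetric] del: nn_integral_indicator)
  also have "\<dots> = (\<integral>\<^sup>+x. ?F (g x) \<partial>lborel) / emeasure lborel (cball (0::'a) 1)"
    by (subst nn_integral_sphere_law)
       (auto simp: linear_scale[OF lin] orthogonal_transformation_norm[OF g] indicator_def
          intro!: arg_cong2[where f="(/)"] nn_integral_cong)
  also have "(\<integral>\<^sup>+x. ?F (g x) \<partial>lborel) = (\<integral>\<^sup>+x. ?F x \<partial>lborel)"
    by (rule nn_integral_lborel_orthogonal[OF g]) measurable
  also have "\<dots> / emeasure lborel (cball (0::'a) 1) = emeasure sphere_law A"
    by (subst nn_integral_sphere_law[symmetric]) auto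
  finally show "emeasure (distr sphere_law borel g) A = emeasure sphere_law A" .
qed simp

lemma integral_sphere_law_orthogonal:
  fixes g :: "'a::euclidean_space \<Rightarrow> 'a" and f :: "'a \<Rightarrow> real"
  assumes g: "orthogonal_transformation g" and f: "f \<in> borel_measurable borel"
  shows "(\<integral>\<^sub>Su. f (g u)) = (\<integral>\<^sub>Su. f u)"
proof -
  have "g \<in> borel_measurable borel"
    by (rule borel_measurable_linear[OF orthogonal_transformation_linear[OF g]])
  then show ?thesis
    using integral_distr[of g sphere_law borel f] f distr_sphere_law_orthogonal[OF g] by simp
qed

text \<open>Division by zero makes \<open>reflection 0\<close> the identity, so
  \<open>reflection_swap\<close> and its consequences need not exclude equal vectors.\<close>

definition reflection :: "'a::euclidean_space \<Rightarrow> 'a \<Rightarrow> 'a" where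
  "reflection v x = x - (2 * (v \<bullet> x) / (v \<bullet> v)) *\<^sub>R v"

lemma orthogonal_transformation_reflection: "orthogonal_transformation (reflection v)"
proof -
  have "linear (reflection v)"
    by (rule linearI) (auto simp: reflection_def algebra_simps inner_add_right add_divide_distrib)
  moreover have "reflection v x \<bullet> reflection v y = x \<bullet> y" for x y
    by (cases "v = 0") (auto simp: reflection_def inner_diff_left inner_diff_right inner_commute field_simps)
  ultimately show ?thesis by (simp add: orthogonal_transformation_def)
qed

lemma reflection_swap:
  assumes "norm a = norm b"
  shows "reflection (a - b) a = b"
proof (cases "a = b")
  case False
  have n: "a \<bullet> a = b \<bullet> b" using assms by (simp add: norm_eq)
  have "(a - b) \<bullet> (a - b) = 2 * ((a - b) \<bullet> a)"
    using n by (simp add: inner_diff_left inner_diff_right inner_commute)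
  moreover have "(a - b) \<bullet> (a - b) \<noteq> 0" using False by simp
  ultimately show ?thesis by (simp add: reflection_def)
qed (simp add: reflection_def)

lemma reflection_fix: "v \<bullet> x = 0 \<Longrightarrow> reflection v x = x"
  by (simp add: reflection_def)

text \<open>Two reflections suffice: the first sends \<open>a\<close> to \<open>a'\<close>; the
  second sends the image of \<open>b\<close> to \<open>b'\<close> and fixes \<open>a'\<close>, which
  is orthogonal to both.\<close>

lemma orthogonal_transformation_pair:
  fixes a b a' b' :: "'a::euclidean_space"
  assumes "norm a = 1" "norm b = 1" "a \<bullet> b = 0" "norm a' = 1" "norm b' = 1" "a' \<bullet> b' = 0"
  obtains g where "orthogonal_transformation g" "g a = a'" "g b = b'"
proof -
  let ?r = "reflection (a - a')"
  have o: "orthogonal_transformation ?r" by (rule orthogonal_transformation_reflection)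
  have ra: "?r a = a'" using assms by (intro reflection_swap) auto
  have nb: "norm (?r b) = norm b'" using orthogonal_transformation_norm[OF o] assms by simp
  have "a' \<bullet> ?r b = 0"
    using o assms(3) ra unfolding orthogonal_transformation_def by metis
  then have fx: "reflection (?r b - b') a' = a'"
    using assms by (intro reflection_fix) (simp add: inner_diff_right inner_commute[of _ a'])
  show ?thesis
    by (rule that[of "reflection (?r b - b') \<circ> ?r"])
       (auto simp: ra fx reflection_swap[OF nb] intro!: orthogonal_transformation_compose orthogonal_transformation_reflection)
qed

lemma integral_sphere_law_pair:
  fixes a b a' b' :: "'a::euclidean_space" and F :: "real \<Rightarrow> real \<Rightarrow> real"
  assumes "norm a = 1" "norm b = 1" "a \<bullet> b = 0" "norm a' = 1" "norm b' = 1" "a' \<bullet> b' = 0"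
    and [measurable]: "case_prod F \<in> borel_measurable borel"
  shows "(\<integral>\<^sub>Su. F (a \<bullet> u) (b \<bullet> u)) = (\<integral>\<^sub>Su. F (a' \<bullet> u) (b' \<bullet> u))"
proof -
  obtain g where g: "orthogonal_transformation g" "g a = a'" "g b = b'"
    using orthogonal_transformation_pair[OF assms(1-6)] by blast
  have "a' \<bullet> g u = a \<bullet> u" "b' \<bullet> g u = b \<bullet> u" for u
    using g unfolding orthogonal_transformation_def by metis+
  moreover have "(\<lambda>u. F (a' \<bullet> u) (b' \<bullet> u)) \<in> borel_measurable borel"
    using measurable_compose[OF _ assms(7), of "\<lambda>u. (a' \<bullet> u, b' \<bullet> u)" borel]
    by (simp add: borel_prod[symmetric])
  ultimately show ?thesis
    using integral_sphere_law_orthogonal[OF g(1), of "\<lambda>u. F (a' \<bullet> u) (b' \<bullet> u)"] by simp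
qed

section \<open>Integration in polar form\<close>

text \<open>The reciprocal of the Minkowski gauge, homogeneous of degree -1. If
  \<open>0 \<in> K\<close>, the set of admissible \<open>t\<close> is unbounded at the origin and
  has no supremum; the value 0 there is a convention at a null point.\<close>

definition radial :: "'a::euclidean_space set \<Rightarrow> 'a \<Rightarrow> real" where
  "radial K x = (if x = 0 then 0 else Sup {t. 0 \<le> t \<and> t *\<^sub>R x \<in> K})"

context
  fixes K :: "'a::euclidean_space set"
  assumes cK: "compact K" and vK: "convex K" and K0: "0 \<in> K"
begin

text \<open>Compactness makes the supremum attained, and convexity with \<open>0 \<in> K\<close>
  fills the segment below it.\<close>

lemma scaleR_mem_iff_le_radial:
  assumes x: "x \<noteq> 0" and t: "t \<ge> 0"
  shows "t *\<^sub>R x \<in> K \<longleftrightarrow> t \<le> radial K x"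
proof -
  define S where "S = {t. 0 \<le> t \<and> t *\<^sub>R x \<in> K}"
  obtain M where M: "\<And>y. y \<in> K \<Longrightarrow> norm y \<le> M"
    using compact_imp_bounded[OF cK] by (auto simp: bounded_iff)
  have "s \<le> M / norm x" if "s \<in> S" for s
    using M[of "s *\<^sub>R x"] that x by (auto simp: S_def field_simps)
  then have bdd: "bdd_above S" by (rule bdd_aboveI)
  have "closed ({0..} \<inter> (\<lambda>t. t *\<^sub>R x) -` K)"
    by (intro closed_Int closed_vimage compact_imp_closed[OF cK] continuous_intros closed_atLeast)
  moreover have "S = {0..} \<inter> (\<lambda>t. t *\<^sub>R x) -` K" by (auto simp: S_def)
  ultimately have cl: "closed S" by simp
  have S0: "0 \<in> S" using K0 by (simp add: S_def)
  have r: "radial K x = Sup S" using x by (simp add: radial_def S_def)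
  have mem: "Sup S \<in> S" using closed_contains_Sup[OF _ bdd cl] S0 by auto
  show ?thesis
  proof
    assume "t *\<^sub>R x \<in> K"
    then show "t \<le> radial K x" unfolding r using t by (intro cSup_upper bdd) (simp add: S_def)
  next
    assume le: "t \<le> radial K x"
    show "t *\<^sub>R x \<in> K"
    proof (cases "radial K x = 0")
      case True
      then show ?thesis using le t K0 by simp
    next
      case False
      then have p: "radial K x > 0" using le t by simp
      have "radial K x \<in> S" using mem r by simp
      then have mem': "radial K x *\<^sub>R x \<in> K" by (simp add: S_def)
      have "(1 - t / radial K x) *\<^sub>R 0 + (t / radial K x) *\<^sub>R (radial K x *\<^sub>R x) \<in> K"
        using mem' le p t K0 by (intro convexD[OF vK]) auto
      then show ?thesis using p by simp
    qed
  qed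
qed

lemma radial_nonneg: "radial K x \<ge> 0"
  using scaleR_mem_iff_le_radial[of x 0] K0 by (cases "x = 0") (auto simp: radial_def)

lemma radial_scaleR:
  assumes "c > 0"
  shows "radial K (c *\<^sub>R x) = radial K x / c"
proof (cases "x = 0")
  case False
  have "t \<le> radial K (c *\<^sub>R x) \<longleftrightarrow> t \<le> radial K x / c" if "t \<ge> 0" for t
    using scaleR_mem_iff_le_radial[of "c *\<^sub>R x" t] scaleR_mem_iff_le_radial[of x "t * c"] False assms that
    by (simp add: field_simps)
  from this[of "radial K (c *\<^sub>R x)"] this[of "radial K x / c"] show ?thesis
    using radial_nonneg[of x] radial_nonneg[of "c *\<^sub>R x"] assms by (intro antisym) auto
qed (simp add: radial_def)

lemma borel_measurable_radial: "radial K \<in> borel_measurable borel"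
proof (rule borel_measurable_iff_ge[THEN iffD2], intro allI)
  fix t :: real
  show "{x \<in> space borel. t \<le> radial K x} \<in> sets borel"
  proof (cases "t \<le> 0")
    case True
    then have "{x. t \<le> radial K x} = UNIV" using radial_nonneg by (auto intro: order_trans)
    then show ?thesis by simp
  next
    case False
    then have "{x. t \<le> radial K x} = - {0} \<inter> (\<lambda>x. t *\<^sub>R x) -` K"
      using scaleR_mem_iff_le_radial[of _ t] by (auto simp: radial_def)
    moreover have "closed ((\<lambda>x. t *\<^sub>R x) -` K)"
      by (intro closed_vimage compact_imp_closed[OF cK] continuous_intros)
    ultimately show ?thesis by auto
  qed
qed

lemma nn_integral_powr_le:
  assumes "q > 0" "r \<ge> 0"
  shows "(\<integral>\<^sup>+t. ennreal (t powr (q - 1)) * indicator {0..r} t \<partial>lborel) = ennreal (r powr q / q)"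
  using nn_integral_has_integral_lebesgue'[OF _ has_integral_powr_from_0[of "q - 1" r]] assms by simp

lemma nn_integral_powr_ge:
  assumes "r > 0" "q > 0"
  shows "(\<integral>\<^sup>+t. ennreal (t powr (- q - 1)) * indicator {r..} t \<partial>lborel) = ennreal (r powr (- q) / q)"
  using nn_integral_has_integral_lebesgue'[OF _ has_integral_powr_to_inf[of "- q - 1" r]] assms by simp

text \<open>No polar coordinates: with \<open>q = DIM('a) + p\<close>, write \<open>radial K x ^ q\<close> as an integral over \<open>t\<close>,
  exchange the integrals and substitute \<open>y = t x\<close>.\<close>

lemma nn_integral_polar:
  fixes F :: "'a \<Rightarrow> real" and p :: real
  assumes p: "p \<ge> 0" and F[measurable]: "F \<in> borel_measurable borel" and F0: "\<And>x. F x \<ge> 0"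
    and hom: "\<And>t x. t > 0 \<Longrightarrow> F (t *\<^sub>R x) = t powr p * F x"
  shows "(\<integral>\<^sup>+x. ennreal (F x) * indicator K x \<partial>lborel)
    = ennreal (DIM('a) / (DIM('a) + p)) * emeasure lborel (cball (0::'a) 1) *
      (\<integral>\<^sup>+u. ennreal (F u * radial K u powr (DIM('a) + p)) \<partial>sphere_law)"
proof -
  define n where "n = real DIM('a)"
  define q where "q = n + p"
  have n: "n > 0" and q: "q > 0" using p by (auto simp: n_def q_def add_pos_nonneg)
  let ?B = "cball (0::'a) 1"
  have [measurable]: "K \<in> sets borel" using cK by (simp add: borel_closed compact_imp_closed)
  have [measurable]: "?B \<in> sets borel" by simp
  note [measurable] = borel_measurable_radial
  let ?H = "\<lambda>y t. (ennreal (n * (F y * norm y powr n)) * indicator K y) * (ennreal (t powr (- n - 1)) * indicator {norm y..} t)" and ?J = "\<lambda>x. ennreal (F (x /\<^sub>R norm x) * radial K (x /\<^sub>R norm x) powr q) * indicator ?B x"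
  \<comment> \<open>The weight \<open>norm y powr n\<close> makes the product of \<open>F y\<close>,
    \<open>norm y powr n\<close> and \<open>radial K y powr q\<close> homogeneous of degree 0, so
    integrating over \<open>t\<close> first leaves a function of the direction of \<open>y\<close>
    on the ball. In the other order, replacing \<open>y\<close> by \<open>y / t\<close> leaves
    \<open>t powr (- n - 1)\<close> on \<open>t \<ge> norm y\<close>, whose integral
    \<open>norm y powr (- n) / n\<close> cancels the weight and the factor \<open>n\<close>.\<close>
  define G where "G t y = ennreal (n * t powr (q - 1)) * indicator {0<..} t * (ennreal (F y * norm y powr n) * indicator ?B y * indicator K (t *\<^sub>R y))" for t :: real and y :: 'a
  have [measurable]: "case_prod G \<in> borel_measurable borel"
    unfolding G_def[abs_def] by (simp add: borel_prod[symmetric])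
  have [measurable]: "G t \<in> borel_measurable borel" for t
    unfolding G_def[abs_def] by measurable
  have Gx: "(\<integral>\<^sup>+t. G t x \<partial>lborel) = ennreal (n / q) * (?J x)"
    if x: "x \<noteq> 0" for x
  proof -
    have "(\<integral>\<^sup>+t. G t x \<partial>lborel) = (\<integral>\<^sup>+t. (ennreal (n * (F x * norm x powr n)) * indicator ?B x) * (ennreal (t powr (q - 1)) * indicator {0..radial K x} t) \<partial>lborel)"
    proof (rule nn_integral_cong)
      fix t :: real
      show "G t x = (ennreal (n * (F x * norm x powr n)) * indicator ?B x) * (ennreal (t powr (q - 1)) * indicator {0..radial K x} t)"
        using scaleR_mem_iff_le_radial[OF x, of t] n F0[of x]
        by (cases "t > 0"; cases "t = 0") (auto simp: G_def ennreal_mult ac_simps split: split_indicator)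
    qed
    also have "\<dots> = (ennreal (n * (F x * norm x powr n)) * indicator ?B x) * ennreal (radial K x powr q / q)"
      by (subst nn_integral_cmult) (use nn_integral_powr_le[OF q radial_nonneg] in auto)
    also have "\<dots> = ennreal (n / q) * (ennreal (F x * norm x powr n * radial K x powr q) * indicator ?B x)"
      using n q F0[of x] by (auto simp: ennreal_mult[symmetric] field_simps split: split_indicator)
    also have "F x * norm x powr n * radial K x powr q = F (x /\<^sub>R norm x) * radial K (x /\<^sub>R norm x) powr q"
    proof -
      have "F (x /\<^sub>R norm x) = norm x powr (- p) * F x"
        using hom[of "inverse (norm x)" x] x by (simp add: powr_minus inverse_powr powr_divide divide_inverse)
      moreover have "radial K (x /\<^sub>R norm x) powr q = norm x powr q * radial K x powr q"
        using radial_scaleR[of "inverse (norm x)" x] x radial_nonneg[of x]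
        by (simp add: field_simps powr_mult)
      ultimately show ?thesis
        by (simp add: q_def powr_add powr_minus x field_simps)
    qed
    finally show ?thesis .
  qed
  have Gt: "(\<integral>\<^sup>+x. G t x \<partial>lborel) = (\<integral>\<^sup>+y. ?H y t \<partial>lborel)"
    (is "_ = ?R t") for t :: real
  proof (cases "t > 0")
    case False
    have nz: "x = 0" if "norm x \<le> t" for x :: 'a
      using False that norm_le_zero_iff[of x] by linarith
    from False have "(\<integral>\<^sup>+x. G t x \<partial>lborel) = (\<integral>\<^sup>+x. 0 \<partial>(lborel :: 'a measure))" by (simp add: G_def)
    also have "\<dots> = ?R t"
    proof (rule nn_integral_cong_AE)
      show "AE x in (lborel :: 'a measure). 0 = ?H x t"
        by (rule AE_I[of _ _ "{0}"]) (use nz in \<open>auto split: split_indicator\<close>)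
    qed
    finally show ?thesis .
  next
    case t: True
    have "(\<integral>\<^sup>+x. G t x \<partial>lborel) = ennreal ((1 / t) ^ DIM('a)) * (\<integral>\<^sup>+y. G t ((1 / t) *\<^sub>R y) \<partial>lborel)"
      using t by (intro nn_integral_lborel_scale) auto
    also have "\<dots> = (\<integral>\<^sup>+y. ennreal ((1 / t) ^ DIM('a)) * G t ((1 / t) *\<^sub>R y) \<partial>lborel)"
      by (rule nn_integral_cmult[symmetric]) simp
    also have "\<dots> = ?R t"
    proof (rule nn_integral_cong)
      fix y :: 'a
      have 1: "F ((1 / t) *\<^sub>R y) = t powr (- p) * F y"
      proof -
        have "(1 / t) powr p = t powr (- p)"
          using t by (simp add: powr_minus_divide powr_divide)
        then show ?thesis using hom[of "1 / t" y] t by (simp only: zero_less_divide_1_iff)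
      qed
      have 2: "(1 / t) ^ DIM('a) = t powr (- n)"
        using t by (simp add: n_def powr_minus powr_realpow divide_inverse power_inverse)
      have 3: "(norm y / t) powr n = norm y powr n * t powr (- n)"
        using t by (simp add: powr_divide powr_minus_divide)
      have 4: "t powr (- n) * (t powr (q - 1) * (t powr (- p) * t powr (- n))) = t powr (- n - 1)"
        by (simp only: powr_add[symmetric]) (simp add: q_def)
      have 5: "(1 / t) *\<^sub>R y \<in> ?B \<longleftrightarrow> norm y \<le> t" using t by (simp add: field_simps)
      have "ennreal ((1 / t) ^ DIM('a)) * G t ((1 / t) *\<^sub>R y)
        = ennreal (t powr (- n) * (n * t powr (q - 1) * ((t powr (- p) * F y) * (norm y powr n * t powr (- n)))))
          * (indicator K y * indicator {norm y..} t)"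
      proof -
        define s where "s = (1 / t) *\<^sub>R y"
        have s: "t *\<^sub>R s = y" "norm s = norm y / t" "F s = t powr (- p) * F y"
          using t 1 by (auto simp: s_def)
        have i: "indicator ?B s = (indicator {norm y..} t :: ennreal)" "indicator {0<..} t = (1 :: ennreal)"
          using t 5 unfolding s_def indicator_def by auto
        have *: "ennreal a * (ennreal b * 1 * (ennreal c * i * k)) = ennreal (a * (b * c)) * (k * i)"
          if "a \<ge> 0" "b \<ge> 0" "c \<ge> 0" for a b c and i k :: ennreal
          using that by (simp add: ennreal_mult ac_simps)
        show ?thesis
          unfolding G_def s_def[symmetric] s i 2 3
          by (rule *) (use n F0[of y] in auto)
      qed
      also have "t powr (- n) * (n * t powr (q - 1) * ((t powr (- p) * F y) * (norm y powr n * t powr (- n))))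
         = (n * (F y * norm y powr n)) * t powr (- n - 1)"
        by (simp only: 4[symmetric] mult.assoc mult.commute mult.left_commute)
      finally show "ennreal ((1 / t) ^ DIM('a)) * G t ((1 / t) *\<^sub>R y) = ?H y t"
        using n F0[of y] by (simp add: ennreal_mult ac_simps)
    qed
    finally show ?thesis .
  qed
  have ae: "AE x in (lborel :: 'a measure). x \<noteq> 0"
    by (rule AE_I[of _ _ "{0}"]) auto
  have "ennreal (n / q) * (\<integral>\<^sup>+x. ?J x \<partial>lborel)
      = (\<integral>\<^sup>+x. ennreal (n / q) * (?J x) \<partial>lborel)"
    by (rule nn_integral_cmult[symmetric]) measurable
  also have "\<dots> = (\<integral>\<^sup>+x. (\<integral>\<^sup>+t. G t x \<partial>lborel) \<partial>lborel)"
    by (rule nn_integral_cong_AE, rule AE_mp[OF ae], rule AE_I2, rule impI, rule Gx[symmetric])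
  also have "\<dots> = (\<integral>\<^sup>+t. (\<integral>\<^sup>+x. G t x \<partial>lborel) \<partial>lborel)"
    by (rule lborel_pair.Fubini'[symmetric]) (unfold G_def, measurable)
  also have "\<dots> = (\<integral>\<^sup>+t. ?R t \<partial>lborel)"
    by (simp only: Gt)
  also have "\<dots> = (\<integral>\<^sup>+y. (\<integral>\<^sup>+t. ?H y t \<partial>lborel) \<partial>lborel)"
  proof -
    \<comment> \<open>Written as a fixed indicator at \<open>t - norm y\<close>, the integrand is
      visibly measurable in both variables jointly.\<close>
    have *: "indicator {norm y..} t = (indicator {0..} (t - norm y) :: ennreal)" for t and y :: 'a
      by (auto simp: indicator_def)
    show ?thesis
      by (rule lborel_pair.Fubini') (unfold *, measurable)
  qed
  also have "\<dots> = (\<integral>\<^sup>+y. ennreal (F y) * indicator K y \<partial>lborel)"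
  proof (rule nn_integral_cong_AE, rule AE_mp[OF ae], rule AE_I2, rule impI)
    fix y :: 'a assume y: "y \<noteq> 0"
    have "(\<integral>\<^sup>+t. ?H y t \<partial>lborel)
       = (ennreal (n * (F y * norm y powr n)) * indicator K y) * ennreal (norm y powr (- n) / n)"
      by (subst nn_integral_cmult) (use nn_integral_powr_ge[of "norm y" n] y n in auto)
    also have "\<dots> = ennreal (F y) * indicator K y"
      using n F0[of y] y by (auto simp: ennreal_mult[symmetric] powr_minus indicator_def)
    finally show "(\<integral>\<^sup>+t. ?H y t \<partial>lborel)
      = ennreal (F y) * indicator K y" .
  qed
  finally have eq: "(\<integral>\<^sup>+y. ennreal (F y) * indicator K y \<partial>lborel) = ennreal (n / q) *
     (\<integral>\<^sup>+x. ?J x \<partial>lborel)" ..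
  have "(\<integral>\<^sup>+u. ennreal (F u * radial K u powr q) \<partial>sphere_law) =
     (\<integral>\<^sup>+x. ?J x \<partial>lborel) / emeasure lborel ?B"
    by (rule nn_integral_sphere_law) measurable
  then have "emeasure lborel ?B * (\<integral>\<^sup>+u. ennreal (F u * radial K u powr q) \<partial>sphere_law) =
     (\<integral>\<^sup>+x. ?J x \<partial>lborel)"
    using emeasure_cball_01[where 'a='a]
    by (simp only: ennreal_times_divide mult.commute[of "emeasure lborel ?B"] mult_divide_eq_ennreal
          infinity_ennreal_def not_False_eq_True)
  then show ?thesis unfolding eq by (simp add: n_def[symmetric] q_def[symmetric] mult.assoc)
qed

end

section \<open>Cosine moments on the circle\<close>

text \<open>Up to normalization, the Fourier cosine coefficients of the periodic function
  \<open>\<bar>cos t\<bar> powr p\<close>.\<close>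

definition cos_moment :: "real \<Rightarrow> nat \<Rightarrow> real" where
  "cos_moment p k = integral {0..2 * pi} (\<lambda>t. \<bar>cos t\<bar> powr p * cos (real k * t))"

text \<open>The formula persists at 0, where the difference quotient is
  \<open>\<bar>h\<bar> powr p\<close>. This covers the zeros of the cosine in the integration by
  parts and, with \<open>p - 1\<close> in place of \<open>p\<close>, yields the Lipschitz bound for
  the kernel.\<close>

lemma has_real_derivative_abs_powr_times:
  fixes p :: real
  assumes p: "p > 0"
  shows "((\<lambda>x. \<bar>x\<bar> powr p * x) has_real_derivative (p + 1) * \<bar>x\<bar> powr p) (at x)"
proof -
  consider "x > 0" | "x < 0" | "x = 0" by linarith
  then show ?thesis
  proof cases
    case 1
    have "((\<lambda>x. x powr (p + 1)) has_real_derivative (p + 1) * \<bar>x\<bar> powr p) (at x)"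
      using 1 has_real_derivative_powr[of x "p + 1"] by simp
    then show ?thesis
      by (rule has_field_derivative_transform_within_open[of _ _ _ "{0<..}"])
         (use 1 in \<open>auto simp: powr_add\<close>)
  next
    case 2
    have "((\<lambda>x. - ((- x) powr (p + 1))) has_real_derivative (p + 1) * \<bar>x\<bar> powr p) (at x)"
      using 2 by (auto intro!: derivative_eq_intros simp: powr_diff)
    then show ?thesis
      by (rule has_field_derivative_transform_within_open[of _ _ _ "{..<0}"])
         (use 2 in \<open>auto simp: powr_add\<close>)
  next
    case 3
    have "((\<lambda>h::real. \<bar>h\<bar> powr p) \<longlongrightarrow> 0) (at 0)"
      by (rule tendsto_zero_powrI[of _ _ _ p]) (use p in \<open>auto intro!: tendsto_eq_intros\<close>)
    moreover have "\<forall>\<^sub>F h in at 0. \<bar>h\<bar> powr p = ((\<bar>0 + h\<bar> powr p * (0 + h) - \<bar>0\<bar> powr p * 0) / h)"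
      by (simp add: eventually_at_filter)
    ultimately have "((\<lambda>h. (\<bar>0 + h\<bar> powr p * (0 + h) - \<bar>0\<bar> powr p * 0) / h) \<longlongrightarrow> 0) (at 0)"
      by (rule Lim_transform_eventually)
    then show ?thesis using 3 p by (simp add: DERIV_def)
  qed
qed

lemma continuous_on_abs_cos_powr [continuous_intros]:
  "p > 0 \<Longrightarrow> continuous_on S f \<Longrightarrow> continuous_on S (\<lambda>t. \<bar>cos (f t)\<bar> powr p)"
  for p :: real and f :: "real \<Rightarrow> real"
  by (intro continuous_on_powr' continuous_intros) auto

text \<open>The function \<open>F\<close> of the proof takes the same value at both ends of the
  period, so its derivative integrates to 0; the addition formulas write that derivative as a
  combination of the integrands for \<open>k\<close> and \<open>k + 2\<close>.\<close>

lemma cos_moment_Suc_Suc: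
  assumes p: "p > 0"
  shows "(p + real k + 2) * cos_moment p (k + 2) = (p - real k) * cos_moment p k"
proof -
  define g where "g j t = \<bar>cos t\<bar> powr p * cos (real j * t)" for j t
  define F where "F t = \<bar>cos t\<bar> powr p * cos t * sin ((real k + 1) * t)" for t
  have eq: "- (p + 1) * \<bar>cos t\<bar> powr p * sin t * sin ((real k + 1) * t)
      + (real k + 1) * \<bar>cos t\<bar> powr p * cos t * cos ((real k + 1) * t)
      = (real k - p) / 2 * g k t + (p + real k + 2) / 2 * g (k + 2) t" (is "?D t = _") for t
  proof -
    have "real k * t = (real k + 1) * t - t" "real (k + 2) * t = (real k + 1) * t + t"
      by (simp_all add: algebra_simps)
    then have "g k t = \<bar>cos t\<bar> powr p * (cos ((real k + 1) * t) * cos t + sin ((real k + 1) * t) * sin t)"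
      "g (k + 2) t = \<bar>cos t\<bar> powr p * (cos ((real k + 1) * t) * cos t - sin ((real k + 1) * t) * sin t)"
      unfolding g_def by (simp_all only: cos_diff cos_add)
    moreover have "- (p + 1) * A * s * S + (K + 1) * A * c * C
        = (K - p) / 2 * (A * (C * c + S * s)) + (p + K + 2) / 2 * (A * (C * c - S * s))"
      for A C c s S K :: real
      by (simp add: field_simps)
    ultimately show ?thesis by (simp only:)
  qed
  have "(F has_real_derivative ?D t) (at t)" for t
  proof -
    have "((\<lambda>t. \<bar>cos t\<bar> powr p * cos t) has_real_derivative (p + 1) * \<bar>cos t\<bar> powr p * (- sin t)) (at t)"
      by (rule DERIV_chain2[where f="\<lambda>x. \<bar>x\<bar> powr p * x" and g=cos])
         (rule has_real_derivative_abs_powr_times[OF p], rule DERIV_cos)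
    moreover have "((\<lambda>t. sin ((real k + 1) * t)) has_real_derivative cos ((real k + 1) * t) * (real k + 1)) (at t)"
      by (auto intro!: derivative_eq_intros)
    ultimately show ?thesis
      unfolding F_def by (rule DERIV_cong[OF DERIV_mult]) (simp add: algebra_simps)
  qed
  then have "(F has_vector_derivative ((real k - p) / 2 * g k t + (p + real k + 2) / 2 * g (k + 2) t)) (at t within {0..2 * pi})" for t
    unfolding eq[symmetric] has_real_derivative_iff_has_vector_derivative[symmetric]
    using has_field_derivative_at_within by blast
  then have I1: "((\<lambda>t. (real k - p) / 2 * g k t + (p + real k + 2) / 2 * g (k + 2) t) has_integral (F (2 * pi) - F 0)) {0..2 * pi}"
    by (intro fundamental_theorem_of_calculus) auto
  have "sin ((real k + 1) * (2 * pi)) = 0"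
    using sin_integer_2pi[of "(real k + 1)"] by (simp add: mult.commute mult.left_commute)
  then have F0: "F (2 * pi) - F 0 = 0"
    by (simp add: F_def)
  have I2: "((\<lambda>t. (real k - p) / 2 * g k t + (p + real k + 2) / 2 * g (k + 2) t) has_integral
      ((real k - p) / 2 * cos_moment p k + (p + real k + 2) / 2 * cos_moment p (k + 2))) {0..2 * pi}"
  proof -
    have "(g j has_integral cos_moment p j) {0..2 * pi}" for j
      unfolding g_def[abs_def] cos_moment_def
      by (intro integrable_integral integrable_continuous_interval continuous_intros p)
    then show ?thesis by (intro has_integral_add has_integral_mult_right) auto
  qed
  have "(real k - p) / 2 * cos_moment p k + (p + real k + 2) / 2 * cos_moment p (k + 2) = 0"
    using has_integral_unique[OF I1 I2] F0 by (simp only:)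
  then show ?thesis by argo
qed

lemma cos_moment_0_pos:
  assumes p: "p > 0"
  shows "cos_moment p 0 > 0"
proof -
  let ?f = "\<lambda>t. \<bar>cos t\<bar> powr p"
  have c: "continuous_on {0..2 * pi} ?f" by (intro continuous_intros p)
  have eq: "cos_moment p 0 = integral {0..2 * pi} ?f" by (simp add: cos_moment_def)
  have "integral {0..2 * pi} ?f \<noteq> 0"
    using integral_eq_0_iff[OF c] pi_gt_zero by force
  moreover have "integral {0..2 * pi} ?f \<ge> 0"
    by (intro integral_nonneg integrable_continuous_interval c) auto
  ultimately show ?thesis by (simp add: eq)
qed

lemma cos_moment_2: "p > 0 \<Longrightarrow> cos_moment p 2 = p / (p + 2) * cos_moment p 0"
  using cos_moment_Suc_Suc[of p 0] by (simp add: field_simps numeral_2_eq_2)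

text \<open>Each step of the recursion multiplies the absolute value by |p - j| / (p + j + 2) < 1.
  Strictness is taken from the step j = 2 alone, since later moments can be 0, as for even integers
  \<open>p\<close>.\<close>

lemma abs_cos_moment_less:
  assumes p: "p > 0" and k: "even k" "k \<ge> 4"
  shows "\<bar>cos_moment p k\<bar> < cos_moment p 2"
proof -
  have step: "\<bar>cos_moment p (j + 2)\<bar> = \<bar>p - real j\<bar> / (p + real j + 2) * \<bar>cos_moment p j\<bar>" for j
  proof -
    have "\<bar>(p + real j + 2) * cos_moment p (j + 2)\<bar> = \<bar>(p - real j) * cos_moment p j\<bar>"
      by (simp only: cos_moment_Suc_Suc[OF p])
    then have 1: "\<bar>p + real j + 2\<bar> * \<bar>cos_moment p (j + 2)\<bar> = \<bar>p - real j\<bar> * \<bar>cos_moment p j\<bar>"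
      by (simp only: abs_mult)
    have 2: "\<bar>p + real j + 2\<bar> = p + real j + 2" "p + real j + 2 \<noteq> 0" using p by auto
    have "x = c / a * y" if "a * x = c * y" "a \<noteq> 0" for a c x y :: real
      using that by (metis nonzero_mult_div_cancel_left times_divide_eq_left)
    from this[OF 1[unfolded 2(1)] 2(2)] show ?thesis .
  qed
  have c2: "cos_moment p 2 > 0"
    using p cos_moment_0_pos[OF p] by (simp add: cos_moment_2)
  have "\<bar>cos_moment p (2 * i + 4)\<bar> < cos_moment p 2" for i
  proof (induction i)
    case 0
    have "\<bar>p - real 2\<bar> / (p + real 2 + 2) < 1" using p by (simp add: abs_if)
    then have "\<bar>cos_moment p (2 + 2)\<bar> < 1 * \<bar>cos_moment p 2\<bar>"
      unfolding step using c2 by (intro mult_strict_right_mono) auto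
    then show ?case using c2 by simp
  next
    case (Suc i)
    have "\<bar>p - real (2 * i + 4)\<bar> / (p + real (2 * i + 4) + 2) \<le> 1" using p by (simp add: abs_if)
    then have "\<bar>cos_moment p (2 * i + 4 + 2)\<bar> \<le> 1 * \<bar>cos_moment p (2 * i + 4)\<bar>"
      unfolding step by (intro mult_right_mono) auto
    then show ?case using Suc by (simp add: add.commute)
  qed
  moreover obtain i where "k = 2 * i + 4"
    using k by (metis dvd_diff_nat dvdE le_add_diff_inverse2 even_numeral)
  ultimately show ?thesis by blast
qed

lemma integral_shift_cos:
  assumes p: "p > 0" and b: "0 \<le> b" "b \<le> 2 * pi"
  shows "integral {0..2 * pi} (\<lambda>t. \<bar>cos (t + b)\<bar> powr p * cos (real k * (t + b))) = cos_moment p k"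
proof -
  define g where "g t = \<bar>cos t\<bar> powr p * cos (real k * t)" for t
  have cg: "continuous_on S g" for S unfolding g_def by (intro continuous_intros p)
  have int: "g integrable_on {x..y}" for x y by (intro integrable_continuous_interval cg)
  have per: "g (t + 2 * pi) = g t" for t
  proof -
    have "cos (real k * (t + 2 * pi)) = cos (real k * t)"
      using cos.plus_of_nat[of "real k * t" k] by (simp add: algebra_simps)
    then show ?thesis by (simp add: g_def)
  qed
  have "integral {0..2 * pi} (\<lambda>t. g (t + b)) = integral {b..2 * pi + b} g"
    using integral_shift[OF cg, of 0 "2 * pi" b] by (simp add: o_def)
  also have "\<dots> = integral {b..2 * pi} g + integral {2 * pi..2 * pi + b} g"
    by (rule Henstock_Kurzweil_Integration.integral_combine[symmetric]) (use b int in auto)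
  also have "integral {2 * pi..2 * pi + b} g = integral {0..b} g"
    using integral_shift[OF cg, of 0 b "2 * pi"] by (simp add: o_def per add.commute)
  also have "integral {b..2 * pi} g + integral {0..b} g = integral {0..2 * pi} g"
    using Henstock_Kurzweil_Integration.integral_combine[of 0 b "2 * pi" g] b int by simp
  finally show ?thesis by (simp add: g_def[abs_def] cos_moment_def)
qed

lemma integral_rotate_cos_moment:
  fixes x y :: real
  assumes p: "p > 0"
  shows "integral {0..2 * pi} (\<lambda>t. \<bar>cos t * x + sin t * y\<bar> powr p * Re (Complex (cos t * x + sin t * y) (- sin t * x + cos t * y) ^ k))
     = norm (Complex x y) powr (p + real k) * cos_moment p k"
proof -
  define r where "r = norm (Complex x y)"
  \<comment> \<open>The angle is that of the conjugate: rotation by \<open>t\<close> then turns the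
    pair into r cos (t + b), - r sin (t + b), and conjugation leaves the real part of the power
    unchanged. \<open>Arg2pi\<close> puts \<open>b\<close> in the range that
    \<open>integral_shift_cos\<close> expects.\<close>
  define b where "b = Arg2pi (Complex x (- y))"
  have r0: "r \<ge> 0" by (simp add: r_def)
  have b: "0 \<le> b" "b \<le> 2 * pi" using Arg2pi[of "Complex x (- y)"] by (auto simp: b_def)
  have "norm (Complex x (- y)) = r" by (simp add: r_def cmod_def)
  then have "Complex x (- y) = complex_of_real r * cis b"
    using Arg2pi_eq[of "Complex x (- y)"] Arg2pi[of "Complex x (- y)"] by (simp add: b_def cis_conv_exp)
  then have xy: "x = r * cos b" "y = - r * sin b"
    by (auto simp: complex_eq_iff)
  have re: "cos t * x + sin t * y = r * cos (t + b)" "- sin t * x + cos t * y = - r * sin (t + b)" for t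
    by (simp_all add: xy cos_add sin_add algebra_simps)
  have pw: "Re (Complex (r * cos s) (- r * sin s) ^ k) = r ^ k * cos (real k * s)" for s
  proof -
    have "Complex (r * cos s) (- r * sin s) = complex_of_real r * cis (- s)"
      by (simp add: complex_eq_iff)
    then have "Complex (r * cos s) (- r * sin s) ^ k = complex_of_real (r ^ k) * cis (real k * (- s))"
      by (simp only: power_mult_distrib Complex.DeMoivre of_real_power)
    then show ?thesis by simp
  qed
  have rk: "r powr p * r ^ k = r powr (p + real k)"
    using r0 by (cases "r = 0") (auto simp: powr_add powr_realpow)
  have "integral {0..2 * pi} (\<lambda>t. \<bar>r * cos (t + b)\<bar> powr p * (r ^ k * cos (real k * (t + b))))
      = integral {0..2 * pi} (\<lambda>t. r powr (p + real k) * (\<bar>cos (t + b)\<bar> powr p * cos (real k * (t + b))))"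
    using r0 by (intro arg_cong[where f="integral _"] ext) (simp add: abs_mult powr_mult rk[symmetric])
  also have "\<dots> = r powr (p + real k) * cos_moment p k"
    by (simp add: integral_shift_cos[OF p b])
  finally show ?thesis unfolding re pw by (simp add: r_def)
qed

section \<open>Multipliers of the cosine transform\<close>

lemma integrable_sphere_law:
  fixes f :: "'a::euclidean_space \<Rightarrow> real"
  assumes f: "f \<in> borel_measurable borel" and B: "\<And>u. norm u = 1 \<Longrightarrow> \<bar>f u\<bar> \<le> B"
  shows "integrable sphere_law f"
proof (rule sphere_law.integrable_const_bound[where B=B])
  show "AE u in sphere_law. norm (f u) \<le> B"
    using AE_sphere_law by eventually_elim (simp add: B)
qed (use f in simp)

lemma integral_sphere_law_cong:
  fixes f g :: "'a::euclidean_space \<Rightarrow> real"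
  assumes "f \<in> borel_measurable borel" "g \<in> borel_measurable borel" "\<And>u. norm u = 1 \<Longrightarrow> f u = g u"
  shows "integral\<^sup>L sphere_law f = integral\<^sup>L sphere_law g"
proof (rule integral_cong_AE)
  show "AE u in sphere_law. f u = g u"
    using AE_sphere_law by eventually_elim (simp add: assms)
qed (use assms in simp_all)

lemma norm_power2_eq_sum_Basis: "norm u ^ 2 = (\<Sum>e\<in>Basis. (e \<bullet> u) ^ 2)"
  unfolding power2_norm_eq_inner euclidean_inner[of u u] by (simp add: power2_eq_square inner_commute)

lemma abs_inner_le_1: "norm a = 1 \<Longrightarrow> norm u = 1 \<Longrightarrow> \<bar>a \<bullet> u\<bar> \<le> 1"
  using Cauchy_Schwarz_ineq2[of a u] by simp

lemma abs_inner_powr_le_1: "norm a = 1 \<Longrightarrow> norm u = 1 \<Longrightarrow> p \<ge> 0 \<Longrightarrow> cos_kernel p a u \<le> 1"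
  using powr_mono2[of p "\<bar>a \<bullet> u\<bar>" 1] abs_inner_le_1[of a u] by simp

lemma cos_moment_odd:
  assumes "p > 0" "odd k"
  shows "cos_moment p k = 0"
proof -
  have "cos (real k * (t + pi)) = - cos (real k * t)" for t
    using assms(2) by (simp add: distrib_left cos_add)
  then have "cos_moment p k = integral {0..2 * pi} (\<lambda>t. - (\<bar>cos t\<bar> powr p * cos (real k * t)))"
    using integral_shift_cos[OF assms(1), of pi k] by simp
  then show ?thesis by (simp add: cos_moment_def)
qed

text \<open>The pair only serves to define moments and multipliers; by \<open>pair_moment_eq\<close>
  their values are the same for every orthonormal pair. Its existence expresses that the dimension
  is at least 2.\<close>

locale orthonormal_pair =
  fixes a b :: "'a::euclidean_space"
  assumes norm_a: "norm a = 1" and norm_b: "norm b = 1" and orth_ab: "a \<bullet> b = 0"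
begin

definition pair_moment :: "real \<Rightarrow> nat \<Rightarrow> nat \<Rightarrow> real" where
  "pair_moment p i j = (\<integral>\<^sub>Su. cos_kernel p a u * (a \<bullet> u) ^ i * (b \<bullet> u) ^ j)"

lemma pair_moment_eq:
  fixes c d :: 'a
  assumes "norm c = 1" "norm d = 1" "c \<bullet> d = 0"
  shows "(\<integral>\<^sub>Su. cos_kernel p c u * (c \<bullet> u) ^ i * (d \<bullet> u) ^ j) = pair_moment p i j"
  unfolding pair_moment_def
  by (rule integral_sphere_law_pair[of c d a b "\<lambda>x y. \<bar>x\<bar> powr p * x ^ i * y ^ j"])
     (use assms norm_a norm_b orth_ab in \<open>simp_all add: borel_prod[symmetric]\<close>)

lemma integrable_pair_moment:
  fixes c d :: 'a
  assumes "norm c = 1" "norm d = 1" "p \<ge> 0"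
  shows "integrable sphere_law (\<lambda>u. cos_kernel p c u * (c \<bullet> u) ^ i * (d \<bullet> u) ^ j)"
proof (rule integrable_sphere_law[where B=1])
  fix u :: 'a assume u: "norm u = 1"
  have "cos_kernel p c u * \<bar>c \<bullet> u\<bar> ^ i * \<bar>d \<bullet> u\<bar> ^ j \<le> 1 * 1 * 1"
    using abs_inner_le_1[OF assms(1) u] abs_inner_le_1[OF assms(2) u] abs_inner_powr_le_1[OF assms(1) u assms(3)]
    by (intro mult_mono power_le_one) auto
  then show "\<bar>cos_kernel p c u * (c \<bullet> u) ^ i * (d \<bullet> u) ^ j\<bar> \<le> 1"
    by (simp add: abs_mult power_abs)
qed simp

lemma pair_moment_odd: "odd j \<Longrightarrow> pair_moment p i j = 0"
  using pair_moment_eq[of a "- b" p i j] norm_a norm_b orth_ab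
  by (simp add: pair_moment_def)

text \<open>The result of expanding (e.u)^k for e = c \<theta> + s w with w orthogonal to \<theta>:
  odd powers of s come with vanishing moments, and s^2 = 1 - c^2 is the factor
  \<open>[:1, 0, -1:]\<close>. Thus the transform of the k-th power of e.u, evaluated at \<theta>,
  is a polynomial in c = e.\<theta>, as in the Funk-Hecke formula.\<close>

definition moment_poly :: "real \<Rightarrow> nat \<Rightarrow> real poly" where
  "moment_poly p k = (\<Sum>i\<le>k. if even i then smult (real (k choose i) * pair_moment p (k - i) i)
     (monom 1 (k - i) * [:1, 0, -1:] ^ (i div 2)) else 0)"

lemma orthonormal_decomposition:
  fixes \<theta> e :: 'a
  assumes "norm \<theta> = 1" "norm e = 1"
  obtains w s where "norm w = 1" "\<theta> \<bullet> w = 0" "e = (e \<bullet> \<theta>) *\<^sub>R \<theta> + s *\<^sub>R w" "s ^ 2 = 1 - (e \<bullet> \<theta>) ^ 2"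
proof -
  define v where "v = e - (e \<bullet> \<theta>) *\<^sub>R \<theta>"
  have tt: "\<theta> \<bullet> \<theta> = 1" "e \<bullet> e = 1" using assms by (simp_all add: norm_eq_1)
  have tv: "\<theta> \<bullet> v = 0" by (simp add: v_def inner_diff_right tt inner_commute)
  have vv: "v \<bullet> v = 1 - (e \<bullet> \<theta>) ^ 2"
    by (simp add: v_def inner_diff_right inner_diff_left tt inner_commute power2_eq_square)
  show ?thesis
  proof (cases "v = 0")
    case False
    show ?thesis
      by (rule that[of "v /\<^sub>R norm v" "norm v"])
         (use False tv vv in \<open>auto simp: v_def power2_norm_eq_inner\<close>)
  next
    case True
    \<comment> \<open>Here \<open>e\<close> is a multiple of \<theta>, so \<open>s = 0\<close> and
      any unit vector orthogonal to \<theta> will do; the image of \<open>b\<close> under an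
      isometry taking \<open>a\<close> to \<theta> is one.\<close>
    obtain g where g: "orthogonal_transformation g" "g a = \<theta>"
    proof (rule that[of "reflection (a - \<theta>)"])
      show "reflection (a - \<theta>) a = \<theta>" using assms norm_a by (intro reflection_swap) simp
    qed (rule orthogonal_transformation_reflection)
    have "norm (g b) = 1" "\<theta> \<bullet> g b = 0"
      using g norm_b orth_ab orthogonal_transformation_norm[OF g(1)]
      unfolding orthogonal_transformation_def by auto
    then show ?thesis
      by (rule that[where s=0]) (use True vv in \<open>auto simp: v_def\<close>)
  qed
qed

lemma integral_powr_power_eq_poly:
  fixes \<theta> e :: 'a
  assumes "norm \<theta> = 1" "norm e = 1" and p: "p \<ge> 0"
  shows "(\<integral>\<^sub>Su. cos_kernel p \<theta> u * (e \<bullet> u) ^ k) = poly (moment_poly p k) (e \<bullet> \<theta>)"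
proof -
  obtain w s where w: "norm w = 1" "\<theta> \<bullet> w = 0" and e: "e = (e \<bullet> \<theta>) *\<^sub>R \<theta> + s *\<^sub>R w"
    and s: "s ^ 2 = 1 - (e \<bullet> \<theta>) ^ 2"
    using orthonormal_decomposition[OF assms(1,2)] by metis
  define c where "c = e \<bullet> \<theta>"
  have eu: "e \<bullet> u = s * (w \<bullet> u) + c * (\<theta> \<bullet> u)" for u
    by (subst e) (simp add: c_def inner_add_left)
  have "(\<integral>\<^sub>Su. cos_kernel p \<theta> u * (e \<bullet> u) ^ k) =
     (\<integral>\<^sub>Su. (\<Sum>i\<le>k. real (k choose i) * s ^ i * c ^ (k - i) * (cos_kernel p \<theta> u * (\<theta> \<bullet> u) ^ (k - i) * (w \<bullet> u) ^ i)))"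
    unfolding eu binomial_ring
    by (intro arg_cong[where f="integral\<^sup>L sphere_law"] ext)
       (simp add: sum_distrib_left power_mult_distrib ac_simps)
  also have "\<dots> = (\<Sum>i\<le>k. real (k choose i) * s ^ i * c ^ (k - i) * pair_moment p (k - i) i)"
    by (subst Bochner_Integration.integral_sum)
       (auto intro!: integrable_mult_right integrable_pair_moment simp: pair_moment_eq assms w)
  also have "\<dots> = (\<Sum>i\<le>k. if even i then real (k choose i) * pair_moment p (k - i) i *
      (c ^ (k - i) * (1 - c ^ 2) ^ (i div 2)) else 0)"
  proof (rule sum.cong[OF refl])
    fix i
    show "real (k choose i) * s ^ i * c ^ (k - i) * pair_moment p (k - i) i =
      (if even i then real (k choose i) * pair_moment p (k - i) i * (c ^ (k - i) * (1 - c ^ 2) ^ (i div 2)) else 0)"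
    proof (cases "even i")
      case True
      then have "s ^ i = (s ^ 2) ^ (i div 2)" by (simp flip: power_mult)
      then show ?thesis using True s by (simp add: c_def)
    qed (simp add: pair_moment_odd)
  qed
  also have "\<dots> = poly (moment_poly p k) c"
    unfolding moment_poly_def poly_sum
    by (intro sum.cong refl) (simp add: poly_monom power2_eq_square)
  finally show ?thesis by (simp add: c_def)
qed

text \<open>The transform is triangular on powers of e.u, and this is its diagonal entry,
  classically the eigenvalue on harmonics of degree \<open>k\<close>. The coefficient at
  \<open>k\<close> is taken instead of the leading one because it can be 0.\<close>

definition multiplier :: "real \<Rightarrow> nat \<Rightarrow> real" where
  "multiplier p k = coeff (moment_poly p k) k"

lemma coeff_monom_mult_power:
  "coeff (monom 1 m * [:1, 0, -1 :: real:] ^ j) (m + 2 * j) = (-1) ^ j"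
proof -
  have "degree ([:1, 0, -1 :: real:] ^ j) = 2 * j" by (simp add: degree_power_eq)
  then have "coeff ([:1, 0, -1 :: real:] ^ j) (2 * j) = (-1) ^ j"
    using lead_coeff_power[of "[:1, 0, -1 :: real:]" j] by simp
  then show ?thesis by (simp add: coeff_monom_mult)
qed

lemma degree_moment_poly: "degree (moment_poly p k) \<le> k"
  unfolding moment_poly_def
proof (rule degree_sum_le)
  fix i assume i: "i \<in> {..k}"
  have "degree (monom 1 (k - i) * [:1, 0, -1 :: real:] ^ (i div 2)) \<le> (k - i) + 2 * (i div 2)"
    using degree_mult_le[of "monom 1 (k - i)" "[:1, 0, -1 :: real:] ^ (i div 2)"]
    by (simp add: degree_power_eq degree_monom_eq)
  also have "\<dots> \<le> k" using i by auto
  finally show "degree (if even i then smult (real (k choose i) * pair_moment p (k - i) i)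
     (monom 1 (k - i) * [:1, 0, -1:] ^ (i div 2)) else 0) \<le> k"
    using degree_smult_le order_trans by auto
qed simp

lemma multiplier_eq_sum:
  "multiplier p k = (\<Sum>i\<le>k. if even i then real (k choose i) * pair_moment p (k - i) i * (-1) ^ (i div 2) else 0)"
  unfolding multiplier_def moment_poly_def coeff_sum
proof (intro sum.cong refl)
  fix i assume "i \<in> {..k}"
  then show "coeff (if even i then smult (real (k choose i) * pair_moment p (k - i) i)
     (monom 1 (k - i) * [:1, 0, -1:] ^ (i div 2)) else 0) k =
     (if even i then real (k choose i) * pair_moment p (k - i) i * (-1) ^ (i div 2) else 0)"
    using coeff_monom_mult_power[of "k - i" "i div 2"] by auto
qed

lemma Re_Complex_power:
  "Re (Complex x y ^ k) = (\<Sum>i\<le>k. if even i then real (k choose i) * (x ^ (k - i) * y ^ i) * (-1) ^ (i div 2) else 0)"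
proof -
  have Re_i: "Re (\<i> ^ i) = (if even i then (-1) ^ (i div 2) else 0)" for i
  proof (cases "even i")
    case True
    then have "\<i> ^ i = (-1) ^ (i div 2)" by (metis dvd_mult_div_cancel power2_i power_mult)
    also have "\<dots> = complex_of_real ((-1) ^ (i div 2))" by simp
    finally show ?thesis using True by simp
  next
    case False
    then have "\<i> ^ i = \<i> * (-1) ^ (i div 2)" by (metis dvd_mult_div_cancel odd_two_times_div_two_succ power2_i power_mult power_add power_one_right mult.commute)
    also have "\<dots> = \<i> * complex_of_real ((-1) ^ (i div 2))" by simp
    finally show ?thesis using False by simp
  qed
  have "Complex x y = \<i> * complex_of_real y + complex_of_real x"
    by (simp add: complex_eq_iff)
  then have "Complex x y ^ k = (\<Sum>i\<le>k. of_nat (k choose i) * (\<i> * complex_of_real y) ^ i * complex_of_real x ^ (k - i))"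
    by (simp only: binomial_ring)
  also have "\<dots> = (\<Sum>i\<le>k. complex_of_real (real (k choose i) * (x ^ (k - i) * y ^ i)) * \<i> ^ i)"
    by (intro sum.cong refl) (simp add: power_mult_distrib)
  finally have "Re (Complex x y ^ k) = (\<Sum>i\<le>k. (real (k choose i) * (x ^ (k - i) * y ^ i)) * Re (\<i> ^ i))"
    by (simp del: of_real_mult of_real_power)
  then show ?thesis by (simp only: Re_i if_distrib mult_zero_right)
qed

text \<open>The signs that the top coefficient picks up from powers of 1 - c^2 are the signs of the
  even powers of the imaginary unit, so the sum reassembles into a harmonic polynomial of the two
  coordinates.\<close>

lemma multiplier_eq_integral:
  assumes p: "p \<ge> 0"
  shows "multiplier p k = (\<integral>\<^sub>Su. cos_kernel p a u * Re (Complex (a \<bullet> u) (b \<bullet> u) ^ k))"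
proof -
  have "(\<integral>\<^sub>Su. cos_kernel p a u * Re (Complex (a \<bullet> u) (b \<bullet> u) ^ k)) =
     (\<integral>\<^sub>Su. (\<Sum>i\<le>k. (if even i then real (k choose i) * (-1) ^ (i div 2) else 0) * (cos_kernel p a u * (a \<bullet> u) ^ (k - i) * (b \<bullet> u) ^ i)))"
    unfolding Re_Complex_power sum_distrib_left
    by (intro arg_cong[where f="integral\<^sup>L sphere_law"] ext sum.cong refl) simp
  also have "\<dots> = (\<Sum>i\<le>k. (if even i then real (k choose i) * (-1) ^ (i div 2) else 0) * pair_moment p (k - i) i)"
    using integrable_pair_moment[OF norm_a norm_b p]
    by (subst Bochner_Integration.integral_sum) (auto simp: pair_moment_def)
  also have "\<dots> = multiplier p k"
    unfolding multiplier_eq_sum by (intro sum.cong refl) simp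
  finally show ?thesis by simp
qed

abbreviation plane_norm :: "'a \<Rightarrow> real" where
  "plane_norm u \<equiv> norm (Complex (a \<bullet> u) (b \<bullet> u))"

lemma norm_Complex_inner_le_1:
  assumes u: "norm u = 1"
  shows "plane_norm u \<le> 1"
proof -
  have "0 \<le> (u - (a \<bullet> u) *\<^sub>R a - (b \<bullet> u) *\<^sub>R b) \<bullet> (u - (a \<bullet> u) *\<^sub>R a - (b \<bullet> u) *\<^sub>R b)" by simp
  also have "\<dots> = 1 - ((a \<bullet> u) ^ 2 + (b \<bullet> u) ^ 2)"
    using u norm_a norm_b orth_ab
    by (simp add: norm_eq_1 inner_diff_left inner_diff_right inner_commute power2_eq_square algebra_simps)
  finally show ?thesis by (simp add: cmod_def)
qed

text \<open>Moments of the length of the projection onto the plane of \<open>a\<close> and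
  \<open>b\<close>; unrelated to \<open>radial\<close>.\<close>

definition radial_moment :: "real \<Rightarrow> real" where
  "radial_moment q = (\<integral>\<^sub>Su. plane_norm u powr q)"

text \<open>Averaging over the rotations of the plane spanned by \<open>a\<close> and \<open>b\<close> separates the variables.\<close>

lemma integral_plane_average:
  assumes p: "p > 0"
  shows "2 * pi * (\<integral>\<^sub>Su. plane_norm u ^ j * (cos_kernel p a u * Re (Complex (a \<bullet> u) (b \<bullet> u) ^ k)))
     = radial_moment (p + real k + real j) * cos_moment p k"
proof -
  \<comment> \<open>The additional factor \<open>norm (Complex x y) ^ j\<close> is invariant under
    rotations of the plane. With \<open>j = 0\<close> the formula gives the multipliers;
    \<open>j = 2\<close>, \<open>k = 0\<close> gives the sum of two second moments in
    \<open>pair_moment_0_2\<close>.\<close>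
  define H where "H x y = norm (Complex x y) ^ j * (\<bar>x\<bar> powr p * Re (Complex x y ^ k))" for x y
  define I where "I = (\<integral>\<^sub>Su. H (a \<bullet> u) (b \<bullet> u))"
  have Hcont: "continuous_on UNIV (case_prod H)"
  proof -
    have c: "continuous_on UNIV (\<lambda>z::real \<times> real. Complex (fst z) (snd z))"
      unfolding complex_eq by (intro continuous_intros)
    have "continuous_on UNIV (\<lambda>z::real \<times> real. \<bar>fst z\<bar> powr p)"
      using p by (intro continuous_on_powr' continuous_intros) auto
    then show ?thesis
      unfolding H_def case_prod_beta
      by (intro continuous_on_mult continuous_on_Re continuous_on_power continuous_on_norm c)
  qed
  then have Hmeas: "case_prod H \<in> borel_measurable borel"
    by (rule borel_measurable_continuous_onI)
  define N where "N = density lborel (indicator {0..2 * pi} :: real \<Rightarrow> ennreal)"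
  have N: "finite_measure N"
    by standard (simp add: N_def emeasure_density)
  interpret N: finite_measure N by (rule N)
  have [measurable_cong]: "sets N = sets borel" by (simp add: N_def)
  have intN: "(\<integral>t. f t \<partial>N) = integral {0..2 * pi} f" if "continuous_on {0..2 * pi} f" "f \<in> borel_measurable borel" for f :: "real \<Rightarrow> real"
  proof -
    have "(\<integral>t. f t \<partial>N) = (LINT t:{0..2 * pi}|lborel. f t)"
      unfolding N_def set_lebesgue_integral_def
      using integral_density[of f lborel "indicator {0..2 * pi}"] that(2) by (simp add: ennreal_indicator)
    also have "\<dots> = integral {0..2 * pi} f"
      by (intro set_borel_integral_eq_integral) (unfold set_integrable_def, rule borel_integrable_compact, rule compact_Icc, rule that(1))
    finally show ?thesis .
  qed
  define x y where "x t u = cos t * (a \<bullet> u) + sin t * (b \<bullet> u)" and "y t u = - sin t * (a \<bullet> u) + cos t * (b \<bullet> u)" for t and u :: 'a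
  \<comment> \<open>For fixed \<open>t\<close> the rotated pair is orthonormal again, so the sphere
    integral does not see the rotation and may be averaged over \<open>t\<close>.\<close>
  have rot: "(\<integral>\<^sub>Su. H (x t u) (y t u)) = I" for t
  proof -
    let ?a = "cos t *\<^sub>R a + sin t *\<^sub>R b" and ?b = "- sin t *\<^sub>R a + cos t *\<^sub>R b"
    have aa: "a \<bullet> a = 1" "b \<bullet> b = 1" "b \<bullet> a = 0"
      using norm_a norm_b orth_ab by (simp_all add: norm_eq_1 inner_commute)
    have "norm ?a = 1" "norm ?b = 1" "?a \<bullet> ?b = 0"
      using orth_ab
      by (simp_all add: norm_eq_1 inner_add_left inner_add_right inner_diff_left inner_diff_right aa flip: power2_eq_square)
    from integral_sphere_law_pair[OF this norm_a norm_b orth_ab Hmeas]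
    show ?thesis by (simp add: x_def y_def I_def inner_add_left inner_diff_left)
  qed
  have nxy: "norm (Complex (x t u) (y t u)) = plane_norm u" for t u
  proof -
    have "(x t u)\<^sup>2 + (y t u)\<^sup>2 = ((a \<bullet> u)\<^sup>2 + (b \<bullet> u)\<^sup>2) * ((cos t)\<^sup>2 + (sin t)\<^sup>2)"
      unfolding x_def y_def by algebra
    then show ?thesis by (simp add: cmod_def)
  qed
  have inner: "(\<integral>t. H (x t u) (y t u) \<partial>N) = plane_norm u powr (p + real k + real j) * cos_moment p k" for u
  proof -
    have "continuous_on UNIV (\<lambda>t. H (x t u) (y t u))"
    proof -
      have "continuous_on UNIV (\<lambda>t. (x t u, y t u))"
        unfolding x_def y_def by (intro continuous_intros)
      from continuous_on_compose2[OF Hcont this] show ?thesis by simp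
    qed
    then have "(\<integral>t. H (x t u) (y t u) \<partial>N) = integral {0..2 * pi} (\<lambda>t. H (x t u) (y t u))"
      by (intro intN borel_measurable_continuous_onI) (auto intro: continuous_on_subset)
    also have "\<dots> = plane_norm u ^ j * integral {0..2 * pi} (\<lambda>t. \<bar>x t u\<bar> powr p * Re (Complex (x t u) (y t u) ^ k))"
      unfolding H_def nxy by simp
    also have "\<dots> = plane_norm u ^ j * (plane_norm u powr (p + real k) * cos_moment p k)"
      unfolding x_def y_def integral_rotate_cos_moment[OF p] ..
    also have "\<dots> = plane_norm u powr (p + real k + real j) * cos_moment p k"
      using p by (cases "plane_norm u = 0") (auto simp: powr_add powr_realpow)
    finally show ?thesis .
  qed
  interpret P: pair_sigma_finite N "sphere_law :: 'a measure" ..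
  have fin: "finite_measure (N \<Otimes>\<^sub>M (sphere_law :: 'a measure))"
    by (rule finite_measure_pair_measure) (rule sphere_law.finite_measure_axioms, rule N)
  have meas: "(\<lambda>(t, u). H (x t u) (y t u)) \<in> borel_measurable (N \<Otimes>\<^sub>M sphere_law)"
    using Hmeas[unfolded borel_prod[symmetric]] unfolding x_def y_def by measurable
  have bound: "\<bar>H (x t u) (y t u)\<bar> \<le> 1" if u: "norm u = 1" for t u
  proof -
    have n: "norm (Complex (x t u) (y t u)) \<le> 1" unfolding nxy by (rule norm_Complex_inner_le_1[OF u])
    have "\<bar>x t u\<bar> \<le> 1" using n abs_Re_le_cmod[of "Complex (x t u) (y t u)"] by simp
    then have "\<bar>x t u\<bar> powr p \<le> 1" using powr_mono2[of p "\<bar>x t u\<bar>" 1] p by simp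
    moreover have "\<bar>Re (Complex (x t u) (y t u) ^ k)\<bar> \<le> 1"
      using abs_Re_le_cmod[of "Complex (x t u) (y t u) ^ k"] power_le_one[OF norm_ge_zero n, of k]
      by (simp add: norm_power)
    moreover have "norm (Complex (x t u) (y t u)) ^ j \<le> 1" by (rule power_le_one[OF norm_ge_zero n])
    ultimately have "norm (Complex (x t u) (y t u)) ^ j * (\<bar>x t u\<bar> powr p * \<bar>Re (Complex (x t u) (y t u) ^ k)\<bar>) \<le> 1 * (1 * 1)"
      by (intro mult_mono) auto
    then show ?thesis by (simp add: H_def abs_mult)
  qed
  have int: "integrable (N \<Otimes>\<^sub>M sphere_law) (\<lambda>(t, u). H (x t u) (y t u))"
  proof (rule finite_measure.integrable_const_bound[OF fin, where B=1])
    show "AE z in N \<Otimes>\<^sub>M sphere_law. norm (case z of (t, u) \<Rightarrow> H (x t u) (y t u)) \<le> 1"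
    proof (rule P.AE_pair_measure)
      show "{z \<in> space (N \<Otimes>\<^sub>M sphere_law). norm (case z of (t, u) \<Rightarrow> H (x t u) (y t u)) \<le> 1} \<in> sets (N \<Otimes>\<^sub>M sphere_law)"
        using meas by measurable
      show "AE t in N. AE u in sphere_law. norm (case (t, u) of (t, u) \<Rightarrow> H (x t u) (y t u)) \<le> 1"
      proof (rule AE_I2)
        fix t
        show "AE u in sphere_law. norm (case (t, u) of (t, u) \<Rightarrow> H (x t u) (y t u)) \<le> 1"
          using AE_sphere_law by eventually_elim (simp add: bound)
      qed
    qed
  qed (rule meas)
  have "2 * pi * I = (\<integral>t. I \<partial>N)"
    by (subst intN) auto
  also have "\<dots> = (\<integral>t. (\<integral>\<^sub>Su. H (x t u) (y t u)) \<partial>N)"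
    by (simp only: rot)
  also have "\<dots> = (\<integral>\<^sub>Su. (\<integral>t. H (x t u) (y t u) \<partial>N))"
    by (rule P.Fubini_integral[OF int, symmetric])
  also have "\<dots> = radial_moment (p + real k + real j) * cos_moment p k"
    unfolding inner radial_moment_def by simp
  finally show ?thesis by (simp add: I_def H_def)
qed


lemma multiplier_eq_cos_moment:
  assumes p: "p > 0"
  shows "2 * pi * multiplier p k = radial_moment (p + real k) * cos_moment p k"
  using integral_plane_average[OF p, of 0 k] p by (simp add: multiplier_eq_integral)

text \<open>All unit directions have the same second moment, and over an orthonormal basis these
  moments add up to 1.\<close>

lemma inner_sphere_moment:
  fixes c :: 'a
  assumes c: "norm c = 1"
  shows "(\<integral>\<^sub>Su. (c \<bullet> u) ^ 2) = 1 / DIM('a)"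
proof -
  define J where "J = (\<integral>\<^sub>Su. (a \<bullet> u) ^ 2)"
  have J: "(\<integral>\<^sub>Su. (d \<bullet> u) ^ 2) = J" if d: "norm d = 1" for d :: 'a
  proof -
    let ?g = "reflection (a - d)"
    have o: "orthogonal_transformation ?g" by (rule orthogonal_transformation_reflection)
    have "?g a = d" using norm_a d by (intro reflection_swap) simp
    then have "d \<bullet> ?g u = a \<bullet> u" for u
      using o unfolding orthogonal_transformation_def by metis
    then show ?thesis
      using integral_sphere_law_orthogonal[OF o, of "\<lambda>u. (d \<bullet> u) ^ 2"] by (simp add: J_def)
  qed
  have "(\<integral>u. norm u ^ 2 \<partial>(sphere_law :: 'a measure)) = (\<integral>u. 1 \<partial>(sphere_law :: 'a measure))"
    by (rule integral_sphere_law_cong) auto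
  moreover have "(\<integral>u. norm u ^ 2 \<partial>(sphere_law :: 'a measure)) = (\<integral>\<^sub>Su. (\<Sum>d\<in>(Basis :: 'a set). (d \<bullet> u) ^ 2))"
    by (intro arg_cong[where f="integral\<^sup>L sphere_law"] ext)
       (simp only: norm_power2_eq_sum_Basis)
  moreover have "\<dots> = (\<Sum>d\<in>(Basis :: 'a set). J)"
    by (subst Bochner_Integration.integral_sum)
       (auto simp: J abs_square_le_1 abs_inner_le_1 intro!: integrable_sphere_law[where B=1])
  ultimately have "real DIM('a) * J = 1" by simp
  then show ?thesis using J[OF c] by (simp add: field_simps)
qed

lemma radial_moment_pos:
  assumes q: "q > 0"
  shows "radial_moment q > 0"
proof -
  let ?f = "\<lambda>u. plane_norm u powr q"
  have meas: "?f \<in> borel_measurable borel"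
    by (simp add: cmod_def)
  have int: "integrable sphere_law ?f"
    using powr_mono2[of q _ 1] q norm_Complex_inner_le_1
    by (intro integrable_sphere_law[where B=1] meas) auto
  have "radial_moment q \<ge> 0" unfolding radial_moment_def by (rule integral_nonneg_AE) simp
  moreover have "radial_moment q \<noteq> 0"
  proof
    assume "radial_moment q = 0"
    then have "AE u in sphere_law. ?f u = 0"
      unfolding radial_moment_def by (subst (asm) integral_nonneg_eq_0_iff_AE[OF int]) auto
    then have "AE u in sphere_law. (a \<bullet> u) ^ 2 = 0"
      by eventually_elim (auto simp: complex_eq_iff)
    then have "(\<integral>\<^sub>Su. (a \<bullet> u) ^ 2) = 0"
      by (rule integral_eq_zero_AE)
    then show False by (simp add: inner_sphere_moment[OF norm_a])
  qed
  ultimately show ?thesis by simp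
qed

lemma radial_moment_mono:
  assumes "0 < q" "q \<le> r"
  shows "radial_moment r \<le> radial_moment q"
proof -
  have int: "integrable sphere_law (\<lambda>u. plane_norm u powr q)" if "q > 0" for q
    using powr_mono2[of q _ 1] that norm_Complex_inner_le_1
    by (intro integrable_sphere_law[where B=1]) (auto simp: cmod_def)
  show ?thesis
    unfolding radial_moment_def
  proof (rule integral_mono_AE[OF int int])
    show "AE u in sphere_law. plane_norm u powr r \<le> plane_norm u powr q"
      using AE_sphere_law
    proof eventually_elim
      fix u :: 'a assume "norm u = 1"
      then show "plane_norm u powr r \<le> plane_norm u powr q"
        using norm_Complex_inner_le_1 assms by (intro powr_mono') auto
    qed
  qed (use assms in auto)
qed

lemma multiplier_2_pos:
  assumes p: "p > 0"
  shows "multiplier p 2 > 0"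
proof -
  have "cos_moment p 2 > 0"
    using cos_moment_2[OF p] cos_moment_0_pos[OF p] p by simp
  then have "2 * pi * multiplier p 2 > 0"
    unfolding multiplier_eq_cos_moment[OF p] using radial_moment_pos[of "p + real 2"] p by simp
  then show ?thesis by (simp add: zero_less_mult_iff)
qed

text \<open>Odd multipliers vanish. For even degrees from 4 on, both factors of
  \<open>multiplier_eq_cos_moment\<close> help: the radial moment decreases in the exponent because
  projections of unit vectors have length at most 1, and the cosine moment is smaller in absolute
  value. Degree 0 is a true exception: by \<open>multiplier_2_eq\<close> its multiplier exceeds that
  of degree 2.\<close>

lemma multiplier_less:
  assumes p: "p > 0" and k: "k \<noteq> 0" "k \<noteq> 2"
  shows "multiplier p k < multiplier p 2"
proof (cases "odd k")
  case True
  then have "multiplier p k = 0"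
    using multiplier_eq_cos_moment[OF p, of k] cos_moment_odd[OF p] by simp
  then show ?thesis using multiplier_2_pos[OF p] by simp
next
  case False
  then have k4: "even k" "k \<ge> 4" using k by (auto elim!: evenE)
  have "2 * pi * multiplier p k \<le> radial_moment (p + real k) * \<bar>cos_moment p k\<bar>"
    unfolding multiplier_eq_cos_moment[OF p] using radial_moment_pos[of "p + real k"] p
    by (intro mult_left_mono) auto
  also have "\<dots> < radial_moment (p + real k) * cos_moment p 2"
    using radial_moment_pos[of "p + real k"] p abs_cos_moment_less[OF p k4]
    by (intro mult_strict_left_mono) auto
  also have "\<dots> \<le> radial_moment (p + real 2) * cos_moment p 2"
    using radial_moment_mono[of "p + real 2" "p + real k"] p k4 abs_cos_moment_less[OF p k4]
    by (intro mult_right_mono) auto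
  finally have "2 * pi * multiplier p k < 2 * pi * multiplier p 2"
    by (simp only: multiplier_eq_cos_moment[OF p])
  then show ?thesis by simp
qed

text \<open>The plane average of x^2 + y^2 (degree 0, extra factor of degree 2) and that of x^2 -
  y^2 (degree 2) share the same radial moment, so their quotient is p / (p + 2) by
  \<open>cos_moment_2\<close>.\<close>

lemma pair_moment_0_2:
  assumes p: "p > 0"
  shows "pair_moment p 2 0 = (p + 1) * pair_moment p 0 2"
proof -
  let ?D = "radial_moment (p + 2)"
  have int: "integrable sphere_law (\<lambda>u. cos_kernel p a u * (a \<bullet> u) ^ 2)" "integrable sphere_law (\<lambda>u. cos_kernel p a u * (b \<bullet> u) ^ 2)"
    using integrable_pair_moment[OF norm_a norm_b, of p 2 0] integrable_pair_moment[OF norm_a norm_b, of p 0 2] p by simp_all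
  have M: "pair_moment p 2 0 = (\<integral>\<^sub>Su. cos_kernel p a u * (a \<bullet> u) ^ 2)"
    "pair_moment p 0 2 = (\<integral>\<^sub>Su. cos_kernel p a u * (b \<bullet> u) ^ 2)"
    by (simp_all add: pair_moment_def)
  have "2 * pi * (\<integral>\<^sub>Su. cos_kernel p a u * (a \<bullet> u) ^ 2 + cos_kernel p a u * (b \<bullet> u) ^ 2) = ?D * cos_moment p 0"
    using integral_plane_average[OF p, of 2 0] by (simp add: cmod_def algebra_simps)
  then have 1: "2 * pi * (pair_moment p 2 0 + pair_moment p 0 2) = ?D * cos_moment p 0"
    using int by (simp add: M)
  have "2 * pi * (\<integral>\<^sub>Su. cos_kernel p a u * (a \<bullet> u) ^ 2 - cos_kernel p a u * (b \<bullet> u) ^ 2) = ?D * cos_moment p 2"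
    using integral_plane_average[OF p, of 0 2] by (simp add: power2_eq_square algebra_simps)
  then have 2: "2 * pi * (pair_moment p 2 0 - pair_moment p 0 2) = ?D * cos_moment p 2"
    using int by (simp add: M)
  have "(p + 2) * (2 * pi * (pair_moment p 2 0 - pair_moment p 0 2)) = p * (2 * pi * (pair_moment p 2 0 + pair_moment p 0 2))"
    unfolding 1 2 cos_moment_2[OF p] using p by (simp add: field_simps)
  then have "2 * pi * (2 * pair_moment p 2 0) = 2 * pi * (2 * ((p + 1) * pair_moment p 0 2))"
    by (simp add: algebra_simps)
  then show ?thesis by simp
qed

lemma moment_poly_2: "poly (moment_poly p 2) c = pair_moment p 0 2 + multiplier p 2 * c ^ 2"
  and multiplier_2: "multiplier p 2 = pair_moment p 2 0 - pair_moment p 0 2"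
proof -
  show m: "multiplier p 2 = pair_moment p 2 0 - pair_moment p 0 2"
    unfolding multiplier_eq_sum by (simp add: numeral_2_eq_2)
  have "poly (moment_poly p 2) c = pair_moment p 2 0 * c ^ 2 + pair_moment p 0 2 * (1 - c ^ 2)"
    unfolding moment_poly_def poly_sum by (simp add: numeral_2_eq_2 poly_monom algebra_simps)
  then show "poly (moment_poly p 2) c = pair_moment p 0 2 + multiplier p 2 * c ^ 2"
    unfolding m by (simp add: algebra_simps)
qed

text \<open>Summing (e.u)^2 = 1 over a basis that contains the direction of the kernel gives m = M +
  (n - 1) M' with M = (p + 1) M' by \<open>pair_moment_0_2\<close>, where M and M' are the second
  moments along and across that direction; the multiplier is M - M' = p M'. The resulting factor p /
  (n + p) is exactly what makes quadratic forms solve the linearized equation.\<close>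

lemma multiplier_2_eq:
  assumes p: "p > 0"
  shows "(real DIM('a) + p) * multiplier p 2 = p * pair_moment p 0 0"
proof -
  obtain d :: 'a where d: "d \<in> Basis" using nonempty_Basis by blast
  have int: "integrable sphere_law (\<lambda>u. cos_kernel p d u * (e \<bullet> u) ^ 2)" if "e \<in> Basis" for e
    using integrable_pair_moment[of d e p 0 2] d that p by simp
  \<comment> \<open>The vector \<open>a\<close> need not belong to \<open>Basis\<close>, so the
    moments are transported to a basis vector \<open>d\<close>; a partner \<open>d'\<close> is
    needed to state them for a pair.\<close>
  obtain d' :: 'a where d': "norm d' = 1" "d \<bullet> d' = 0"
  proof -
    obtain g where g: "orthogonal_transformation g" "g a = d"
      by (rule that[of "reflection (a - d)"])
         (use norm_a d in \<open>auto simp: orthogonal_transformation_reflection reflection_swap\<close>)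
    have "norm (g b) = 1" "d \<bullet> g b = 0"
      using g norm_b orth_ab orthogonal_transformation_norm[OF g(1)]
      unfolding orthogonal_transformation_def by auto
    then show ?thesis by (rule that)
  qed
  have val: "(\<integral>\<^sub>Su. cos_kernel p d u * (e \<bullet> u) ^ 2) = (if e = d then pair_moment p 2 0 else pair_moment p 0 2)"
    if e: "e \<in> Basis" for e
    using pair_moment_eq[of d d' p 2 0] pair_moment_eq[of d e p 0 2] d e d' by (auto simp: inner_not_same_Basis)
  have "pair_moment p 0 0 = (\<integral>\<^sub>Su. cos_kernel p d u)"
    using pair_moment_eq[of d d' p 0 0] d d' by simp
  also have "\<dots> = (\<integral>\<^sub>Su. cos_kernel p d u * (norm u) ^ 2)"
    by (rule integral_sphere_law_cong) auto
  also have "\<dots> = (\<integral>\<^sub>Su. (\<Sum>e\<in>Basis. cos_kernel p d u * (e \<bullet> u) ^ 2))"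
    by (intro arg_cong[where f="integral\<^sup>L sphere_law"] ext)
       (simp only: norm_power2_eq_sum_Basis sum_distrib_left)
  also have "\<dots> = (\<Sum>e\<in>Basis. if e = d then pair_moment p 2 0 else pair_moment p 0 2)"
    using int by (subst Bochner_Integration.integral_sum) (auto simp: val)
  also have "\<dots> = pair_moment p 2 0 + (\<Sum>e\<in>Basis - {d}. pair_moment p 0 2)"
    using d by (subst sum.remove[of _ d]) (auto intro!: sum.cong)
  also have "\<dots> = (real DIM('a) + p) * pair_moment p 0 2"
    using d by (simp add: pair_moment_0_2[OF p] card_Diff_singleton of_nat_diff Suc_leI algebra_simps)
  finally have "p * pair_moment p 0 0 = (real DIM('a) + p) * (p * pair_moment p 0 2)" by simp
  also have "p * pair_moment p 0 2 = multiplier p 2"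
    unfolding multiplier_2 pair_moment_0_2[OF p] by (simp add: algebra_simps)
  finally show ?thesis ..
qed

end

section \<open>Symmetry of the cosine transform and vanishing moments\<close>

lemma poly_eq_sum_le:
  fixes q :: "'a::comm_semiring_1 poly"
  assumes "degree q \<le> k"
  shows "poly q x = (\<Sum>i\<le>k. coeff q i * x ^ i)"
  unfolding poly_altdef
  by (rule sum.mono_neutral_left) (use assms in \<open>auto intro!: le_degree\<close>)

lemma sphere_law_Fubini:
  fixes F :: "'a::euclidean_space \<Rightarrow> 'a \<Rightarrow> real"
  assumes meas: "case_prod F \<in> borel_measurable borel"
    and bound: "\<And>u v. norm u = 1 \<Longrightarrow> norm v = 1 \<Longrightarrow> \<bar>F u v\<bar> \<le> B"
  shows "(\<integral>\<^sub>Sv. (\<integral>\<^sub>Su. F u v)) = (\<integral>\<^sub>Su. (\<integral>\<^sub>Sv. F u v))"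
proof -
  let ?S = "sphere_law :: 'a measure"
  interpret P: pair_sigma_finite ?S ?S ..
  have fin: "finite_measure (?S \<Otimes>\<^sub>M ?S)"
    by (rule finite_measure_pair_measure) (rule sphere_law.finite_measure_axioms)+
  have m: "case_prod F \<in> borel_measurable (?S \<Otimes>\<^sub>M ?S)"
    using meas[unfolded borel_prod[symmetric]] by measurable
  have "integrable (?S \<Otimes>\<^sub>M ?S) (case_prod F)"
  proof (rule finite_measure.integrable_const_bound[OF fin, where B=B])
    show "AE z in ?S \<Otimes>\<^sub>M ?S. norm (case_prod F z) \<le> B"
    proof (rule P.AE_pair_measure)
      show "{z \<in> space (?S \<Otimes>\<^sub>M ?S). norm (case_prod F z) \<le> B} \<in> sets (?S \<Otimes>\<^sub>M ?S)"
        using m by measurable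
      show "AE u in ?S. AE v in ?S. norm (case_prod F (u, v)) \<le> B"
        using AE_sphere_law
      proof eventually_elim
        fix u :: 'a assume u: "norm u = 1"
        show "AE v in ?S. norm (case_prod F (u, v)) \<le> B"
          using AE_sphere_law by eventually_elim (simp add: bound u)
      qed
    qed
  qed (rule m)
  from P.Fubini_integral[OF this] show ?thesis by simp
qed

text \<open>Not normalized: the operator T of the overview is this one divided by \<open>m\<close>,
  the common integral of the kernels, and its eigenvalues are the multipliers divided by
  \<open>m\<close>.\<close>

definition cosine_transform :: "real \<Rightarrow> ('a::euclidean_space \<Rightarrow> real) \<Rightarrow> 'a \<Rightarrow> real" where
  "cosine_transform p f \<theta> = (\<integral>\<^sub>Su. cos_kernel p \<theta> u * f u)"

lemma borel_measurable_integral_sphere_law: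
  fixes F :: "'a::euclidean_space \<Rightarrow> 'a \<Rightarrow> real"
  assumes "case_prod F \<in> borel_measurable borel"
  shows "(\<lambda>u. (\<integral>\<^sub>Sv. F u v)) \<in> borel_measurable borel"
proof (rule sphere_law.borel_measurable_lebesgue_integral)
  show "case_prod F \<in> borel_measurable (borel \<Otimes>\<^sub>M (sphere_law :: 'a measure))"
    using assms[unfolded borel_prod[symmetric]] by measurable
qed

lemma abs_integral_sphere_law_le:
  fixes f :: "'a::euclidean_space \<Rightarrow> real"
  assumes f: "f \<in> borel_measurable borel" and B: "\<And>u. norm u = 1 \<Longrightarrow> \<bar>f u\<bar> \<le> B"
  shows "\<bar>integral\<^sup>L sphere_law f\<bar> \<le> B"
proof -
  have int: "integrable sphere_law f" by (rule integrable_sphere_law[OF f B])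
  have "\<bar>integral\<^sup>L sphere_law f\<bar> \<le> (\<integral>\<^sub>Su. \<bar>f u\<bar>)"
    using integral_norm_bound[of sphere_law f] by simp
  also have "\<dots> \<le> (\<integral>u. B \<partial>(sphere_law :: 'a measure))"
  proof (rule integral_mono_AE)
    show "AE u in sphere_law. \<bar>f u\<bar> \<le> B"
      using AE_sphere_law by eventually_elim (simp add: B)
  qed (use int in auto)
  finally show ?thesis by simp
qed

lemma borel_measurable_cosine_transform [measurable]:
  fixes f :: "'a::euclidean_space \<Rightarrow> real"
  assumes [measurable]: "f \<in> borel_measurable borel"
  shows "cosine_transform p f \<in> borel_measurable borel"
  unfolding cosine_transform_def
  by (rule borel_measurable_integral_sphere_law) (simp add: borel_prod[symmetric])

lemma integrable_cosine_transform:
  fixes f :: "'a::euclidean_space \<Rightarrow> real"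
  assumes "p \<ge> 0" "f \<in> borel_measurable borel" "\<And>u. norm u = 1 \<Longrightarrow> \<bar>f u\<bar> \<le> B" "norm \<theta> = 1"
  shows "integrable sphere_law (\<lambda>u. cos_kernel p \<theta> u * f u)"
proof (rule integrable_sphere_law[where B=B])
  fix u :: 'a assume u: "norm u = 1"
  have "cos_kernel p \<theta> u * \<bar>f u\<bar> \<le> 1 * B"
    using abs_inner_powr_le_1[OF assms(4) u assms(1)] assms(3)[OF u] by (intro mult_mono) auto
  then show "\<bar>cos_kernel p \<theta> u * f u\<bar> \<le> B" by (simp add: abs_mult)
qed (use assms in measurable)

context orthonormal_pair
begin

text \<open>The kernel is symmetric, so Fubini moves the transform from \<open>f\<close>, which is
  arbitrary, to the power, where its value is known.\<close>

lemma integral_cosine_transform_times_power: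
  fixes f :: "'a \<Rightarrow> real" and e :: 'a
  assumes p: "p \<ge> 0" and f[measurable]: "f \<in> borel_measurable borel"
    and B: "\<And>u. norm u = 1 \<Longrightarrow> \<bar>f u\<bar> \<le> B" and e: "norm e = 1"
  shows "(\<integral>\<^sub>Sv. cosine_transform p f v * (e \<bullet> v) ^ k)
       = (\<integral>\<^sub>Su. f u * poly (moment_poly p k) (e \<bullet> u))"
proof -
  define F where "F u v = cos_kernel p v u * f u * (e \<bullet> v) ^ k" for u v
  have m: "case_prod F \<in> borel_measurable borel"
    unfolding F_def by (simp add: borel_prod[symmetric])
  have B0: "B \<ge> 0" using B[OF e] by simp
  have bd: "\<bar>F u v\<bar> \<le> B" if "norm u = 1" "norm v = 1" for u v
  proof -
    have "cos_kernel p v u * \<bar>f u\<bar> * \<bar>e \<bullet> v\<bar> ^ k \<le> 1 * B * 1"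
      using abs_inner_powr_le_1[OF that(2,1) p] B[OF that(1)] B0 abs_inner_le_1[OF e that(2)]
      by (intro mult_mono power_le_one) auto
    then show ?thesis by (simp add: F_def abs_mult power_abs)
  qed
  have "(\<integral>\<^sub>Sv. cosine_transform p f v * (e \<bullet> v) ^ k) = (\<integral>\<^sub>Sv. (\<integral>\<^sub>Su. F u v))"
    by (simp add: cosine_transform_def F_def)
  also have "\<dots> = (\<integral>\<^sub>Su. (\<integral>\<^sub>Sv. F u v))"
    by (rule sphere_law_Fubini[OF m bd])
  also have "\<dots> = (\<integral>\<^sub>Su. f u * poly (moment_poly p k) (e \<bullet> u))"
  proof (rule integral_sphere_law_cong)
    show "(\<lambda>u. \<integral>\<^sub>Sv. F u v) \<in> borel_measurable borel"
      by (rule borel_measurable_integral_sphere_law[OF m])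
    show "(\<lambda>u. f u * poly (moment_poly p k) (e \<bullet> u)) \<in> borel_measurable borel"
      unfolding poly_altdef by measurable
    fix u :: 'a assume u: "norm u = 1"
    have "(\<integral>\<^sub>Sv. F u v) = (\<integral>\<^sub>Sv. f u * (cos_kernel p u v * (e \<bullet> v) ^ k))"
      by (simp add: F_def inner_commute ac_simps)
    also have "\<dots> = f u * poly (moment_poly p k) (e \<bullet> u)"
      by (simp add: integral_powr_power_eq_poly[OF u e p])
    finally show "(\<integral>\<^sub>Sv. F u v) = f u * poly (moment_poly p k) (e \<bullet> u)" .
  qed
  finally show ?thesis .
qed

text \<open>Pairing the eigenvalue equation with the k-th power and moving the transform to the
  power leaves a polynomial whose lower moments against \<open>f\<close> vanish by induction. Only
  the top coefficient remains, so the moment is multiplied both by \<open>multiplier p 2\<close> and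
  by \<open>multiplier p k\<close>, which differ.\<close>

lemma moments_vanish:
  fixes f :: "'a \<Rightarrow> real" and e :: 'a
  assumes p: "p > 0" and f[measurable]: "f \<in> borel_measurable borel"
    and B: "\<And>u. norm u = 1 \<Longrightarrow> \<bar>f u\<bar> \<le> B"
    and eig: "\<And>v. norm v = 1 \<Longrightarrow> cosine_transform p f v = multiplier p 2 * f v"
    and m0: "(\<integral>\<^sub>Su. f u) = 0"
    and m2: "\<And>e. norm e = 1 \<Longrightarrow> (\<integral>\<^sub>Su. f u * (e \<bullet> u) ^ 2) = 0"
    and e: "norm e = 1"
  shows "(\<integral>\<^sub>Su. f u * (e \<bullet> u) ^ k) = 0"
proof (induction k rule: less_induct)
  case (less k)
  let ?A = "\<lambda>i. (\<integral>\<^sub>Su. f u * (e \<bullet> u) ^ i)"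
  have int: "integrable sphere_law (\<lambda>u. f u * (e \<bullet> u) ^ i)" for i
  proof (rule integrable_sphere_law[where B=B])
    fix u :: 'a assume u: "norm u = 1"
    have "\<bar>f u\<bar> * \<bar>e \<bullet> u\<bar> ^ i \<le> B * 1"
      using B[OF u] abs_inner_le_1[OF e u] by (intro mult_mono power_le_one) auto
    then show "\<bar>f u * (e \<bullet> u) ^ i\<bar> \<le> B" by (simp add: abs_mult power_abs)
  qed measurable
  show ?case
  proof (cases "k = 0 \<or> k = 2")
    case True
    then show ?thesis using m0 m2[OF e] by auto
  next
    case False
    have "multiplier p 2 * ?A k = (\<integral>\<^sub>Sv. multiplier p 2 * (f v * (e \<bullet> v) ^ k))"
      by simp
    also have "\<dots> = (\<integral>\<^sub>Sv. cosine_transform p f v * (e \<bullet> v) ^ k)"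
      by (rule integral_sphere_law_cong) (auto simp: eig)
    also have "\<dots> = (\<integral>\<^sub>Su. f u * poly (moment_poly p k) (e \<bullet> u))"
      using p by (intro integral_cosine_transform_times_power[where B=B] f B e) auto
    also have "\<dots> = (\<integral>\<^sub>Su. (\<Sum>i\<le>k. coeff (moment_poly p k) i * (f u * (e \<bullet> u) ^ i)))"
      unfolding poly_eq_sum_le[OF degree_moment_poly]
      by (intro arg_cong[where f="integral\<^sup>L sphere_law"] ext) (simp add: sum_distrib_left ac_simps)
    also have "\<dots> = (\<Sum>i\<le>k. coeff (moment_poly p k) i * ?A i)"
      using int by (subst Bochner_Integration.integral_sum) auto
    also have "\<dots> = (\<Sum>i\<in>{k}. coeff (moment_poly p k) i * ?A i)"
      by (rule sum.mono_neutral_right) (use less in auto)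
    also have "\<dots> = multiplier p k * ?A k" by (simp add: multiplier_def)
    finally show ?thesis using multiplier_less[OF p, of k] False by auto
  qed
qed

end

text \<open>Exponentials rather than polynomials: products are again exponentials, which gives the
  algebra required by Stone-Weierstrass at once, and the power series of exp (e.u) involves only
  powers of a single e.u. Mixed monomials and polarization are thereby avoided.\<close>

inductive exp_sum :: "('a::euclidean_space \<Rightarrow> real) \<Rightarrow> bool" where
  exp: "exp_sum (\<lambda>u. c * exp (e \<bullet> u))"
| add: "exp_sum f \<Longrightarrow> exp_sum g \<Longrightarrow> exp_sum (\<lambda>u. f u + g u)"

lemma continuous_on_exp_sum: "exp_sum f \<Longrightarrow> continuous_on S f"
  by (induction rule: exp_sum.induct) (auto intro!: continuous_intros)

lemma exp_sum_mult: "exp_sum f \<Longrightarrow> exp_sum g \<Longrightarrow> exp_sum (\<lambda>u. f u * g u)"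
proof (induction rule: exp_sum.induct)
  case (exp c e)
  from exp show ?case
  proof (induction rule: exp_sum.induct)
    case (exp c' e')
    have "(\<lambda>u. c * exp (e \<bullet> u) * (c' * exp (e' \<bullet> u))) = (\<lambda>u. (c * c') * exp ((e + e') \<bullet> u))"
      by (simp add: fun_eq_iff inner_add_left exp_add)
    then show ?case using exp_sum.exp by metis
  next
    case (add f g)
    have "(\<lambda>u. c * exp (e \<bullet> u) * (f u + g u)) = (\<lambda>u. c * exp (e \<bullet> u) * f u + c * exp (e \<bullet> u) * g u)"
      by (simp add: algebra_simps)
    then show ?case using exp_sum.add[OF add.IH] by simp
  qed
next
  case (add f f')
  then have "exp_sum (\<lambda>u. f u * g u + f' u * g u)" by (intro exp_sum.add) auto
  then show ?case by (simp add: algebra_simps)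
qed

lemma exp_sum_dense:
  fixes h :: "'a::euclidean_space \<Rightarrow> real"
  assumes "continuous_on (sphere 0 1) h" "\<epsilon> > 0"
  obtains g where "exp_sum g" "\<And>u. norm u = 1 \<Longrightarrow> \<bar>h u - g u\<bar> < \<epsilon>"
proof -
  have "\<exists>g. exp_sum g \<and> (\<forall>x\<in>sphere (0::'a) 1. \<bar>h x - g x\<bar> < \<epsilon>)"
  proof (rule Stone_Weierstrass_HOL)
    show "exp_sum (\<lambda>x::'a. c)" for c
      using exp_sum.exp[of c 0] by simp
    fix x y :: 'a assume "x \<in> sphere 0 1 \<and> y \<in> sphere 0 1 \<and> x \<noteq> y"
    then have xy: "x \<bullet> x = 1" "y \<bullet> y = 1" "x - y \<noteq> 0" by (auto simp: norm_eq_1)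
    \<comment> \<open>For distinct unit vectors x.y < 1 = x.x, so the exponential with exponent x.u
      separates the two points.\<close>
    have "x \<bullet> x \<noteq> x \<bullet> y"
    proof
      assume "x \<bullet> x = x \<bullet> y"
      then have "(x - y) \<bullet> (x - y) = 0"
        using xy by (simp add: inner_diff_left inner_diff_right inner_commute)
      then show False using xy(3) by simp
    qed
    then show "\<exists>f. exp_sum f \<and> f x \<noteq> f y"
      using exp_sum.exp[of 1 x] by (intro exI[of _ "\<lambda>u. 1 * exp (x \<bullet> u)"]) auto
  qed (use assms exp_sum_mult exp_sum.add continuous_on_exp_sum in auto)
  then show ?thesis using that by auto
qed

text \<open>The exponential series is integrated term by term; on the sphere its partial sums times
  \<open>f\<close> are dominated by \<open>B * exp (norm e)\<close>. The moment hypothesis for unit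
  vectors extends to all \<open>e\<close> by homogeneity.\<close>

lemma integral_exp_sum_eq_0:
  fixes f :: "'a::euclidean_space \<Rightarrow> real"
  assumes f[measurable]: "f \<in> borel_measurable borel" and B: "\<And>u. norm u = 1 \<Longrightarrow> \<bar>f u\<bar> \<le> B"
    and mom: "\<And>e k. norm e = 1 \<Longrightarrow> (\<integral>\<^sub>Su. f u * (e \<bullet> u) ^ k) = 0"
    and g: "exp_sum g"
  shows "(\<integral>\<^sub>Su. f u * g u) = 0"
proof -
  obtain d :: 'a where d: "norm d = 1" using vector_choose_size[of 1] by auto
  have B0: "B \<ge> 0" using B[OF d] by simp
  have int_g: "integrable sphere_law (\<lambda>u. f u * g u)" if "exp_sum g" for g
  proof -
    have "compact (g ` sphere 0 1)"
      by (intro compact_continuous_image continuous_on_exp_sum that compact_sphere)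
    then obtain M where M: "\<And>u. norm u = 1 \<Longrightarrow> \<bar>g u\<bar> \<le> M"
      using compact_imp_bounded by (fastforce simp: bounded_iff)
    show ?thesis
    proof (rule integrable_sphere_law[where B="B * M"])
      show "(\<lambda>u. f u * g u) \<in> borel_measurable borel"
        using borel_measurable_continuous_onI[OF continuous_on_exp_sum[OF that]] by measurable
      show "\<bar>f u * g u\<bar> \<le> B * M" if "norm u = 1" for u
        unfolding abs_mult using B[OF that] M[OF that] B0 by (intro mult_mono) auto
    qed
  qed
  have 0: "(\<integral>\<^sub>Su. f u * (e \<bullet> u) ^ k) = 0" for e k
  proof (cases "e = 0")
    case True
    then show ?thesis using mom[OF d, of 0] by (cases k) auto
  next
    case False
    have "(\<integral>\<^sub>Su. f u * (e \<bullet> u) ^ k) = (\<integral>\<^sub>Su. norm e ^ k * (f u * ((e /\<^sub>R norm e) \<bullet> u) ^ k))"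
      using False by (simp add: power_mult_distrib field_simps)
    also have "\<dots> = 0" using mom[of "e /\<^sub>R norm e" k] False by simp
    finally show ?thesis .
  qed
  have E: "(\<integral>\<^sub>Su. f u * exp (e \<bullet> u)) = 0" for e
  proof -
    let ?s = "\<lambda>n u. \<Sum>k<n. f u * (e \<bullet> u) ^ k / fact k"
    have "(\<lambda>n. \<integral>\<^sub>Su. ?s n u) \<longlonglongrightarrow> (\<integral>\<^sub>Su. f u * exp (e \<bullet> u))"
    proof (rule integral_dominated_convergence[where w="\<lambda>_. B * exp (norm e)"])
      show "AE u in sphere_law. (\<lambda>n. ?s n u) \<longlonglongrightarrow> f u * exp (e \<bullet> u)"
      proof (rule AE_I2)
        fix u
        have "(\<lambda>k. f u * (e \<bullet> u) ^ k / fact k) sums (f u * exp (e \<bullet> u))"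
          using sums_mult[OF exp_converges[of "e \<bullet> u"], of "f u"] by (simp add: scaleR_conv_of_real field_simps)
        then show "(\<lambda>n. ?s n u) \<longlonglongrightarrow> f u * exp (e \<bullet> u)" by (simp add: sums_def)
      qed
      fix n
      show "AE u in sphere_law. norm (?s n u) \<le> B * exp (norm e)"
        using AE_sphere_law
      proof eventually_elim
        fix u :: 'a assume u: "norm u = 1"
        have eu: "\<bar>e \<bullet> u\<bar> \<le> norm e" using Cauchy_Schwarz_ineq2[of e u] u by simp
        have "norm (?s n u) \<le> (\<Sum>k<n. B * (norm e ^ k / fact k))"
        proof (intro order.trans[OF norm_sum] sum_mono)
          fix k
          have "\<bar>f u\<bar> * (\<bar>e \<bullet> u\<bar> ^ k / fact k) \<le> B * (norm e ^ k / fact k)"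
            using B[OF u] B0 eu by (intro mult_mono divide_right_mono power_mono) auto
          then show "norm (f u * (e \<bullet> u) ^ k / fact k) \<le> B * (norm e ^ k / fact k)"
            by (simp add: abs_mult power_abs)
        qed
        also have "\<dots> = B * (\<Sum>k<n. norm e ^ k / fact k)" by (simp add: sum_distrib_left)
        also have "\<dots> \<le> B * exp (norm e)"
          using exp_converges[of "norm e"] B0
          by (intro mult_left_mono sum_le_suminf[THEN order.trans])
             (auto simp: sums_iff scaleR_conv_of_real field_simps)
        finally show "norm (?s n u) \<le> B * exp (norm e)" .
      qed
    qed auto
    moreover have "(\<integral>\<^sub>Su. ?s n u) = 0" for n
    proof -
      have "integrable sphere_law (\<lambda>u. f u * (e \<bullet> u) ^ k)" for k
      proof (rule integrable_sphere_law[where B="B * norm e ^ k"])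
        fix u :: 'a assume u: "norm u = 1"
        have "\<bar>f u\<bar> * \<bar>e \<bullet> u\<bar> ^ k \<le> B * norm e ^ k"
          using B[OF u] B0 Cauchy_Schwarz_ineq2[of e u] u by (intro mult_mono power_mono) auto
        then show "\<bar>f u * (e \<bullet> u) ^ k\<bar> \<le> B * norm e ^ k" by (simp add: abs_mult power_abs)
      qed measurable
      then show ?thesis by (subst Bochner_Integration.integral_sum) (auto simp: 0)
    qed
    ultimately show ?thesis by (simp add: LIMSEQ_const_iff)
  qed
  from g show ?thesis
  proof (induction rule: exp_sum.induct)
    case (exp c e)
    have "(\<integral>\<^sub>Su. f u * (c * exp (e \<bullet> u))) = (\<integral>\<^sub>Su. c * (f u * exp (e \<bullet> u)))"
      by (simp add: ac_simps)
    then show ?case using E by simp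
  next
    case (add g h)
    then show ?case using int_g by (simp add: distrib_left)
  qed
qed

section \<open>The eigenvalue of the quadratic forms\<close>

context orthonormal_pair
begin

text \<open>The kernel is approximated by exponential sums, not \<open>f\<close>, so boundedness and
  measurability of \<open>f\<close> suffice. This gives \<open>cosine_transform p f v = 0\<close>,
  and the eigenvalue equation with a nonzero eigenvalue then yields \<open>f v = 0\<close> at every
  unit vector rather than almost everywhere.\<close>

lemma eigenfunction_eq_0:
  fixes f :: "'a \<Rightarrow> real" and p :: real
  assumes p: "p > 0" and f[measurable]: "f \<in> borel_measurable borel"
    and B: "\<And>u. norm u = 1 \<Longrightarrow> \<bar>f u\<bar> \<le> B"
    and eig: "\<And>v. norm v = 1 \<Longrightarrow> cosine_transform p f v = multiplier p 2 * f v"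
    and m0: "(\<integral>\<^sub>Su. f u) = 0"
    and m2: "\<And>e. norm e = 1 \<Longrightarrow> (\<integral>\<^sub>Su. f u * (e \<bullet> u) ^ 2) = 0"
    and v: "norm v = 1"
  shows "f v = 0"
proof -
  have B0: "B \<ge> 0" using B[OF v] by simp
  have le: "\<bar>cosine_transform p f v\<bar> \<le> B * \<epsilon>" if \<epsilon>: "\<epsilon> > 0" for \<epsilon>
  proof -
    have "continuous_on (sphere 0 1) (\<lambda>u. cos_kernel p v u)"
      using p by (intro continuous_on_powr' continuous_intros) auto
    from exp_sum_dense[OF this \<epsilon>] obtain g where
      g: "exp_sum g" and gd: "\<And>u. norm u = 1 \<Longrightarrow> \<bar>cos_kernel p v u - g u\<bar> < \<epsilon>" by metis
    have gm[measurable]: "g \<in> borel_measurable borel"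
      by (rule borel_measurable_continuous_onI[OF continuous_on_exp_sum[OF g]])
    have fg: "(\<integral>\<^sub>Su. f u * g u) = 0"
      by (rule integral_exp_sum_eq_0[OF f B moments_vanish[OF p f B eig m0 m2] g])
    have bd: "\<bar>f u * (cos_kernel p v u - g u)\<bar> \<le> B * \<epsilon>" if "norm u = 1" for u
      unfolding abs_mult using B[OF that] gd[OF that] B0 by (intro mult_mono) auto
    have int: "integrable sphere_law (\<lambda>u. f u * (cos_kernel p v u - g u))"
      by (rule integrable_sphere_law[OF _ bd]) measurable
    have int2: "integrable sphere_law (\<lambda>u. cos_kernel p v u * f u)"
      using p by (intro integrable_cosine_transform[OF _ f B v]) auto
    have "integrable sphere_law (\<lambda>u. cos_kernel p v u * f u - f u * (cos_kernel p v u - g u))"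
      by (intro Bochner_Integration.integrable_diff int int2)
    then have int3: "integrable sphere_law (\<lambda>u. f u * g u)"
      by (simp add: algebra_simps)
    have "cosine_transform p f v = (\<integral>\<^sub>Su. f u * (cos_kernel p v u - g u) + f u * g u)"
      unfolding cosine_transform_def by (simp add: algebra_simps)
    also have "\<dots> = (\<integral>\<^sub>Su. f u * (cos_kernel p v u - g u))"
      using int int3 fg by simp
    also have "\<bar>\<dots>\<bar> \<le> B * \<epsilon>"
      by (rule abs_integral_sphere_law_le[OF _ bd]) measurable
    finally show ?thesis .
  qed
  have "\<bar>cosine_transform p f v\<bar> \<le> 0 + e" if e: "e > 0" for e
  proof -
    have "\<bar>cosine_transform p f v\<bar> \<le> B * (e / (B + 1))"
      by (rule le) (use e B0 in simp)
    also have "\<dots> \<le> e"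
      using e B0 by (simp add: divide_le_eq algebra_simps)
    finally show ?thesis by simp
  qed
  then have "cosine_transform p f v = 0"
    using field_le_epsilon[of "\<bar>cosine_transform p f v\<bar>" 0] by simp
  then show ?thesis using eig[OF v] multiplier_2_pos[OF p] by simp
qed

text \<open>By Fubini the transform acts on (w.u)^2 as a function of w, where it gives a constant
  plus \<open>multiplier p 2\<close> times (v.u)^2; the mean zero condition on \<open>f\<close>
  removes the constant. The exponent here is independent of any equation for
  \<open>f\<close>.\<close>

lemma cosine_transform_quadratic:
  fixes f :: "'a \<Rightarrow> real" and p :: real
  assumes p: "p \<ge> 0" and f[measurable]: "f \<in> borel_measurable borel"
    and B: "\<And>u. norm u = 1 \<Longrightarrow> \<bar>f u\<bar> \<le> B"
    and m0: "(\<integral>\<^sub>Su. f u) = 0" and v: "norm v = 1"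
  shows "(\<integral>\<^sub>Sw. cos_kernel p v w * (\<integral>\<^sub>Su. f u * (w \<bullet> u) ^ 2))
     = multiplier p 2 * (\<integral>\<^sub>Su. f u * (v \<bullet> u) ^ 2)"
proof -
  define F where "F u w = f u * (cos_kernel p v w * (u \<bullet> w) ^ 2)" for u w
  have m: "case_prod F \<in> borel_measurable borel"
    unfolding F_def by (simp add: borel_prod[symmetric])
  have B0: "B \<ge> 0" using B[OF v] by simp
  have sq: "(x \<bullet> y) ^ 2 \<le> 1" if "norm x = 1" "norm y = 1" for x y :: 'a
    using abs_inner_le_1[OF that] by (simp add: abs_square_le_1)
  have bd: "\<bar>F u w\<bar> \<le> B" if u: "norm u = 1" and w: "norm w = 1" for u w
  proof -
    have "\<bar>f u\<bar> * (cos_kernel p v w * (u \<bullet> w) ^ 2) \<le> B * (1 * 1)"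
      using abs_inner_powr_le_1[OF v w p] B[OF u] B0 sq[OF u w] by (intro mult_mono) auto
    then show ?thesis by (simp add: F_def abs_mult)
  qed
  have int1: "integrable sphere_law (\<lambda>u. f u * (v \<bullet> u) ^ 2)"
  proof (rule integrable_sphere_law[where B=B])
    fix u :: 'a assume u: "norm u = 1"
    have "\<bar>f u\<bar> * (v \<bullet> u) ^ 2 \<le> B * 1" using B[OF u] B0 sq[OF v u] by (intro mult_mono) auto
    then show "\<bar>f u * (v \<bullet> u) ^ 2\<bar> \<le> B" by (simp add: abs_mult)
  qed measurable
  have int0: "integrable sphere_law f" by (rule integrable_sphere_law[OF f B])
  have "(\<integral>\<^sub>Sw. cos_kernel p v w * (\<integral>\<^sub>Su. f u * (w \<bullet> u) ^ 2))
      = (\<integral>\<^sub>Sw. (\<integral>\<^sub>Su. F u w))"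
  proof (rule arg_cong[where f="integral\<^sup>L sphere_law"], rule ext)
    fix w
    have "cos_kernel p v w * (\<integral>\<^sub>Su. f u * (w \<bullet> u) ^ 2) = (\<integral>\<^sub>Su. cos_kernel p v w * (f u * (w \<bullet> u) ^ 2))"
      by (rule integral_mult_right_zero[symmetric])
    then show "cos_kernel p v w * (\<integral>\<^sub>Su. f u * (w \<bullet> u) ^ 2) = (\<integral>\<^sub>Su. F u w)"
      by (simp add: F_def inner_commute ac_simps)
  qed
  also have "\<dots> = (\<integral>\<^sub>Su. (\<integral>\<^sub>Sw. F u w))"
    by (rule sphere_law_Fubini[OF m bd])
  also have "\<dots> = (\<integral>\<^sub>Su. pair_moment p 0 2 * f u + multiplier p 2 * (f u * (v \<bullet> u) ^ 2))"
  proof (rule integral_sphere_law_cong)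
    show "(\<lambda>u. \<integral>\<^sub>Sw. F u w) \<in> borel_measurable borel"
      by (rule borel_measurable_integral_sphere_law[OF m])
    fix u :: 'a assume u: "norm u = 1"
    have "(\<integral>\<^sub>Sw. F u w) = f u * (\<integral>\<^sub>Sw. cos_kernel p v w * (u \<bullet> w) ^ 2)"
      unfolding F_def by (rule integral_mult_right_zero)
    also have "(\<integral>\<^sub>Sw. cos_kernel p v w * (u \<bullet> w) ^ 2) = pair_moment p 0 2 + multiplier p 2 * (v \<bullet> u) ^ 2"
      using integral_powr_power_eq_poly[OF v u p, of 2] by (simp only: moment_poly_2 inner_commute[of u v])
    finally show "(\<integral>\<^sub>Sw. F u w) = pair_moment p 0 2 * f u + multiplier p 2 * (f u * (v \<bullet> u) ^ 2)"
      by (simp add: algebra_simps)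
  qed measurable
  also have "\<dots> = multiplier p 2 * (\<integral>\<^sub>Su. f u * (v \<bullet> u) ^ 2)"
    using int0 int1 m0 by simp
  finally show ?thesis .
qed

lemma integral_cosine_transform:
  fixes f :: "'a \<Rightarrow> real" and p :: real
  assumes p: "p \<ge> 0" and f[measurable]: "f \<in> borel_measurable borel"
    and B: "\<And>u. norm u = 1 \<Longrightarrow> \<bar>f u\<bar> \<le> B"
  shows "(\<integral>\<^sub>Sv. cosine_transform p f v) = pair_moment p 0 0 * (\<integral>\<^sub>Su. f u)"
proof -
  have "poly (moment_poly p 0) c = pair_moment p 0 0" for c
    by (simp add: moment_poly_def)
  then show ?thesis
    using integral_cosine_transform_times_power[OF p f B norm_a, of 0] by simp
qed

lemma integral_abs_inner_powr:
  fixes v :: 'a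
  assumes p: "p \<ge> 0" and v: "norm v = 1"
  shows "(\<integral>\<^sub>Su. cos_kernel p v u) = pair_moment p 0 0"
  using integral_powr_power_eq_poly[OF v v p, of 0] by (simp add: moment_poly_def)

lemma pair_moment_0_0_pos:
  fixes p :: real
  assumes p: "p > 0"
  shows "pair_moment p 0 0 > 0"
  using multiplier_2_eq[OF p] multiplier_2_pos[OF p] p
  by (metis DIM_positive add_pos_pos mult_pos_pos of_nat_0_less_iff zero_less_mult_pos)

text \<open>Decomposition of \<open>f\<close> into its mean \<open>I\<close>, the quadratic part
  \<open>\<kappa> * q\<close> of the rest \<open>f1\<close>, and a remainder \<open>f2\<close>. The
  remainder satisfies the eigenvalue equation and has no moments of degree 0 and 2, so it
  vanishes.\<close>

lemma cosine_transform_fixed_imp_quadratic: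
  fixes f :: "'a \<Rightarrow> real" and p :: real
  assumes p: "p > 0" and f[measurable]: "f \<in> borel_measurable borel"
    and B: "\<And>u. norm u = 1 \<Longrightarrow> \<bar>f u\<bar> \<le> B"
    and eq: "\<And>v. norm v = 1 \<Longrightarrow> p * f v = \<beta> + (DIM('a) + p) / pair_moment p 0 0 * cosine_transform p f v"
  obtains S where "linear S" "\<And>v. norm v = 1 \<Longrightarrow> f v = v \<bullet> S v"
proof -
  define n where "n = real DIM('a)"
  define m where "m = pair_moment p 0 0"
  define L where "L = multiplier p 2"
  have m: "m > 0" unfolding m_def by (rule pair_moment_0_0_pos[OF p])
  have L: "L > 0" unfolding L_def by (rule multiplier_2_pos[OF p])
  have n: "n > 0" by (simp add: n_def)
  have nL: "(n + p) * L = p * m" unfolding n_def L_def m_def by (rule multiplier_2_eq[OF p])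
  define I where "I = (\<integral>\<^sub>Su. f u)"
  have p0: "p \<ge> 0" using p by simp
  have B0: "B \<ge> 0" using B[OF norm_a] by simp
  have int_f: "integrable sphere_law f" by (rule integrable_sphere_law[OF f B])
  have T_bd: "\<bar>cosine_transform p f v\<bar> \<le> B" if v: "norm v = 1" for v
    unfolding cosine_transform_def
  proof (rule abs_integral_sphere_law_le)
    fix u :: 'a assume u: "norm u = 1"
    have "cos_kernel p v u * \<bar>f u\<bar> \<le> 1 * B"
      using abs_inner_powr_le_1[OF v u p0] B[OF u] by (intro mult_mono) auto
    then show "\<bar>cos_kernel p v u * f u\<bar> \<le> B" by (simp add: abs_mult)
  qed measurable
  have int_T: "integrable sphere_law (cosine_transform p f)"
    by (rule integrable_sphere_law[OF _ T_bd]) measurable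
  \<comment> \<open>Integration over the sphere determines \<beta>, because the transform multiplies
    the mean by \<open>m\<close>. The equation for \<open>f - I\<close> then has no constant
    term.\<close>
  have "p * I = (\<integral>\<^sub>Sv. p * f v)" by (simp add: I_def)
  also have "\<dots> = (\<integral>\<^sub>Sv. \<beta> + (n + p) / m * cosine_transform p f v)"
    by (rule integral_sphere_law_cong) (auto simp: eq n_def m_def)
  also have "\<dots> = \<beta> + (n + p) / m * (m * I)"
    using int_T integral_cosine_transform[OF p0 f B] by (simp add: m_def I_def)
  also have "(n + p) / m * (m * I) = (n + p) * I" using m by simp
  finally have \<beta>: "\<beta> = - n * I" by (simp add: algebra_simps)
  define f1 where "f1 u = f u - I" for u
  have [measurable]: "f1 \<in> borel_measurable borel" unfolding f1_def by measurable
  have B1: "\<bar>f1 u\<bar> \<le> B + \<bar>I\<bar>" if "norm u = 1" for u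
    using B[OF that] by (simp add: f1_def)
  have I1: "(\<integral>\<^sub>Su. f1 u) = 0"
    using int_f by (simp add: f1_def I_def)
  have T1: "cosine_transform p f1 v = cosine_transform p f v - m * I" if v: "norm v = 1" for v
  proof -
    have "integrable sphere_law (\<lambda>u. cos_kernel p v u * f u)"
      by (rule integrable_cosine_transform[OF p0 f B v])
    moreover have "integrable sphere_law (\<lambda>u. cos_kernel p v u * I)"
      by (rule integrable_cosine_transform[OF p0 _ _ v, where B="\<bar>I\<bar>"]) auto
    ultimately show ?thesis
      unfolding cosine_transform_def f1_def right_diff_distrib m_def
      by (simp add: integral_abs_inner_powr[OF p0 v])
  qed
  have eig1: "cosine_transform p f1 v = L * f1 v" if v: "norm v = 1" for v
  proof -
    have "(n + p) * cosine_transform p f v = m * (p * f v + n * I)"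
      using eq[OF v] m unfolding \<beta> n_def[symmetric] m_def[symmetric] by (simp add: field_simps)
    then have "(n + p) * cosine_transform p f1 v = p * m * f1 v"
      by (simp add: T1[OF v] f1_def algebra_simps)
    also have "\<dots> = (n + p) * (L * f1 v)" unfolding nL[symmetric] by simp
    finally show ?thesis using n p by simp
  qed
  define q where "q v = (\<integral>\<^sub>Su. f1 u * (v \<bullet> u) ^ 2)" for v
  have qm[measurable]: "q \<in> borel_measurable borel"
    unfolding q_def by (rule borel_measurable_integral_sphere_law) (simp add: borel_prod[symmetric])
  have sq: "(x \<bullet> y) ^ 2 \<le> 1" if "norm x = 1" "norm y = 1" for x y :: 'a
    using abs_inner_le_1[OF that] by (simp add: abs_square_le_1)
  have bd2: "\<bar>f1 u * (v \<bullet> u) ^ 2\<bar> \<le> B + \<bar>I\<bar>" if u: "norm u = 1" and v: "norm v = 1" for u v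
  proof -
    have "\<bar>f1 u\<bar> * (v \<bullet> u) ^ 2 \<le> (B + \<bar>I\<bar>) * 1"
      using B1[OF u] sq[OF v u] B0 by (intro mult_mono) auto
    then show ?thesis by (simp add: abs_mult)
  qed
  have qB: "\<bar>q v\<bar> \<le> B + \<bar>I\<bar>" if "norm v = 1" for v
    unfolding q_def by (rule abs_integral_sphere_law_le) (use bd2 that in auto)
  \<comment> \<open>The function \<open>q\<close> is the cosine transform of \<open>f1\<close> with
    exponent 2, whose kernel is (v.u)^2. Since that transform multiplies \<open>q\<close> by
    \<open>multiplier 2 2\<close>, dividing by this number makes \<open>f1\<close> and
    \<open>\<kappa> * q\<close> have the same second moments.\<close>
  define \<kappa> where "\<kappa> = 1 / multiplier 2 2"
  define f2 where "f2 v = f1 v - \<kappa> * q v" for v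
  have f2m[measurable]: "f2 \<in> borel_measurable borel" unfolding f2_def by measurable
  have B2: "\<bar>f2 v\<bar> \<le> (B + \<bar>I\<bar>) + \<bar>\<kappa>\<bar> * (B + \<bar>I\<bar>)" if v: "norm v = 1" for v
  proof -
    have "\<bar>f2 v\<bar> \<le> \<bar>f1 v\<bar> + \<bar>\<kappa>\<bar> * \<bar>q v\<bar>" unfolding f2_def by (simp flip: abs_mult)
    also have "\<dots> \<le> (B + \<bar>I\<bar>) + \<bar>\<kappa>\<bar> * (B + \<bar>I\<bar>)"
      using B1[OF v] qB[OF v] by (intro add_mono mult_left_mono) auto
    finally show ?thesis .
  qed
  have int_q: "integrable sphere_law q" by (rule integrable_sphere_law[OF qm qB])
  have int_1: "integrable sphere_law f1" by (rule integrable_sphere_law[OF _ B1]) measurable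
  have Tq: "cosine_transform r q v = multiplier r 2 * q v" if "r \<ge> 0" "norm v = 1" for r v
    unfolding cosine_transform_def q_def
    by (rule cosine_transform_quadratic[OF that(1) _ B1 I1 that(2)]) measurable
  have eig2: "cosine_transform p f2 v = L * f2 v" if v: "norm v = 1" for v
  proof -
    have "integrable sphere_law (\<lambda>u. cos_kernel p v u * f1 u)"
      by (rule integrable_cosine_transform[OF p0 _ B1 v]) measurable
    moreover have "integrable sphere_law (\<lambda>u. cos_kernel p v u * q u)"
      by (rule integrable_cosine_transform[OF p0 qm qB v])
    ultimately have "cosine_transform p f2 v = cosine_transform p f1 v - \<kappa> * cosine_transform p q v"
      unfolding cosine_transform_def f2_def right_diff_distrib by (simp add: mult.left_commute)
    then show ?thesis using eig1[OF v] Tq[OF p0 v] by (simp add: f2_def L_def algebra_simps)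
  qed
  have Iq: "(\<integral>\<^sub>Sv. q v) = 0"
  proof -
    have "(\<integral>\<^sub>Sv. q v) = (\<integral>\<^sub>Su. (\<integral>\<^sub>Sv. f1 u * (v \<bullet> u) ^ 2))"
      unfolding q_def by (rule sphere_law_Fubini[OF _ bd2]) (simp add: borel_prod[symmetric])
    also have "\<dots> = (\<integral>\<^sub>Su. f1 u * (1 / n))"
    proof (rule integral_sphere_law_cong)
      show "(\<lambda>u. \<integral>\<^sub>Sv. f1 u * (v \<bullet> u) ^ 2) \<in> borel_measurable borel"
        by (rule borel_measurable_integral_sphere_law) (simp add: borel_prod[symmetric])
      fix u :: 'a assume "norm u = 1"
      then show "(\<integral>\<^sub>Sv. f1 u * (v \<bullet> u) ^ 2) = f1 u * (1 / n)"
        using inner_sphere_moment[of u] by (simp add: n_def inner_commute)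
    qed measurable
    also have "\<dots> = 0" using I1 by simp
    finally show ?thesis .
  qed
  have m0: "(\<integral>\<^sub>Su. f2 u) = 0"
    unfolding f2_def using int_1 int_q I1 Iq by simp
  have m2: "(\<integral>\<^sub>Su. f2 u * (e \<bullet> u) ^ 2) = 0" if e: "norm e = 1" for e
  proof -
    have "(\<integral>\<^sub>Su. (e \<bullet> u) ^ 2 * q u) = multiplier 2 2 * q e"
      using Tq[of 2 e] e by (simp add: cosine_transform_def)
    moreover have "integrable sphere_law (\<lambda>u. (e \<bullet> u) ^ 2 * q u)"
      using integrable_cosine_transform[OF _ qm qB e, of 2] by simp
    moreover have "integrable sphere_law (\<lambda>u. f1 u * (e \<bullet> u) ^ 2)"
      by (rule integrable_sphere_law[OF _ bd2]) (use e in auto)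
    moreover have "multiplier 2 2 \<noteq> 0" using multiplier_2_pos[of 2] by simp
    ultimately show ?thesis
      by (simp add: f2_def left_diff_distrib \<kappa>_def q_def[symmetric] mult.assoc mult.commute[of "q _"])
  qed
  have f2: "f2 v = 0" if "norm v = 1" for v
    by (rule eigenfunction_eq_0[OF p f2m B2 _ m0 m2 that]) (use eig2 in \<open>auto simp: L_def\<close>)
  \<comment> \<open>At unit vectors the constant \<open>I\<close> is the quadratic form
    \<open>I * (v \<bullet> v)\<close>, and \<open>q\<close> is the form of the operator integrating
    \<open>f1 u\<close> times the rank-one map v to (v.u) u.\<close>
  define S where "S v = I *\<^sub>R v + \<kappa> *\<^sub>R (\<integral>\<^sub>Su. (f1 u * (v \<bullet> u)) *\<^sub>R u)" for v
  have intS: "integrable sphere_law (\<lambda>u. (f1 u * (v \<bullet> u)) *\<^sub>R u)" for v :: 'a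
  proof (rule sphere_law.integrable_const_bound[where B="(B + \<bar>I\<bar>) * norm v"])
    show "AE u in sphere_law. norm ((f1 u * (v \<bullet> u)) *\<^sub>R u) \<le> (B + \<bar>I\<bar>) * norm v"
      using AE_sphere_law
    proof eventually_elim
      fix u :: 'a assume u: "norm u = 1"
      show "norm ((f1 u * (v \<bullet> u)) *\<^sub>R u) \<le> (B + \<bar>I\<bar>) * norm v"
        using B1[OF u] Cauchy_Schwarz_ineq2[of v u] u B0 by (auto simp: abs_mult intro!: mult_mono)
    qed
  qed measurable
  have "linear S"
  proof (rule linearI)
    fix v w :: 'a and c :: real
    have "(\<integral>\<^sub>Su. (f1 u * ((v + w) \<bullet> u)) *\<^sub>R u) = (\<integral>\<^sub>Su. (f1 u * (v \<bullet> u)) *\<^sub>R u + (f1 u * (w \<bullet> u)) *\<^sub>R u)"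
      by (simp add: inner_add_left distrib_left scaleR_add_left)
    then show "S (v + w) = S v + S w"
      unfolding S_def using intS by (simp add: algebra_simps)
    have "(\<integral>\<^sub>Su. (f1 u * ((c *\<^sub>R v) \<bullet> u)) *\<^sub>R u) = (\<integral>\<^sub>Su. c *\<^sub>R ((f1 u * (v \<bullet> u)) *\<^sub>R u))"
      by (simp add: mult.left_commute)
    also have "\<dots> = c *\<^sub>R (\<integral>\<^sub>Su. (f1 u * (v \<bullet> u)) *\<^sub>R u)"
      by (rule integral_scaleR_right)
    finally have eq: "(\<integral>\<^sub>Su. (f1 u * ((c *\<^sub>R v) \<bullet> u)) *\<^sub>R u) = c *\<^sub>R (\<integral>\<^sub>Su. (f1 u * (v \<bullet> u)) *\<^sub>R u)" .
    show "S (c *\<^sub>R v) = c *\<^sub>R S v"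
      unfolding S_def eq by (simp add: scaleR_add_right mult.commute)
  qed
  moreover have "f v = v \<bullet> S v" if v: "norm v = 1" for v
  proof -
    have "v \<bullet> (\<integral>\<^sub>Su. (f1 u * (v \<bullet> u)) *\<^sub>R u) = (\<integral>\<^sub>Su. v \<bullet> ((f1 u * (v \<bullet> u)) *\<^sub>R u))"
      by (rule integral_inner_right[OF intS, symmetric])
    also have "\<dots> = q v" by (simp add: q_def power2_eq_square mult.assoc)
    finally have "v \<bullet> S v = I + \<kappa> * q v"
      using v by (simp add: S_def inner_add_right norm_eq_1)
    then show ?thesis using f2[OF v] by (simp add: f2_def f1_def)
  qed
  ultimately show ?thesis by (rule that)
qed

end

section \<open>Bodies close to the ball\<close>

text \<open>Interface that hides the auxiliary orthonormal pair, chosen here from the standard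
  basis.\<close>

lemma cosine_transform_structure:
  fixes p :: real
  assumes "DIM('a::euclidean_space) \<ge> 2" and p: "p > 0"
  obtains m where "m > 0" "\<And>v :: 'a. norm v = 1 \<Longrightarrow> (\<integral>\<^sub>Su. cos_kernel p v u) = m"
    "\<And>(f :: 'a \<Rightarrow> real) B \<beta>. f \<in> borel_measurable borel \<Longrightarrow> (\<And>u. norm u = 1 \<Longrightarrow> \<bar>f u\<bar> \<le> B) \<Longrightarrow>
       (\<And>v. norm v = 1 \<Longrightarrow> p * f v = \<beta> + (DIM('a) + p) / m * cosine_transform p f v) \<Longrightarrow>
       \<exists>S. linear S \<and> (\<forall>v. norm v = 1 \<longrightarrow> f v = v \<bullet> S v)"
proof -
  obtain a :: 'a where a: "a \<in> Basis" using nonempty_Basis by blast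
  have "card (Basis - {a}) \<noteq> 0" using assms(1) a by (simp add: card_Diff_singleton)
  then obtain b :: 'a where b: "b \<in> Basis" "b \<noteq> a" by (metis DiffE card.empty equals0I insertI1)
  interpret orthonormal_pair a b
    by standard (use a b in \<open>auto simp: inner_not_same_Basis\<close>)
  show ?thesis
  proof (rule that[of "pair_moment p 0 0"])
    show "pair_moment p 0 0 > 0" by (rule pair_moment_0_0_pos[OF p])
    show "(\<integral>\<^sub>Su. cos_kernel p v u) = pair_moment p 0 0" if "norm v = 1" for v :: 'a
      using integral_abs_inner_powr[of p v] p that by simp
    fix f :: "'a \<Rightarrow> real" and B \<beta>
    assume "f \<in> borel_measurable borel" "\<And>u. norm u = 1 \<Longrightarrow> \<bar>f u\<bar> \<le> B"
      "\<And>v. norm v = 1 \<Longrightarrow> p * f v = \<beta> + (DIM('a) + p) / pair_moment p 0 0 * cosine_transform p f v"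
    from cosine_transform_fixed_imp_quadratic[OF p this]
    show "\<exists>S. linear S \<and> (\<forall>v. norm v = 1 \<longrightarrow> f v = v \<bullet> S v)" by metis
  qed
qed

section \<open>Lipschitz bounds for powers, and support and radial functions near the ball\<close>

lemma powr_Lipschitz:
  fixes a b q :: real
  assumes "0 < a"
  obtains C where "C > 0" "\<And>x y. x \<in> {a..b} \<Longrightarrow> y \<in> {a..b} \<Longrightarrow> \<bar>x powr q - y powr q\<bar> \<le> C * \<bar>x - y\<bar>"
proof -
  have "compact ((\<lambda>x. q * x powr (q - 1)) ` {a..b})"
    using assms by (intro compact_continuous_image continuous_intros compact_Icc) auto
  then obtain C where C: "\<And>x. x \<in> {a..b} \<Longrightarrow> \<bar>q * x powr (q - 1)\<bar> \<le> C"
    using compact_imp_bounded by (fastforce simp: bounded_iff)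
  have "\<bar>x powr q - y powr q\<bar> \<le> max C 1 * \<bar>x - y\<bar>" if "x \<in> {a..b}" "y \<in> {a..b}" for x y
    using field_differentiable_bound[of "{a..b}" "\<lambda>x. x powr q" "\<lambda>x. q * x powr (q - 1)" "max C 1" y x] that C assms
    by (force intro!: has_field_derivative_at_within[OF has_real_derivative_powr] simp: abs_minus_commute)
  then show ?thesis by (intro that[of "max C 1"]) (simp_all add: less_max_iff_disj)
qed

text \<open>On [-1, 1] the function \<open>?G\<close> has derivative
  \<open>p * \<bar>z\<bar> powr (p - 1)\<close>, also at 0, and this is at most \<open>p\<close>
  because p > 1; at nonnegative points \<open>?G\<close> is the power itself.\<close>

lemma abs_powr_Lipschitz:
  fixes s t p :: real
  assumes p: "p > 1" and st: "\<bar>s\<bar> \<le> 1" "\<bar>t\<bar> \<le> 1"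
  shows "\<bar>\<bar>s\<bar> powr p - \<bar>t\<bar> powr p\<bar> \<le> p * \<bar>s - t\<bar>"
proof -
  let ?G = "\<lambda>x. \<bar>x\<bar> powr (p - 1) * x"
  have G: "?G \<bar>x\<bar> = \<bar>x\<bar> powr p" for x
    by (cases "x = 0") (auto simp: powr_mult_base' powr_diff)
  have "norm (?G \<bar>s\<bar> - ?G \<bar>t\<bar>) \<le> p * norm (\<bar>s\<bar> - \<bar>t\<bar>)"
  proof (rule field_differentiable_bound[of "{-1..1}"])
    fix z :: real assume z: "z \<in> {-1..1}"
    show "(?G has_field_derivative p * \<bar>z\<bar> powr (p - 1)) (at z within {-1..1})"
      using has_real_derivative_abs_powr_times[of "p - 1" z] p by (auto intro: has_field_derivative_at_within)
    show "norm (p * \<bar>z\<bar> powr (p - 1)) \<le> p"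
      using powr_mono2[of "p - 1" "\<bar>z\<bar>" 1] z p by (auto simp: abs_mult)
  qed (use st in auto)
  then have "\<bar>\<bar>s\<bar> powr p - \<bar>t\<bar> powr p\<bar> \<le> p * \<bar>\<bar>s\<bar> - \<bar>t\<bar>\<bar>" unfolding G by simp
  also have "\<dots> \<le> p * \<bar>s - t\<bar>" using p by (intro mult_left_mono) auto
  finally show ?thesis .
qed

text \<open>Separation by a hyperplane. A point of \<open>K\<close> in each direction replaces the
  supremum, which makes the criterion directly applicable to linear images.\<close>

lemma mem_convex_if_le_support:
  fixes K :: "'a::euclidean_space set"
  assumes K: "closed K" "convex K" "K \<noteq> {}"
    and le: "\<And>\<theta>. norm \<theta> = 1 \<Longrightarrow> \<exists>y\<in>K. x \<bullet> \<theta> \<le> y \<bullet> \<theta>"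
  shows "x \<in> K"
proof (rule ccontr)
  assume "x \<notin> K"
  then obtain a b where ab: "a \<bullet> x < b" "\<And>y. y \<in> K \<Longrightarrow> a \<bullet> y > b"
    using separating_hyperplane_closed_point[OF K(2,1)] by metis
  have a: "a \<noteq> 0" using ab K(3) by force
  obtain y where y: "y \<in> K" "x \<bullet> (- (1 / norm a) *\<^sub>R a) \<le> y \<bullet> (- (1 / norm a) *\<^sub>R a)"
    using le[of "- (1 / norm a) *\<^sub>R a"] a by auto
  then have "(a \<bullet> y) / norm a \<le> (a \<bullet> x) / norm a" by (simp add: inner_commute)
  then have "a \<bullet> y \<le> a \<bullet> x" using a by (simp add: divide_le_cancel)
  then show False using ab y(1) by force
qed

lemma support_function_attained:
  assumes "convex_body K"
  obtains y where "y \<in> K" "y \<bullet> v = support_function K v"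
proof -
  have "compact K" "K \<noteq> {}" using assms by (auto simp: convex_body_def)
  then obtain y where y: "y \<in> K" "\<And>x. x \<in> K \<Longrightarrow> x \<bullet> v \<le> y \<bullet> v"
    using continuous_attains_sup[of K "\<lambda>x. x \<bullet> v"] continuous_on_inner[OF continuous_on_id continuous_on_const]
    by metis
  then have "support_function K v = y \<bullet> v"
    unfolding support_function_def by (intro cSup_eq_maximum) auto
  then show ?thesis using that y(1) by simp
qed

lemma set_integral_polar:
  fixes K :: "'a::euclidean_space set" and p :: real
  assumes K: "compact K" "convex K" "0 \<in> K" and p: "p \<ge> 0"
  shows "(LINT x:K|lborel. cos_kernel p \<theta> x) = DIM('a) / (DIM('a) + p) * measure lborel (cball (0::'a) 1) *
     (\<integral>\<^sub>Su. cos_kernel p \<theta> u * radial K u powr (DIM('a) + p))"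
proof -
  have [measurable]: "K \<in> sets borel" using K(1) by (simp add: borel_closed compact_imp_closed)
  note [measurable] = borel_measurable_radial[OF K]
  have pol: "(\<integral>\<^sup>+x. ennreal (cos_kernel p \<theta> x) * indicator K x \<partial>lborel)
    = ennreal (DIM('a) / (DIM('a) + p)) * emeasure lborel (cball (0::'a) 1) *
      (\<integral>\<^sup>+u. ennreal (cos_kernel p \<theta> u * radial K u powr (DIM('a) + p)) \<partial>sphere_law)"
    by (rule nn_integral_polar[OF K p]) (auto simp: abs_mult powr_mult)
  \<comment> \<open>Both integrals have nonnegative integrands and are read through
    \<open>enn2real\<close>, so integrability does not have to be established.\<close>
  have "(LINT x:K|lborel. cos_kernel p \<theta> x) = enn2real (\<integral>\<^sup>+x. ennreal (indicator K x *\<^sub>R cos_kernel p \<theta> x) \<partial>lborel)"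
    unfolding set_lebesgue_integral_def by (rule integral_eq_nn_integral) auto
  also have "(\<integral>\<^sup>+x. ennreal (indicator K x *\<^sub>R cos_kernel p \<theta> x) \<partial>lborel) = (\<integral>\<^sup>+x. ennreal (cos_kernel p \<theta> x) * indicator K x \<partial>lborel)"
    by (intro nn_integral_cong) (auto simp: indicator_def)
  also have "enn2real \<dots> = DIM('a) / (DIM('a) + p) * measure lborel (cball (0::'a) 1) *
     enn2real (\<integral>\<^sup>+u. ennreal (cos_kernel p \<theta> u * radial K u powr (DIM('a) + p)) \<partial>sphere_law)"
    using p unfolding pol by (simp add: enn2real_mult measure_def)
  also have "enn2real (\<integral>\<^sup>+u. ennreal (cos_kernel p \<theta> u * radial K u powr (DIM('a) + p)) \<partial>sphere_law)
     = (\<integral>\<^sub>Su. cos_kernel p \<theta> u * radial K u powr (DIM('a) + p))"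
    by (rule integral_eq_nn_integral[symmetric]) auto
  finally show ?thesis .
qed

text \<open>The bound 1/4 keeps radial and support functions between 3/4 and 5/4 on the sphere,
  where powers have uniform Lipschitz constants; r is positive because deviations are divided by
  it.\<close>

definition near_ball :: "(real ^ 'n) set \<Rightarrow> real \<Rightarrow> bool" where
  "near_ball K r \<longleftrightarrow> convex_body K \<and> 0 < r \<and> r \<le> 1 / 4 \<and> cball 0 (1 - r) \<subseteq> K \<and> K \<subseteq> cball 0 (1 + r)"

lemma near_ball_bounds:
  fixes K :: "(real ^ 'n) set"
  assumes "near_ball K r"
  shows "compact K" "convex K" "0 \<in> K"
    and "norm u = 1 \<Longrightarrow> 1 - r \<le> radial K u \<and> radial K u \<le> support_function K u \<and> support_function K u \<le> 1 + r"
proof -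
  have body: "convex_body K" and r: "0 < r" "r \<le> 1 / 4" and sub: "cball 0 (1 - r) \<subseteq> K" "K \<subseteq> cball 0 (1 + r)"
    using assms by (auto simp: near_ball_def)
  show K: "compact K" "convex K" using body by (auto simp: convex_body_def)
  show K0: "0 \<in> K" using sub(1) r by auto
  assume u: "norm u = 1"
  then have u0: "u \<noteq> 0" by auto
  have "(1 - r) *\<^sub>R u \<in> K" using sub(1) u r by auto
  then have 1: "1 - r \<le> radial K u"
    using scaleR_mem_iff_le_radial[OF K K0 u0, of "1 - r"] r by simp
  have "radial K u *\<^sub>R u \<in> K"
    using scaleR_mem_iff_le_radial[OF K K0 u0, of "radial K u"] radial_nonneg[OF K K0, of u] by simp
  from support_function_upper[OF body this, of u] have 2: "radial K u \<le> support_function K u"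
    using u by (simp add: norm_eq_1)
  obtain y where y: "y \<in> K" "y \<bullet> u = support_function K u"
    using support_function_attained[OF body] by metis
  have "y \<bullet> u \<le> norm y * norm u" by (rule norm_cauchy_schwarz)
  also have "\<dots> \<le> 1 + r" using sub(2) y(1) u by auto
  finally show "1 - r \<le> radial K u \<and> radial K u \<le> support_function K u \<and> support_function K u \<le> 1 + r"
    using 1 2 y(2) by simp
qed

text \<open>With d the distance from u to \<theta>, the point t u projects onto \<theta> with length
  t (1 - d^2 / 2), whereas h(\<theta>) is at least h(u) - M d. The quadratic gain in d beats the
  linear loss once t is lowered by M^2. For M proportional to r this is the second-order bound on h
  - \<rho>.\<close>

lemma radial_ge_if_Lipschitz:
  fixes K :: "(real ^ 'n) set"
  assumes K: "near_ball K r" and u: "norm u = 1"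
    and lip: "\<And>\<theta>. norm \<theta> = 1 \<Longrightarrow> \<bar>support_function K u - support_function K \<theta>\<bar> \<le> M * norm (u - \<theta>)"
    and M: "M ^ 2 \<le> 1 / 4"
  shows "support_function K u - M ^ 2 \<le> radial K u"
proof -
  have body: "convex_body K" and r: "0 < r" "r \<le> 1 / 4" using K by (auto simp: near_ball_def)
  define t where "t = support_function K u - M ^ 2"
  have t: "t \<ge> 1 / 2" using near_ball_bounds(4)[OF K u] r M by (simp add: t_def)
  have "t *\<^sub>R u \<in> K"
  proof (rule mem_convex_if_le_support)
    show "closed K" "convex K" "K \<noteq> {}"
      using near_ball_bounds[OF K] by (auto intro: compact_imp_closed)
    fix \<theta> :: "real ^ 'n" assume \<theta>: "norm \<theta> = 1"
    define d where "d = norm (u - \<theta>)"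
    have "d ^ 2 = 2 - 2 * (u \<bullet> \<theta>)"
      using u \<theta> by (simp add: d_def power2_norm_eq_inner inner_diff_left inner_diff_right norm_eq_1 inner_commute)
    then have ut: "u \<bullet> \<theta> = 1 - d ^ 2 / 2" by linarith
    \<comment> \<open>The square is weighted so that its term d^2 / 4 is covered by t d^2 / 2, using
      t \<ge> 1/2.\<close>
    have "(d / 2 - M) ^ 2 \<ge> 0" by simp
    then have "M * d \<le> M ^ 2 + d ^ 2 / 4" by (simp add: power2_eq_square algebra_simps)
    moreover have "1 / 2 * d ^ 2 \<le> t * d ^ 2" using t by (intro mult_right_mono) auto
    moreover have "t * (u \<bullet> \<theta>) = t - t * d ^ 2 / 2" by (simp add: ut algebra_simps)
    ultimately have "t * (u \<bullet> \<theta>) \<le> support_function K u - M * d"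
      using t_def by linarith
    also have "\<dots> \<le> support_function K \<theta>" using lip[OF \<theta>] by (simp add: d_def)
    finally have le: "(t *\<^sub>R u) \<bullet> \<theta> \<le> support_function K \<theta>" by simp
    obtain y where "y \<in> K" "y \<bullet> \<theta> = support_function K \<theta>"
      using support_function_attained[OF body] by metis
    then show "\<exists>y\<in>K. (t *\<^sub>R u) \<bullet> \<theta> \<le> y \<bullet> \<theta>" using le by (intro bexI[of _ y]) auto
  qed
  moreover have "u \<noteq> 0" using u by auto
  ultimately have "t \<le> radial K u"
    using scaleR_mem_iff_le_radial[OF near_ball_bounds(1-3)[OF K], of u t] t by simp
  then show ?thesis by (simp add: t_def)
qed

text \<open>The form of the fixed point equation that survives linear maps: the free factor
  \<open>A\<close> absorbs the scalar, the volume and the determinant, and the centroid body is no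
  longer mentioned.\<close>

definition moment_fixed :: "real \<Rightarrow> (real ^ 'n) set \<Rightarrow> bool" where
  "moment_fixed p K \<longleftrightarrow> (\<exists>A. \<forall>\<theta>. norm \<theta> = 1 \<longrightarrow>
     support_function K \<theta> powr p = A * (LINT x:K|lborel. cos_kernel p \<theta> x))"

lemma moment_fixed_sphere:
  fixes K :: "(real ^ 'n) set" and p :: real
  assumes p: "p > 1" and K: "near_ball K r" and fp: "moment_fixed p K"
  obtains \<kappa> where "\<kappa> > 0" "\<And>\<theta>. norm \<theta> = 1 \<Longrightarrow>
     support_function K \<theta> powr p = \<kappa> * (\<integral>\<^sub>Su. cos_kernel p \<theta> u * radial K u powr (CARD('n) + p))"
proof -
  obtain A where A: "\<And>\<theta>. norm \<theta> = 1 \<Longrightarrow> support_function K \<theta> powr p = A * (LINT x:K|lborel. cos_kernel p \<theta> x)"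
    using fp by (auto simp: moment_fixed_def)
  define \<kappa> where "\<kappa> = A * (CARD('n) / (CARD('n) + p) * measure lborel (cball (0 :: real ^ 'n) 1))"
  let ?I = "\<lambda>\<theta>. (\<integral>\<^sub>Su. cos_kernel p \<theta> u * radial K u powr (CARD('n) + p))"
  have eq: "support_function K \<theta> powr p = \<kappa> * ?I \<theta>" if "norm \<theta> = 1" for \<theta>
    using A[OF that] set_integral_polar[OF near_ball_bounds(1-3)[OF K], of p \<theta>] p by (simp add: \<kappa>_def)
  obtain \<theta> :: "real ^ 'n" where \<theta>: "norm \<theta> = 1" using vector_choose_size[of 1] by auto
  have "support_function K \<theta> > 0" using near_ball_bounds(4)[OF K \<theta>] K by (auto simp: near_ball_def)
  then have "\<kappa> * ?I \<theta> > 0" by (simp flip: eq[OF \<theta>])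
  moreover have "?I \<theta> \<ge> 0" by (rule integral_nonneg_AE) auto
  ultimately have "\<kappa> > 0" by (simp add: zero_less_mult_iff)
  then show ?thesis by (rule that[OF _ eq])
qed

section \<open>Linearization at the ball\<close>

text \<open>The integral of the kernel is the same for all directions, so in the difference of the
  equations at \<theta> and \<theta>' the density \<rho>^q may be replaced by \<rho>^q - 1, which is
  O(r). The difference of the kernels contributes the distance of \<theta> and \<theta>'.\<close>

lemma near_ball_regularity:
  fixes p :: real
  assumes p: "p > 1" and n: "CARD('n::finite) \<ge> 2"
  obtains C where "C > 0"
    "\<And>(K :: (real ^ 'n) set) r \<theta> \<theta>'. near_ball K r \<Longrightarrow> moment_fixed p K \<Longrightarrow> norm \<theta> = 1 \<Longrightarrow> norm \<theta>' = 1 \<Longrightarrow>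
       \<bar>support_function K \<theta> - support_function K \<theta>'\<bar> \<le> C * r * norm (\<theta> - \<theta>')"
proof -
  obtain m where m: "m > 0" "\<And>v :: real ^ 'n. norm v = 1 \<Longrightarrow> (\<integral>\<^sub>Su. cos_kernel p v u) = m"
  proof -
    have "DIM(real ^ 'n) \<ge> 2" "p > 0" using n p by simp_all
    then show thesis by (rule cosine_transform_structure) (rule that)
  qed
  define q where "q = CARD('n) + p"
  have q: "q > 0" using p by (simp add: q_def add_nonneg_pos)
  obtain C1 where C1: "C1 > 0" "\<And>x y. x \<in> {3/4..5/4} \<Longrightarrow> y \<in> {3/4..5/4} \<Longrightarrow> \<bar>x powr q - y powr q\<bar> \<le> C1 * \<bar>x - y\<bar>"
    using powr_Lipschitz[of "3/4" "5/4" q] by auto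
  obtain C2 where C2: "C2 > 0" "\<And>x y. x \<in> {(3/4) powr p..(5/4) powr p} \<Longrightarrow> y \<in> {(3/4) powr p..(5/4) powr p} \<Longrightarrow>
      \<bar>x powr (1 / p) - y powr (1 / p)\<bar> \<le> C2 * \<bar>x - y\<bar>"
    using powr_Lipschitz[of "(3/4) powr p" "(5/4) powr p" "1 / p"] by auto
  \<comment> \<open>An upper bound for \<kappa>, obtained from h \<le> 5/4 on the left and \<rho>
    \<ge> 3/4 on the right of the equation.\<close>
  define D where "D = (5/4) powr p / (m * (3/4) powr q)"
  have D: "D > 0" using m by (simp add: D_def)
  show ?thesis
  proof (rule that[of "C2 * (D * (p * C1))"])
    show "C2 * (D * (p * C1)) > 0" using C1 C2 D p by simp
    fix K :: "(real ^ 'n) set" and r and \<theta> \<theta>' :: "real ^ 'n"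
    assume K: "near_ball K r" and fp: "moment_fixed p K" and t: "norm \<theta> = 1" "norm \<theta>' = 1"
    let ?h = "support_function K" and ?\<rho> = "radial K"
    let ?D = "\<lambda>u. (cos_kernel p \<theta> u - cos_kernel p \<theta>' u) * (?\<rho> u powr q - 1)" and ?I = "\<lambda>v. (\<integral>\<^sub>Su. cos_kernel p v u * ?\<rho> u powr q)"
    have r: "0 < r" "r \<le> 1 / 4" using K by (auto simp: near_ball_def)
    note bounds = near_ball_bounds(4)[OF K]
    have [measurable]: "?\<rho> \<in> borel_measurable borel" by (rule borel_measurable_radial[OF near_ball_bounds(1-3)[OF K]])
    obtain \<kappa> where \<kappa>: "\<kappa> > 0" "\<And>\<theta>. norm \<theta> = 1 \<Longrightarrow> ?h \<theta> powr p = \<kappa> * ?I \<theta>"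
      using moment_fixed_sphere[OF p K fp, folded q_def] by blast
    have \<rho>: "?\<rho> u \<in> {3/4..5/4}" "\<bar>?\<rho> u - 1\<bar> \<le> r" if "norm u = 1" for u
      using bounds[OF that] r by auto
    have \<rho>q: "(3/4) powr q \<le> ?\<rho> u powr q" "?\<rho> u powr q \<le> (5/4) powr q" if "norm u = 1" for u
      using \<rho>(1)[OF that] q by (auto intro!: powr_mono2)
    have int1: "integrable sphere_law (\<lambda>u. cos_kernel p v u * ?\<rho> u powr q)" if "norm v = 1" for v
      using p \<rho>q that by (intro integrable_cosine_transform[where B="(5/4) powr q"]) auto
    have int0: "integrable sphere_law (\<lambda>u. cos_kernel p v u * c)" if "norm v = 1" for v and c :: real
      using p that by (intro integrable_cosine_transform[where B="\<bar>c\<bar>"]) auto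
    have "\<kappa> * (m * (3/4) powr q) \<le> \<kappa> * ?I \<theta>"
    proof (rule mult_left_mono)
      have "m * (3/4) powr q = (\<integral>\<^sub>Su. cos_kernel p \<theta> u * (3/4) powr q)"
        using m(2)[OF t(1)] by simp
      also have "\<dots> \<le> ?I \<theta>"
      proof (rule integral_mono_AE[OF int0[OF t(1)] int1[OF t(1)]])
        show "AE u in sphere_law. cos_kernel p \<theta> u * (3/4) powr q \<le> cos_kernel p \<theta> u * ?\<rho> u powr q"
          using AE_sphere_law by eventually_elim (intro mult_left_mono \<rho>q, auto)
      qed
      finally show "m * (3/4) powr q \<le> ?I \<theta>" .
    qed (use \<kappa> in simp)
    also have "\<dots> = ?h \<theta> powr p" using \<kappa>(2)[OF t(1)] by simp
    also have "\<dots> \<le> (5/4) powr p" using bounds[OF t(1)] r p by (intro powr_mono2) auto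
    finally have \<kappa>D: "\<kappa> \<le> D" using m by (simp add: D_def pos_le_divide_eq)
    have bd: "\<bar>?D u\<bar> \<le> (p * norm (\<theta> - \<theta>')) * (C1 * r)"
      if u: "norm u = 1" for u
    proof -
      have "\<bar>cos_kernel p \<theta> u - cos_kernel p \<theta>' u\<bar> \<le> p * \<bar>\<theta> \<bullet> u - \<theta>' \<bullet> u\<bar>"
        by (rule abs_powr_Lipschitz[OF p]) (rule abs_inner_le_1[OF _ u], fact)+
      also have "\<dots> \<le> p * norm (\<theta> - \<theta>')"
        using Cauchy_Schwarz_ineq2[of "\<theta> - \<theta>'" u] u p by (intro mult_left_mono) (auto simp: inner_diff_left)
      finally have 1: "\<bar>cos_kernel p \<theta> u - cos_kernel p \<theta>' u\<bar> \<le> p * norm (\<theta> - \<theta>')" .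
      have "\<bar>?\<rho> u powr q - 1 powr q\<bar> \<le> C1 * \<bar>?\<rho> u - 1\<bar>" by (rule C1(2)[OF \<rho>(1)[OF u]]) simp
      also have "\<dots> \<le> C1 * r" using \<rho>(2)[OF u] C1 by (intro mult_left_mono) auto
      finally have 2: "\<bar>?\<rho> u powr q - 1\<bar> \<le> C1 * r" by simp
      show ?thesis unfolding abs_mult using 1 2 p C1 r by (intro mult_mono) auto
    qed
    have "?h \<theta> powr p - ?h \<theta>' powr p = \<kappa> * (\<integral>\<^sub>Su. ?D u)"
    proof -
      have "(\<integral>\<^sub>Su. ?D u)
        = (\<integral>\<^sub>Su. (cos_kernel p \<theta> u * ?\<rho> u powr q - cos_kernel p \<theta> u * 1) - (cos_kernel p \<theta>' u * ?\<rho> u powr q - cos_kernel p \<theta>' u * 1))"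
        by (simp add: algebra_simps)
      also have "\<dots> = (?I \<theta> - m) - (?I \<theta>' - m)"
        using int1[OF t(1)] int1[OF t(2)] int0[OF t(1), of 1] int0[OF t(2), of 1] m(2)[OF t(1)] m(2)[OF t(2)]
        by simp
      finally have E: "(\<integral>\<^sub>Su. ?D u)
        = (?I \<theta> - m) - (?I \<theta>' - m)" .
      show ?thesis unfolding E \<kappa>(2)[OF t(1)] \<kappa>(2)[OF t(2)] by (simp add: right_diff_distrib)
    qed
    then have "\<bar>?h \<theta> powr p - ?h \<theta>' powr p\<bar> = \<kappa> * \<bar>\<integral>\<^sub>Su. ?D u\<bar>"
      using \<kappa>(1) by (simp add: abs_mult)
    also have "\<dots> \<le> D * ((p * norm (\<theta> - \<theta>')) * (C1 * r))"
    proof (intro mult_mono \<kappa>D)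
      show "\<bar>\<integral>\<^sub>Su. ?D u\<bar> \<le> (p * norm (\<theta> - \<theta>')) * (C1 * r)"
        by (rule abs_integral_sphere_law_le[OF _ bd]) measurable
    qed (use D in auto)
    finally have hp: "\<bar>?h \<theta> powr p - ?h \<theta>' powr p\<bar> \<le> D * ((p * norm (\<theta> - \<theta>')) * (C1 * r))" .
    have hm: "?h v powr p \<in> {(3/4) powr p..(5/4) powr p}" "(?h v powr p) powr (1 / p) = ?h v" if "norm v = 1" for v
      using bounds[OF that] r p by (auto intro!: powr_mono2 simp: powr_powr)
    have "\<bar>?h \<theta> - ?h \<theta>'\<bar> \<le> C2 * \<bar>?h \<theta> powr p - ?h \<theta>' powr p\<bar>"
      using C2(2)[OF hm(1)[OF t(1)] hm(1)[OF t(2)]] by (simp only: hm(2) t)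
    also have "\<dots> \<le> C2 * (D * ((p * norm (\<theta> - \<theta>')) * (C1 * r)))"
      using C2(1) by (intro mult_left_mono hp) auto
    finally show "\<bar>?h \<theta> - ?h \<theta>'\<bar> \<le> C2 * (D * (p * C1)) * r * norm (\<theta> - \<theta>')"
      by (simp add: ac_simps)
  qed
qed

lemma powr_difference_quotient_tendsto:
  fixes x r :: "nat \<Rightarrow> real"
  assumes r: "\<And>j. r j > 0" "r \<longlonglongrightarrow> 0" and y: "(\<lambda>j. (x j - 1) / r j) \<longlonglongrightarrow> y"
  shows "(\<lambda>j. (x j powr q - 1) / r j) \<longlonglongrightarrow> q * y"
proof -
  have "((\<lambda>z. z powr q) has_real_derivative q) (at 1)"
    using has_real_derivative_powr[of 1 q] by simp
  \<comment> \<open>The Caratheodory form of the derivative avoids dividing by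
    \<open>x j - 1\<close>, which may be 0.\<close>
  then obtain g where g: "\<And>z. z powr q - 1 powr q = g z * (z - 1)" "isCont g 1" "g 1 = q"
    unfolding CARAT_DERIV by blast
  have "(\<lambda>j. 1 + r j * ((x j - 1) / r j)) \<longlonglongrightarrow> 1 + 0 * y"
    by (intro tendsto_intros r y)
  moreover have "1 + r j * ((x j - 1) / r j) = x j" for j using r(1)[of j] by simp
  ultimately have "x \<longlonglongrightarrow> 1" by simp
  then have "(\<lambda>j. g (x j)) \<longlonglongrightarrow> q"
    using isCont_tendsto_compose[OF g(2), of x] g(3) by simp
  from tendsto_mult[OF this y] show ?thesis
    using g(1) by simp
qed

text \<open>With \<rho>^q = 1 + r F the equation reads h^p = \<kappa> (m + r T F), T being the
  transform that is not normalized. Subtracting 1 and dividing by r isolates (\<kappa> m - 1) / r,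
  which does not depend on the direction; its limit is the constant \<beta>.\<close>

lemma linearized_equation:
  fixes K :: "nat \<Rightarrow> (real ^ 'n::finite) set" and p :: real
  assumes p: "p > 1" and n: "CARD('n) \<ge> 2"
    and K: "\<And>j. near_ball (K j) (r j)" "\<And>j. moment_fixed p (K j)" and r: "r \<longlonglongrightarrow> 0"
    and f: "f \<in> borel_measurable borel"
    and lim: "\<And>v. norm v = 1 \<Longrightarrow> (\<lambda>j. (support_function (K j) v - 1) / r j) \<longlonglongrightarrow> f v"
    and m: "m > 0" "\<And>v :: real ^ 'n. norm v = 1 \<Longrightarrow> (\<integral>\<^sub>Su. cos_kernel p v u) = m"
  obtains \<beta> where "\<And>v. norm v = 1 \<Longrightarrow> p * f v = \<beta> + (CARD('n) + p) / m * cosine_transform p f v"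
proof -
  define q where "q = CARD('n) + p"
  have q: "q > 0" using p by (simp add: q_def add_nonneg_pos)
  have rj: "0 < r j" "r j \<le> 1 / 4" for j using K(1)[of j] by (auto simp: near_ball_def)
  let ?h = "\<lambda>j. support_function (K j)" and ?\<rho> = "\<lambda>j. radial (K j)"
  note bounds = near_ball_bounds(4)[OF K(1)]
  have \<rho>m[measurable]: "?\<rho> j \<in> borel_measurable borel" for j
    by (rule borel_measurable_radial[OF near_ball_bounds(1-3)[OF K(1)]])
  obtain C where C: "C > 0" "\<And>(K :: (real ^ 'n) set) r \<theta> \<theta>'. near_ball K r \<Longrightarrow> moment_fixed p K \<Longrightarrow> norm \<theta> = 1 \<Longrightarrow> norm \<theta>' = 1 \<Longrightarrow>
       \<bar>support_function K \<theta> - support_function K \<theta>'\<bar> \<le> C * r * norm (\<theta> - \<theta>')"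
    using near_ball_regularity[OF p n] by metis
  obtain C1 where C1: "C1 > 0" "\<And>x y. x \<in> {3/4..5/4} \<Longrightarrow> y \<in> {3/4..5/4} \<Longrightarrow> \<bar>x powr q - y powr q\<bar> \<le> C1 * \<bar>x - y\<bar>"
    using powr_Lipschitz[of "3/4" "5/4" q] by auto
  \<comment> \<open>The two functions differ by at most (C r)^2, which is still negligible after
    division by r.\<close>
  have \<rho>lim: "(\<lambda>j. (?\<rho> j u - 1) / r j) \<longlonglongrightarrow> f u" if u: "norm u = 1" for u
  proof (rule Lim_transform[OF lim[OF u]])
    have "(\<lambda>j. C ^ 2 * r j ^ 2) \<longlonglongrightarrow> C ^ 2 * 0 ^ 2" by (intro tendsto_intros r)
    then have "eventually (\<lambda>j. C ^ 2 * r j ^ 2 < 1 / 4) sequentially"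
      by (rule order_tendstoD(2)) simp
    then have "eventually (\<lambda>j. norm ((?\<rho> j u - 1) / r j - (?h j u - 1) / r j) \<le> C ^ 2 * r j) sequentially"
    proof eventually_elim
      fix j assume s: "C ^ 2 * r j ^ 2 < 1 / 4"
      have "?h j u - (C * r j) ^ 2 \<le> ?\<rho> j u"
        using s by (intro radial_ge_if_Lipschitz[OF K(1) u] C(2)[OF K u]) (auto simp: power_mult_distrib)
      moreover have "?\<rho> j u \<le> ?h j u" using bounds[OF u, of j] by simp
      ultimately have "\<bar>?\<rho> j u - ?h j u\<bar> \<le> (C * r j) ^ 2" by simp
      then have "\<bar>?\<rho> j u - ?h j u\<bar> / r j \<le> (C * r j) ^ 2 / r j"
        using rj(1)[of j] by (intro divide_right_mono) auto
      also have "(C * r j) ^ 2 / r j = C ^ 2 * r j"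
        using rj(1)[of j] by (simp add: power2_eq_square)
      finally show "norm ((?\<rho> j u - 1) / r j - (?h j u - 1) / r j) \<le> C ^ 2 * r j"
        using rj(1)[of j] by (simp flip: diff_divide_distrib)
    qed
    moreover have "(\<lambda>j. C ^ 2 * r j) \<longlonglongrightarrow> 0" using tendsto_mult_right_zero[OF r] by simp
    ultimately show "(\<lambda>j. (?\<rho> j u - 1) / r j - (?h j u - 1) / r j) \<longlonglongrightarrow> 0"
      by (rule Lim_null_comparison)
  qed
  define F where "F j u = (?\<rho> j u powr q - 1) / r j" for j u
  let ?T = "\<lambda>j v. (\<integral>\<^sub>Su. cos_kernel p v u * F j u)" and ?I = "\<lambda>j v. (\<integral>\<^sub>Su. cos_kernel p v u * ?\<rho> j u powr q)"
  have Fm[measurable]: "F j \<in> borel_measurable borel" for j unfolding F_def by measurable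
  have Fb: "\<bar>F j u\<bar> \<le> C1" if u: "norm u = 1" for j u
  proof -
    have "\<bar>?\<rho> j u powr q - 1 powr q\<bar> \<le> C1 * \<bar>?\<rho> j u - 1\<bar>"
      using bounds[OF u, of j] rj[of j] by (intro C1(2)) auto
    also have "\<dots> \<le> C1 * r j" using bounds[OF u, of j] C1 by (intro mult_left_mono) auto
    finally show ?thesis using rj(1)[of j] by (simp add: F_def divide_le_eq)
  qed
  have Flim: "(\<lambda>j. F j u) \<longlonglongrightarrow> q * f u" if "norm u = 1" for u
    unfolding F_def by (rule powr_difference_quotient_tendsto[OF rj(1) r \<rho>lim[OF that]])
  have Tlim: "(\<lambda>j. ?T j v) \<longlonglongrightarrow> q * cosine_transform p f v"
    if v: "norm v = 1" for v
  proof -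
    have "(\<lambda>j. ?T j v) \<longlonglongrightarrow> (\<integral>\<^sub>Su. cos_kernel p v u * (q * f u))"
    proof (rule integral_dominated_convergence[where w="\<lambda>_. C1"])
      show "AE u in sphere_law. (\<lambda>j. cos_kernel p v u * F j u) \<longlonglongrightarrow> cos_kernel p v u * (q * f u)"
        using AE_sphere_law by eventually_elim (intro tendsto_intros Flim)
      show "AE u in sphere_law. norm (cos_kernel p v u * F j u) \<le> C1" for j
        using AE_sphere_law
      proof eventually_elim
        fix u :: "real ^ 'n" assume u: "norm u = 1"
        have "cos_kernel p v u * \<bar>F j u\<bar> \<le> 1 * C1"
          using abs_inner_powr_le_1[OF v u, of p] p Fb[OF u, of j] by (intro mult_mono) auto
        then show "norm (cos_kernel p v u * F j u) \<le> C1" by (simp add: abs_mult)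
      qed
    qed (use f in \<open>auto intro!: borel_measurable_times\<close>)
    moreover have "(\<integral>\<^sub>Su. cos_kernel p v u * (q * f u)) = q * cosine_transform p f v"
      unfolding cosine_transform_def by (simp add: mult.left_commute)
    ultimately show ?thesis by simp
  qed
  have "\<forall>j. \<exists>k. k > 0 \<and> (\<forall>v. norm v = 1 \<longrightarrow> ?h j v powr p = k * ?I j v)"
    using moment_fixed_sphere[OF p K] unfolding q_def by blast
  from choice[OF this] obtain \<kappa> where \<kappa>: "\<And>j. \<kappa> j > 0"
    "\<And>j v. norm v = 1 \<Longrightarrow> ?h j v powr p = \<kappa> j * ?I j v"
    by blast
  have split: "?I j v = m + r j * ?T j v"
    if v: "norm v = 1" for j v
  proof -
    have "integrable sphere_law (\<lambda>u. cos_kernel p v u * F j u)"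
      using p v Fb by (intro integrable_cosine_transform[where B=C1]) auto
    moreover have "integrable sphere_law (\<lambda>u. cos_kernel p v u * 1)"
      using p v by (intro integrable_cosine_transform[where B=1]) auto
    moreover have "cos_kernel p v u * ?\<rho> j u powr q = cos_kernel p v u * 1 + r j * (cos_kernel p v u * F j u)" for u
      using rj(1)[of j] by (simp add: F_def field_simps)
    ultimately show ?thesis using m(2)[OF v] by simp
  qed
  have hlim: "(\<lambda>j. (?h j v powr p - 1) / r j) \<longlonglongrightarrow> p * f v" if "norm v = 1" for v
    by (rule powr_difference_quotient_tendsto[OF rj(1) r lim[OF that]])
  obtain e :: "real ^ 'n" where e: "norm e = 1" using vector_choose_size[of 1] by auto
  \<comment> \<open>One direction \<open>e\<close> determines \<kappa>. This limit alone says
    nothing about the rate (\<kappa> m - 1) / r, which \<open>blim\<close> supplies.\<close>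
  have \<kappa>lim: "\<kappa> \<longlonglongrightarrow> 1 / m"
  proof -
    have h1: "(\<lambda>j. ?h j e powr p) \<longlonglongrightarrow> 1"
    proof -
      have "(\<lambda>j. 1 + r j * ((?h j e powr p - 1) / r j)) \<longlonglongrightarrow> 1 + 0 * (p * f e)"
        by (intro tendsto_intros r hlim[OF e])
      moreover have "1 + r j * ((?h j e powr p - 1) / r j) = ?h j e powr p" for j
        using rj(1)[of j] by simp
      ultimately show ?thesis by simp
    qed
    have "(\<lambda>j. m + r j * ?T j e) \<longlonglongrightarrow> m + 0 * (q * cosine_transform p f e)"
      by (intro tendsto_intros r Tlim[OF e])
    then have "(\<lambda>j. ?h j e powr p / (m + r j * ?T j e)) \<longlonglongrightarrow> 1 / m"
      using m(1) by (intro tendsto_divide h1) auto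
    moreover have "?h j e powr p / (m + r j * ?T j e) = \<kappa> j" for j
    proof -
      have "?h j e powr p > 0" using bounds[OF e, of j] rj[of j] by auto
      then show ?thesis using \<kappa>(2)[OF e, of j] unfolding split[OF e] by auto
    qed
    ultimately show ?thesis by simp
  qed
  have blim: "(\<lambda>j. (\<kappa> j * m - 1) / r j) \<longlonglongrightarrow> p * f v - q / m * cosine_transform p f v"
    if v: "norm v = 1" for v
  proof -
    have "(\<lambda>j. (?h j v powr p - 1) / r j - \<kappa> j * ?T j v) \<longlonglongrightarrow> p * f v - 1 / m * (q * cosine_transform p f v)"
      by (intro tendsto_intros hlim \<kappa>lim Tlim v)
    moreover have "(?h j v powr p - 1) / r j - \<kappa> j * ?T j v = (\<kappa> j * m - 1) / r j" for j
      using rj(1)[of j] unfolding \<kappa>(2)[OF v] split[OF v] by (simp add: field_simps)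
    ultimately show ?thesis by simp
  qed
  show ?thesis
  proof (rule that)
    fix v :: "real ^ 'n" assume v: "norm v = 1"
    have "p * f v - q / m * cosine_transform p f v = p * f e - q / m * cosine_transform p f e"
      by (rule LIMSEQ_unique[OF blim[OF v] blim[OF e]])
    then show "p * f v = (p * f e - q / m * cosine_transform p f e) + (CARD('n) + p) / m * cosine_transform p f v"
      by (simp add: q_def)
  qed
qed

section \<open>Improving the position\<close>

lemma support_function_scaleR:
  assumes K: "convex_body K" and c: "c \<ge> 0"
  shows "support_function K (c *\<^sub>R v) = c * support_function K v"
proof -
  obtain y where y: "y \<in> K" "y \<bullet> v = support_function K v"
    using support_function_attained[OF K] by metis
  obtain z where z: "z \<in> K" "z \<bullet> (c *\<^sub>R v) = support_function K (c *\<^sub>R v)"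
    using support_function_attained[OF K] by metis
  have "c * (z \<bullet> v) \<le> c * support_function K v"
    using support_function_upper[OF K z(1)] c by (intro mult_left_mono)
  moreover have "c * (y \<bullet> v) \<le> support_function K (c *\<^sub>R v)"
    using support_function_upper[OF K y(1), of "c *\<^sub>R v"] by simp
  ultimately show ?thesis using y z by simp
qed

text \<open>With f = \<theta>.S\<theta>, the length of \<theta> - r S\<theta> is 1 - r f up to
  O(r^2), while the support function in its direction is 1 + r f up to a small multiple of r; in the
  product the terms of first order cancel. The hypothesis \<open>small\<close> collects all errors
  after division by r.\<close>

lemma support_function_perturbed:
  fixes K :: "(real ^ 'n) set"
  assumes K: "near_ball K r" and S: "\<And>v. norm (S v) \<le> s * norm v" and s: "s \<ge> 0" "r * s \<le> 1 / 4"
    and lip: "\<And>\<theta> \<theta>'. norm \<theta> = 1 \<Longrightarrow> norm \<theta>' = 1 \<Longrightarrow>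
      \<bar>support_function K \<theta> - support_function K \<theta>'\<bar> \<le> C * r * norm (\<theta> - \<theta>')"
    and C: "C \<ge> 0"
    and appr: "\<And>\<theta>. norm \<theta> = 1 \<Longrightarrow> \<bar>support_function K \<theta> - 1 - r * (\<theta> \<bullet> S \<theta>)\<bar> \<le> r * \<eta>"
    and small: "4 * r * s ^ 2 + 2 * C * r * s + r * s + \<eta> \<le> 1 / 2"
    and \<theta>: "norm \<theta> = 1"
  shows "\<bar>support_function K (\<theta> - r *\<^sub>R S \<theta>) - 1\<bar> \<le> r / 2"
proof -
  have body: "convex_body K" and r: "0 < r" "r \<le> 1 / 4" using K by (auto simp: near_ball_def)
  define v where "v = \<theta> - r *\<^sub>R S \<theta>"
  define f where "f = \<theta> \<bullet> S \<theta>"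
  have S\<theta>: "norm (S \<theta>) \<le> s" using S[of \<theta>] \<theta> by simp
  have f: "\<bar>f\<bar> \<le> s" using Cauchy_Schwarz_ineq2[of \<theta> "S \<theta>"] \<theta> S\<theta> by (simp add: f_def)
  have rf: "\<bar>r * f\<bar> \<le> 1 / 4"
    using mult_left_mono[OF f, of r] r s(2) unfolding abs_mult by linarith
  have vt: "norm (v - \<theta>) \<le> r * s" using S\<theta> r by (simp add: v_def)
  then have nv: "\<bar>norm v - 1\<bar> \<le> r * s"
    using norm_triangle_ineq3[of v \<theta>] \<theta> by simp
  then have nv0: "norm v \<ge> 3 / 4" using s(2) by linarith
  then have v0: "v \<noteq> 0" by auto
  define w where "w = v /\<^sub>R norm v"
  have w: "norm w = 1" using v0 by (simp add: w_def)
  have vw: "norm v *\<^sub>R w = v" using v0 by (simp add: w_def)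
  have "norm (w - v) = \<bar>norm v - 1\<bar>"
  proof -
    have "w - v = (1 - norm v) *\<^sub>R w" by (simp add: scaleR_left_diff_distrib vw)
    then show ?thesis using w by simp
  qed
  then have wt: "norm (w - \<theta>) \<le> 2 * (r * s)"
    using norm_triangle_ineq[of "w - v" "v - \<theta>"] vt nv by simp
  define H where "H = support_function K w"
  have H: "\<bar>H - 1\<bar> \<le> r" using near_ball_bounds(4)[OF K w] unfolding H_def by linarith
  have hv: "support_function K v = norm v * H"
    using support_function_scaleR[OF body, of "norm v" w] by (simp add: vw H_def)
  have Hf: "\<bar>H - 1 - r * f\<bar> \<le> r * (2 * C * r * s + \<eta>)"
  proof -
    have "\<bar>H - support_function K \<theta>\<bar> \<le> C * r * (2 * (r * s))"
      unfolding H_def using C r by (intro order.trans[OF lip[OF w \<theta>]] mult_left_mono wt) auto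
    moreover have "\<bar>support_function K \<theta> - 1 - r * f\<bar> \<le> r * \<eta>" using appr[OF \<theta>] by (simp add: f_def)
    ultimately have "\<bar>H - 1 - r * f\<bar> \<le> C * r * (2 * (r * s)) + r * \<eta>" by linarith
    also have "\<dots> = r * (2 * C * r * s + \<eta>)" by (simp add: algebra_simps)
    finally show ?thesis .
  qed
  have nvf: "\<bar>norm v - (1 - r * f)\<bar> \<le> 2 * (r ^ 2 * s ^ 2)"
  proof -
    have sq: "norm v ^ 2 = 1 - 2 * (r * f) + r ^ 2 * norm (S \<theta>) ^ 2"
      using \<theta> unfolding power2_norm_eq_inner v_def f_def
      by (simp add: inner_diff_left inner_diff_right norm_eq_1 inner_commute power2_eq_square algebra_simps)
    \<comment> \<open>The difference of squares is known exactly, and the sum being at least 1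
      allows passing to the difference of the lengths.\<close>
    have d: "norm v + (1 - r * f) \<ge> 1" using nv0 rf by linarith
    have "\<bar>norm v - (1 - r * f)\<bar> * 1 \<le> \<bar>norm v - (1 - r * f)\<bar> * (norm v + (1 - r * f))"
      using d by (intro mult_left_mono) auto
    also have "\<dots> = \<bar>(norm v - (1 - r * f)) * (norm v + (1 - r * f))\<bar>"
      using d by (simp add: abs_mult)
    also have "(norm v - (1 - r * f)) * (norm v + (1 - r * f)) = r ^ 2 * norm (S \<theta>) ^ 2 - r ^ 2 * f ^ 2"
      using sq by (simp add: power2_eq_square algebra_simps)
    also have "\<bar>\<dots>\<bar> \<le> r ^ 2 * norm (S \<theta>) ^ 2 + r ^ 2 * f ^ 2"
      by (rule order.trans[OF abs_triangle_ineq4]) simp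
    also have "\<dots> \<le> r ^ 2 * s ^ 2 + r ^ 2 * s ^ 2"
    proof (intro add_mono mult_left_mono)
      show "norm (S \<theta>) ^ 2 \<le> s ^ 2" using S\<theta> by (intro power_mono) auto
      show "f ^ 2 \<le> s ^ 2" using f s(1) by (simp add: abs_le_square_iff[symmetric])
    qed auto
    finally show ?thesis by simp
  qed
  \<comment> \<open>The error in the length, the error in the support function, and the product of
    the two first-order terms are separated.\<close>
  have "\<bar>norm v * H - 1\<bar> = \<bar>(norm v - (1 - r * f)) * H + (H - 1 - r * f) - r * f * (H - 1)\<bar>"
    by (simp add: algebra_simps)
  also have "\<dots> \<le> \<bar>norm v - (1 - r * f)\<bar> * \<bar>H\<bar> + \<bar>H - 1 - r * f\<bar> + \<bar>r * f\<bar> * \<bar>H - 1\<bar>"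
    unfolding abs_mult[symmetric] by linarith
  also have "\<dots> \<le> 2 * (r ^ 2 * s ^ 2) * 2 + r * (2 * C * r * s + \<eta>) + (r * s) * r"
  proof (intro add_mono mult_mono nvf Hf H)
    show "\<bar>H\<bar> \<le> 2" using H r by linarith
    show "\<bar>r * f\<bar> \<le> r * s" using f r by (simp add: abs_mult)
  qed (use r s in auto)
  also have "\<dots> = r * (4 * r * s ^ 2 + 2 * C * r * s + r * s + \<eta>)"
    by (simp add: power2_eq_square algebra_simps)
  also have "\<dots> \<le> r * (1 / 2)" using small r by (intro mult_left_mono) auto
  finally show ?thesis using hv by (simp add: v_def)
qed

text \<open>The support function of a linear image is the old one composed with the adjoint map.
  Moving the arguments by \<open>R\<close> therefore means moving the body by the adjoint of
  \<open>R\<close>.\<close>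

lemma near_ball_improve:
  fixes K :: "(real ^ 'n) set"
  assumes K: "near_ball K r" and S: "linear S"
    and h: "\<And>\<theta>. norm \<theta> = 1 \<Longrightarrow> \<bar>support_function K (\<theta> - r *\<^sub>R S \<theta>) - 1\<bar> \<le> r / 2"
  shows "\<exists>T :: real ^ 'n \<Rightarrow> real ^ 'n. linear T \<and> cball 0 (1 - r / 2) \<subseteq> T ` K \<and> T ` K \<subseteq> cball 0 (1 + r / 2)"
proof -
  have body: "convex_body K" and r: "0 < r" "r \<le> 1 / 4" using K by (auto simp: near_ball_def)
  define R where "R v = v - r *\<^sub>R S v" for v
  have R: "linear R"
    unfolding R_def using S by (intro linear_compose_sub linear_ident linear_compose_scale_right)
  define T where "T = adjoint R"
  have T: "linear T" unfolding T_def by (rule adjoint_linear[OF R])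
  have TR: "T x \<bullet> v = x \<bullet> R v" for x v
    using adjoint_works[OF R, of v x] by (simp add: T_def inner_commute)
  have hR: "\<bar>support_function K (R \<theta>) - 1\<bar> \<le> r / 2" if "norm \<theta> = 1" for \<theta>
    using h[OF that] by (simp add: R_def)
  have "T x \<in> cball 0 (1 + r / 2)" if x: "x \<in> K" for x
  proof (cases "T x = 0")
    case False
    define \<theta> where "\<theta> = T x /\<^sub>R norm (T x)"
    have \<theta>: "norm \<theta> = 1" using False by (simp add: \<theta>_def)
    have "norm (T x) = T x \<bullet> \<theta>" using False by (simp add: \<theta>_def dot_square_norm power2_eq_square)
    also have "\<dots> = x \<bullet> R \<theta>" by (rule TR)
    also have "\<dots> \<le> support_function K (R \<theta>)" by (rule support_function_upper[OF body x])
    finally show ?thesis using hR[OF \<theta>] unfolding mem_cball_0 by linarith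
  qed (use r in simp)
  moreover have "x \<in> T ` K" if x: "x \<in> cball 0 (1 - r / 2)" for x
  proof (rule mem_convex_if_le_support)
    show "closed (T ` K)" "convex (T ` K)" "T ` K \<noteq> {}"
      using near_ball_bounds(1-3)[OF K] T
      by (auto intro!: compact_imp_closed compact_continuous_image linear_continuous_on convex_linear_image linear_conv_bounded_linear[THEN iffD1])
    fix \<theta> :: "real ^ 'n" assume \<theta>: "norm \<theta> = 1"
    obtain y where y: "y \<in> K" "y \<bullet> R \<theta> = support_function K (R \<theta>)"
      using support_function_attained[OF body] by metis
    have "x \<bullet> \<theta> \<le> norm x * norm \<theta>" by (rule norm_cauchy_schwarz)
    also have "\<dots> \<le> 1 - r / 2" using x \<theta> by simp
    also have "\<dots> \<le> T y \<bullet> \<theta>" using hR[OF \<theta>] y(2) unfolding TR by linarith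
    finally show "\<exists>y\<in>T ` K. x \<bullet> \<theta> \<le> y \<bullet> \<theta>" using y(1) by auto
  qed
  ultimately show ?thesis using T by (intro exI[of _ T]) auto
qed

text \<open>By contradiction, hence without an explicit \<epsilon>: counterexamples with r below
  \<open>1 / Suc j\<close> have deviations (h - 1) / r that are bounded by 1 and, by
  \<open>near_ball_regularity\<close>, Lipschitz with one constant.\<close>

lemma near_ball_improvable:
  fixes p :: real
  assumes p: "p > 1" and n: "CARD('n::finite) \<ge> 2"
  obtains \<epsilon> where "\<epsilon> > 0" "\<And>(K :: (real ^ 'n) set) r. near_ball K r \<Longrightarrow> moment_fixed p K \<Longrightarrow> r < \<epsilon> \<Longrightarrow>
    \<exists>T :: real ^ 'n \<Rightarrow> real ^ 'n. linear T \<and> cball 0 (1 - r / 2) \<subseteq> T ` K \<and> T ` K \<subseteq> cball 0 (1 + r / 2)"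
proof (rule ccontr)
  assume contra: "\<not> thesis"
  have "\<exists>K r. near_ball K r \<and> moment_fixed p K \<and> r < 1 / Suc j \<and>
     \<not> (\<exists>T :: real ^ 'n \<Rightarrow> real ^ 'n. linear T \<and> cball 0 (1 - r / 2) \<subseteq> T ` K \<and> T ` K \<subseteq> cball (0 :: real ^ 'n) (1 + r / 2))" for j
  proof (rule ccontr)
    assume neg: "\<not> ?thesis"
    have thesis
    proof (rule that[of "1 / Suc j"])
      fix K :: "(real ^ 'n) set" and r
      assume "near_ball K r" "moment_fixed p K" "r < 1 / Suc j"
      then show "\<exists>T :: real ^ 'n \<Rightarrow> real ^ 'n. linear T \<and> cball 0 (1 - r / 2) \<subseteq> T ` K \<and> T ` K \<subseteq> cball 0 (1 + r / 2)"
        using neg by blast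
    qed simp
    then show False using contra by contradiction
  qed
  then obtain K :: "nat \<Rightarrow> (real ^ 'n) set" and r where K: "\<And>j. near_ball (K j) (r j)" "\<And>j. moment_fixed p (K j)"
    and r1: "\<And>j. r j < 1 / Suc j"
    and bad: "\<And>j. \<not> (\<exists>T :: real ^ 'n \<Rightarrow> real ^ 'n. linear T \<and> cball 0 (1 - r j / 2) \<subseteq> T ` K j \<and> T ` K j \<subseteq> cball 0 (1 + r j / 2))"
    by metis
  have rj: "0 < r j" "r j \<le> 1 / 4" for j using K(1)[of j] by (auto simp: near_ball_def)
  have r: "r \<longlonglongrightarrow> 0"
    by (rule tendsto_sandwich[OF _ _ tendsto_const LIMSEQ_inverse_real_of_nat])
       (use rj r1 in \<open>auto simp: inverse_eq_divide less_imp_le intro!: always_eventually\<close>)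
  obtain C where C: "C > 0" "\<And>(K :: (real ^ 'n) set) r \<theta> \<theta>'. near_ball K r \<Longrightarrow> moment_fixed p K \<Longrightarrow> norm \<theta> = 1 \<Longrightarrow> norm \<theta>' = 1 \<Longrightarrow>
       \<bar>support_function K \<theta> - support_function K \<theta>'\<bar> \<le> C * r * norm (\<theta> - \<theta>')"
    using near_ball_regularity[OF p n] by metis
  define F where "F j \<theta> = (support_function (K j) \<theta> - 1) / r j" for j \<theta>
  have Fb: "\<bar>F j \<theta>\<bar> \<le> 1" if "norm \<theta> = 1" for j \<theta>
    using near_ball_bounds(4)[OF K(1) that, of j] rj(1)[of j] by (auto simp: F_def abs_le_iff field_simps)
  have Fl: "\<bar>F j \<theta> - F j \<theta>'\<bar> \<le> C * norm (\<theta> - \<theta>')" if "norm \<theta> = 1" "norm \<theta>' = 1" for j \<theta> \<theta>'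
  proof -
    have "F j \<theta> - F j \<theta>' = (support_function (K j) \<theta> - support_function (K j) \<theta>') / r j"
      by (simp add: F_def diff_divide_distrib)
    then have "\<bar>F j \<theta> - F j \<theta>'\<bar> = \<bar>support_function (K j) \<theta> - support_function (K j) \<theta>'\<bar> / r j"
      using rj(1)[of j] by simp
    also have "\<dots> \<le> (C * r j * norm (\<theta> - \<theta>')) / r j"
      using rj(1)[of j] by (intro divide_right_mono C(2)[OF K that]) auto
    also have "\<dots> = C * norm (\<theta> - \<theta>')" using rj(1)[of j] by simp
    finally show ?thesis .
  qed
  \<comment> \<open>Pointwise limits would do for the linear equation; uniform convergence allows a
    single index to serve all directions at the end.\<close>
  obtain g k where g: "continuous_on (sphere (0 :: real ^ 'n) 1) g" and k: "strict_mono (k :: nat \<Rightarrow> nat)"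
    and conv: "\<And>e. 0 < e \<Longrightarrow> \<exists>N. \<forall>n x. n \<ge> N \<and> x \<in> sphere 0 1 \<longrightarrow> norm (F (k n) x - g x) < e"
  proof (rule Arzela_Ascoli[of "sphere (0 :: real ^ 'n) 1" F 1])
    fix x :: "real ^ 'n" and e :: real assume xe: "x \<in> sphere 0 1" "0 < e"
    show "\<exists>d>0. \<forall>n y. y \<in> sphere 0 1 \<and> norm (x - y) < d \<longrightarrow> norm (F n x - F n y) < e"
    proof (intro exI[of _ "e / C"] conjI allI impI)
      fix n y assume y: "y \<in> sphere 0 1 \<and> norm (x - y) < e / C"
      have "norm (F n x - F n y) \<le> C * norm (x - y)" using Fl[of x y n] xe y by auto
      also have "\<dots> < e" using y C(1) by (simp add: field_simps)
      finally show "norm (F n x - F n y) < e" .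
    qed (use xe C in simp)
  qed (use Fb in auto)
  \<comment> \<open>The limit is known on the sphere only; extension by 0 makes it a Borel function
    on the whole space.\<close>
  define f where "f \<theta> = (if \<theta> \<in> sphere 0 1 then g \<theta> else 0)" for \<theta>
  have fm: "f \<in> borel_measurable borel"
    unfolding f_def by (rule borel_measurable_continuous_on_if) (use g in auto)
  have lim: "(\<lambda>j. F (k j) v) \<longlonglongrightarrow> f v" if v: "norm v = 1" for v
  proof (rule LIMSEQ_I)
    fix e :: real assume "e > 0"
    from conv[OF this] obtain N where "\<And>n x. n \<ge> N \<Longrightarrow> x \<in> sphere 0 1 \<Longrightarrow> norm (F (k n) x - g x) < e" by blast
    then show "\<exists>N. \<forall>n\<ge>N. norm (F (k n) v - f v) < e"
      using v by (intro exI[of _ N]) (auto simp: f_def)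
  qed
  have fb: "\<bar>f v\<bar> \<le> 1" if v: "norm v = 1" for v
    by (rule tendsto_upperbound[OF tendsto_rabs[OF lim[OF v]]]) (use Fb[OF v] in auto)
  have dim: "DIM(real ^ 'n) \<ge> 2" "p > 0" using n p by simp_all
  obtain m where m: "m > 0" "\<And>v :: real ^ 'n. norm v = 1 \<Longrightarrow> (\<integral>\<^sub>Su. cos_kernel p v u) = m"
    "\<And>(f :: real ^ 'n \<Rightarrow> real) B \<beta>. f \<in> borel_measurable borel \<Longrightarrow> (\<And>u. norm u = 1 \<Longrightarrow> \<bar>f u\<bar> \<le> B) \<Longrightarrow>
       (\<And>v. norm v = 1 \<Longrightarrow> p * f v = \<beta> + (DIM(real ^ 'n) + p) / m * cosine_transform p f v) \<Longrightarrow>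
       \<exists>S. linear S \<and> (\<forall>v. norm v = 1 \<longrightarrow> f v = v \<bullet> S v)"
    using cosine_transform_structure[OF dim] by blast
  have rk: "(\<lambda>j. r (k j)) \<longlonglongrightarrow> 0"
    using LIMSEQ_subseq_LIMSEQ[OF r k] by (simp add: o_def)
  obtain \<beta> where \<beta>: "\<And>v. norm v = 1 \<Longrightarrow> p * f v = \<beta> + (CARD('n) + p) / m * cosine_transform p f v"
    using linearized_equation[OF p n K(1) K(2) rk fm lim[unfolded F_def] m(1,2)] by blast
  obtain S where S: "linear S" "\<And>v. norm v = 1 \<Longrightarrow> f v = v \<bullet> S v"
    using m(3)[OF fm fb, of \<beta>] \<beta> by auto
  obtain s where s: "s > 0" "\<And>v. norm (S v) \<le> s * norm v"
    using linear_bounded_pos[OF S(1)] by metis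
  \<comment> \<open>Of the error 1/2 allowed in \<open>support_function_perturbed\<close>, 1/4 is
    given to the terms that vanish with r and 1/4, as \<eta>, to the distance between
    \<open>F (k j)\<close> and \<open>f\<close>.\<close>
  have "(\<lambda>j. 4 * r (k j) * s ^ 2 + 2 * C * r (k j) * s + r (k j) * s) \<longlonglongrightarrow> 4 * 0 * s ^ 2 + 2 * C * 0 * s + 0 * s"
    by (intro tendsto_intros rk)
  then have "eventually (\<lambda>j. 4 * r (k j) * s ^ 2 + 2 * C * r (k j) * s + r (k j) * s < 1 / 4) sequentially"
    by (rule order_tendstoD(2)) simp
  moreover obtain N where N: "\<And>n x. n \<ge> N \<Longrightarrow> norm x = 1 \<Longrightarrow> \<bar>F (k n) x - f x\<bar> < 1 / 4"
    using conv[of "1 / 4"] unfolding f_def by auto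
  ultimately obtain j where j: "j \<ge> N" "4 * r (k j) * s ^ 2 + 2 * C * r (k j) * s + r (k j) * s < 1 / 4"
    unfolding eventually_sequentially by (metis le_cases)
  let ?K = "K (k j)" and ?r = "r (k j)"
  have nn: "0 \<le> 4 * ?r * s ^ 2" "0 \<le> 2 * C * ?r * s" using rj(1)[of "k j"] s C by auto
  have "\<bar>support_function ?K (\<theta> - ?r *\<^sub>R S \<theta>) - 1\<bar> \<le> ?r / 2" if \<theta>: "norm \<theta> = 1" for \<theta>
  proof (rule support_function_perturbed[OF K(1) s(2) _ _ C(2)[OF K] _ _ _ \<theta>, where \<eta>="1/4"])
    show "\<bar>support_function ?K \<theta> - 1 - ?r * (\<theta> \<bullet> S \<theta>)\<bar> \<le> ?r * (1 / 4)" if "norm \<theta> = 1" for \<theta>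
    proof -
      have "?r * F (k j) \<theta> = support_function ?K \<theta> - 1"
        using rj(1)[of "k j"] by (simp add: F_def)
      then have "support_function ?K \<theta> - 1 - ?r * (\<theta> \<bullet> S \<theta>) = ?r * (F (k j) \<theta> - f \<theta>)"
        using S(2)[OF that] by (simp only: right_diff_distrib)
      then show ?thesis
        using N[OF j(1) that] rj(1)[of "k j"] by (simp add: abs_mult)
    qed
    show "?r * s \<le> 1 / 4" using j(2) nn by linarith
    show "4 * ?r * s ^ 2 + 2 * C * ?r * s + ?r * s + 1 / 4 \<le> 1 / 2" using j(2) by linarith
  qed (use s C in auto)
  from near_ball_improve[OF K(1) S(1) this] bad show False by blast
qed

section \<open>Minimal positions and the theorem\<close>

lemma set_integral_linear_image:
  fixes A :: "'a::euclidean_space \<Rightarrow> 'a"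
  assumes A: "linear A" "bij A" and K: "compact K"
  obtains c where "c > 0" "\<And>f. f \<in> borel_measurable borel \<Longrightarrow> (\<And>x. f x \<ge> (0::real)) \<Longrightarrow>
     (LINT x:K|lborel. f (A x)) = c * (LINT y:A ` K|lborel. f y)"
proof -
  obtain c :: real where c: "c > 0" "\<And>F :: 'a \<Rightarrow> ennreal. F \<in> borel_measurable borel \<Longrightarrow>
        (\<integral>\<^sup>+x. F (A x) \<partial>lborel) = ennreal c * (\<integral>\<^sup>+x. F x \<partial>lborel)"
    by (rule nn_integral_lborel_linear_const[OF A]) (rule that)
  have cA: "continuous_on S A" for S
    by (rule continuous_on_linear[OF A(1)])
  have [measurable]: "A \<in> borel_measurable borel" by (rule borel_measurable_continuous_onI[OF cA])
  have [measurable]: "K \<in> sets borel" using K by (simp add: borel_closed compact_imp_closed)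
  have "compact (A ` K)" by (rule compact_continuous_image[OF cA K])
  then have [measurable]: "A ` K \<in> sets borel" by (simp add: borel_closed compact_imp_closed)
  have ind: "indicator (A ` K) (A x) = (indicator K x :: real)" for x
    using A(2) by (auto simp: indicator_def bij_def inj_image_mem_iff)
  show ?thesis
  proof (rule that[OF c(1)])
    fix f :: "'a \<Rightarrow> real" assume [measurable]: "f \<in> borel_measurable borel" and f0: "\<And>x. f x \<ge> 0"
    have "(LINT x:K|lborel. f (A x)) = enn2real (\<integral>\<^sup>+x. ennreal (indicator (A ` K) (A x) *\<^sub>R f (A x)) \<partial>lborel)"
      unfolding set_lebesgue_integral_def ind by (rule integral_eq_nn_integral) (auto simp: f0)
    also have "\<dots> = enn2real (ennreal c * (\<integral>\<^sup>+y. ennreal (indicator (A ` K) y *\<^sub>R f y) \<partial>lborel))"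
      by (subst c(2)) auto
    also have "\<dots> = c * enn2real (\<integral>\<^sup>+y. ennreal (indicator (A ` K) y *\<^sub>R f y) \<partial>lborel)"
      using c(1) by (simp add: enn2real_mult)
    also have "enn2real (\<integral>\<^sup>+y. ennreal (indicator (A ` K) y *\<^sub>R f y) \<partial>lborel) = (LINT y:A ` K|lborel. f y)"
      unfolding set_lebesgue_integral_def by (rule integral_eq_nn_integral[symmetric]) (auto simp: f0)
    finally show "(LINT x:K|lborel. f (A x)) = c * (LINT y:A ` K|lborel. f y)" .
  qed
qed

lemma support_function_scaleR_image:
  fixes L :: "(real ^ 'n) set"
  assumes L: "convex_body L"
  shows "support_function ((\<lambda>x. c *\<^sub>R x) ` L) v = support_function L (c *\<^sub>R v)"
  by (simp add: support_function_def image_image)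

text \<open>The absolute value admits scalars of either sign, since the moment function is even.
  Homogeneity extends the identity from the sphere to all vectors, as required at
  \<open>adjoint A \<theta>\<close>, which is not a unit vector in general.\<close>

lemma support_function_centroid_fixed:
  fixes K :: "(real ^ 'n) set"
  assumes p: "p \<ge> 1" and K: "convex_body K" and c: "(\<lambda>x. c *\<^sub>R x) ` p_centroid_body p K = K"
  shows "support_function K v = \<bar>c\<bar> * moment_function p K v"
proof -
  let ?L = "p_centroid_body p K"
  have L: "convex_body ?L" by (rule p_centroid_body(1)[OF p K])
  have M: "support_function ?L v = moment_function p K v" for v
  proof (cases "v = 0")
    case True
    then show ?thesis
      using support_function_scaleR[OF L, of 0 0] moment_function_sublinear(1)[OF p K, of 0 0] by simp
  next
    case False
    have "support_function ?L v = norm v * support_function ?L (v /\<^sub>R norm v)"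
      using support_function_scaleR[OF L, of "norm v" "v /\<^sub>R norm v"] False by simp
    also have "support_function ?L (v /\<^sub>R norm v) = moment_function p K (v /\<^sub>R norm v)"
      using False by (intro p_centroid_body(2)[OF p K]) simp
    also have "norm v * \<dots> = moment_function p K v"
      using moment_function_sublinear(1)[OF p K, of "norm v" "v /\<^sub>R norm v"] False by simp
    finally show ?thesis .
  qed
  have even: "moment_function p K (- w) = moment_function p K w" for w
    by (simp add: moment_function_def)
  have "support_function K v = moment_function p K (c *\<^sub>R v)"
    using support_function_scaleR_image[OF L, of c v] by (simp add: c M)
  also have "\<dots> = moment_function p K (\<bar>c\<bar> *\<^sub>R v)"
    using even[of "c *\<^sub>R v"] by (cases "c \<ge> 0") auto
  also have "\<dots> = \<bar>c\<bar> * moment_function p K v"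
    by (rule moment_function_sublinear(1)[OF p K]) simp
  finally show ?thesis .
qed

text \<open>Support function and kernel of the image both become those of \<open>K\<close> at
  \<open>adjoint A \<theta>\<close>; the substitution in the integral costs only a constant.\<close>

lemma moment_fixed_linear_image:
  fixes K :: "(real ^ 'n) set" and A :: "real ^ 'n \<Rightarrow> real ^ 'n"
  assumes p: "p \<ge> 1" and K: "convex_body K" and c: "(\<lambda>x. c *\<^sub>R x) ` p_centroid_body p K = K"
    and A: "linear A" "bij A"
  shows "moment_fixed p (A ` K)"
proof -
  have cK: "compact K" using K by (simp add: convex_body_def)
  obtain d where d: "\<And>f. f \<in> borel_measurable borel \<Longrightarrow> (\<And>x. f x \<ge> (0::real)) \<Longrightarrow>
     (LINT x:K|lborel. f (A x)) = d * (LINT y:A ` K|lborel. f y)"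
    using set_integral_linear_image[OF A cK] by metis
  define V where "V = measure lborel K"
  have "support_function (A ` K) \<theta> powr p = (\<bar>c\<bar> powr p * (1 / V) * d) * (LINT x:A ` K|lborel. cos_kernel p \<theta> x)" for \<theta>
  proof -
    have At: "\<theta> \<bullet> A x = adjoint A \<theta> \<bullet> x" for x
      using adjoint_works[OF A(1), of x \<theta>] by (simp add: inner_commute)
    have I0: "(LINT x:K|lborel. \<bar>adjoint A \<theta> \<bullet> x\<bar> powr p) \<ge> 0"
      unfolding set_lebesgue_integral_def by (rule integral_nonneg_AE) auto
    have "support_function (A ` K) \<theta> = support_function K (adjoint A \<theta>)"
      using At by (simp add: support_function_def image_image inner_commute[of _ \<theta>] inner_commute[of _ "adjoint A \<theta>"])
    also have "\<dots> = \<bar>c\<bar> * moment_function p K (adjoint A \<theta>)"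
      by (rule support_function_centroid_fixed[OF p K c])
    finally have "support_function (A ` K) \<theta> powr p = \<bar>c\<bar> powr p * (1 / V * (LINT x:K|lborel. \<bar>adjoint A \<theta> \<bullet> x\<bar> powr p))"
      using p I0 by (simp add: moment_function_def powr_mult powr_powr V_def)
    also have "(LINT x:K|lborel. \<bar>adjoint A \<theta> \<bullet> x\<bar> powr p) = d * (LINT x:A ` K|lborel. cos_kernel p \<theta> x)"
      using d[of "\<lambda>x. cos_kernel p \<theta> x"] by (simp add: At)
    finally show ?thesis by simp
  qed
  then show ?thesis unfolding moment_fixed_def by blast
qed

lemma convex_body_linear_image:
  fixes A :: "real ^ 'n \<Rightarrow> real ^ 'n"
  assumes K: "convex_body K" and A: "linear A" and ball: "cball 0 e \<subseteq> A ` K" "e > 0"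
  shows "convex_body (A ` K)"
proof -
  have "compact (A ` K)" "convex (A ` K)"
    using K A by (auto simp: convex_body_def intro!: compact_continuous_image linear_continuous_on
      convex_linear_image linear_conv_bounded_linear[THEN iffD1])
  moreover have "ball 0 e \<subseteq> interior (A ` K)"
    using ball(1) by (intro interior_maximal) auto
  then have "interior (A ` K) \<noteq> {}" using ball(2) by fastforce
  ultimately show ?thesis by (simp add: convex_body_def)
qed

lemma bij_if_ball_subset_image:
  fixes A :: "'a::euclidean_space \<Rightarrow> 'a"
  assumes A: "linear A" and ball: "cball 0 e \<subseteq> A ` K" "e > 0"
  shows "bij A"
proof -
  have "y \<in> range A" for y
  proof (cases "y = 0")
    case True
    then show ?thesis using linear_0[OF A] by (metis rangeI)
  next
    case False
    have "(e / norm y) *\<^sub>R y \<in> A ` K" using False ball by (intro subsetD[OF ball(1)]) simp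
    then obtain x where "A x = (e / norm y) *\<^sub>R y" by auto
    then have "A ((norm y / e) *\<^sub>R x) = y" using False ball(2) by (simp add: linear_scale[OF A])
    then show ?thesis by (metis rangeI)
  qed
  then have "surj A" by auto
  then show ?thesis using linear_surjective_imp_injective[OF A] by (simp add: bij_def)
qed

text \<open>In this form the inclusion is a family of closed conditions on the map, as the
  compactness argument of \<open>minimal_position\<close> needs.\<close>

lemma ball_subset_linear_image_iff:
  fixes K :: "(real ^ 'n) set" and A :: "real ^ 'n \<Rightarrow> real ^ 'n"
  assumes K: "convex_body K" and A: "linear A" and e: "e \<ge> 0"
  shows "cball 0 e \<subseteq> A ` K \<longleftrightarrow> (\<forall>\<theta>\<in>sphere 0 1. e \<le> support_function K (adjoint A \<theta>))"
proof -
  have At: "A x \<bullet> \<theta> = x \<bullet> adjoint A \<theta>" for x \<theta>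
    using adjoint_works[OF A, of x \<theta>] by (simp add: inner_commute)
  show ?thesis
  proof
    assume sub: "cball 0 e \<subseteq> A ` K"
    show "\<forall>\<theta>\<in>sphere 0 1. e \<le> support_function K (adjoint A \<theta>)"
    proof
      fix \<theta> :: "real ^ 'n" assume \<theta>: "\<theta> \<in> sphere 0 1"
      then have "e *\<^sub>R \<theta> \<in> A ` K" using e by (intro subsetD[OF sub]) simp
      then obtain x where x: "x \<in> K" "e *\<^sub>R \<theta> = A x" by auto
      have "e = A x \<bullet> \<theta>" using \<theta> by (simp add: x(2)[symmetric] norm_eq_1)
      also have "\<dots> \<le> support_function K (adjoint A \<theta>)"
        unfolding At by (rule support_function_upper[OF K x(1)])
      finally show "e \<le> support_function K (adjoint A \<theta>)" .
    qed
  next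
    assume le: "\<forall>\<theta>\<in>sphere 0 1. e \<le> support_function K (adjoint A \<theta>)"
    show "cball 0 e \<subseteq> A ` K"
    proof
      fix x :: "real ^ 'n" assume x: "x \<in> cball 0 e"
      show "x \<in> A ` K"
      proof (rule mem_convex_if_le_support)
        show "closed (A ` K)" "convex (A ` K)" "A ` K \<noteq> {}"
          using K A by (auto simp: convex_body_def intro!: compact_imp_closed compact_continuous_image
            linear_continuous_on convex_linear_image linear_conv_bounded_linear[THEN iffD1])
        fix \<theta> :: "real ^ 'n" assume \<theta>: "norm \<theta> = 1"
        obtain y where y: "y \<in> K" "y \<bullet> adjoint A \<theta> = support_function K (adjoint A \<theta>)"
          using support_function_attained[OF K] by metis
        have "x \<bullet> \<theta> \<le> norm x * norm \<theta>" by (rule norm_cauchy_schwarz)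
        also have "\<dots> \<le> e" using x \<theta> by simp
        also have "\<dots> \<le> A y \<bullet> \<theta>" unfolding At y(2) using le \<theta> by simp
        finally show "\<exists>y\<in>A ` K. x \<bullet> \<theta> \<le> y \<bullet> \<theta>" using y(1) by auto
      qed
    qed
  qed
qed

lemma continuous_on_support_function:
  fixes K :: "(real ^ 'n) set"
  assumes K: "convex_body K"
  shows "continuous_on S (support_function K)"
proof -
  have "convex_on UNIV (support_function K)"
  proof (rule convex_onI)
    fix t :: real and x y :: "real ^ 'n" assume t: "0 < t" "t < 1"
    obtain z where z: "z \<in> K" "z \<bullet> ((1 - t) *\<^sub>R x + t *\<^sub>R y) = support_function K ((1 - t) *\<^sub>R x + t *\<^sub>R y)"
      using support_function_attained[OF K] by metis
    have "(1 - t) * (z \<bullet> x) + t * (z \<bullet> y) \<le> (1 - t) * support_function K x + t * support_function K y"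
      using t by (intro add_mono mult_left_mono support_function_upper[OF K z(1)]) auto
    then show "support_function K ((1 - t) *\<^sub>R x + t *\<^sub>R y) \<le> (1 - t) * support_function K x + t * support_function K y"
      by (simp flip: z(2) add: inner_add_right)
  qed simp
  then show ?thesis
    using convex_on_continuous[OF open_UNIV] continuous_on_subset by blast
qed

text \<open>A minimizer of r over a compact set of pairs of a radius and a matrix. Invertibility,
  which is not a closed condition, is not imposed; it follows from the inclusion of a ball of radius
  at least 3/4. Competitors above \<open>r0\<close> need no comparison.\<close>

lemma minimal_position:
  fixes K :: "(real ^ 'n::finite) set"
  assumes K: "convex_body K" and r0: "0 \<le> r0" "r0 \<le> 1 / 4"
    and T0: "linear T0" "cball 0 (1 - r0) \<subseteq> T0 ` K" "T0 ` K \<subseteq> cball (0 :: real ^ 'n) (1 + r0)"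
  obtains r T where "0 \<le> r" "r \<le> r0" "linear T" "cball 0 (1 - r) \<subseteq> T ` K" "T ` K \<subseteq> cball (0 :: real ^ 'n) (1 + r)"
    "\<And>r' T'. 0 \<le> r' \<Longrightarrow> linear T' \<Longrightarrow> cball 0 (1 - r') \<subseteq> T' ` K \<Longrightarrow> T' ` K \<subseteq> cball (0 :: real ^ 'n) (1 + r') \<Longrightarrow> r \<le> r'"
proof -
  define Z where "Z = {z :: real \<times> (real ^ 'n ^ 'n). 0 \<le> fst z \<and> fst z \<le> r0 \<and>
     (\<forall>x\<in>K. norm (snd z *v x) \<le> 1 + fst z) \<and>
     (\<forall>\<theta>\<in>sphere 0 1. 1 - fst z \<le> support_function K (transpose (snd z) *v \<theta>))}"
  have Z_iff: "(r, A) \<in> Z \<longleftrightarrow> 0 \<le> r \<and> r \<le> r0 \<and> cball 0 (1 - r) \<subseteq> (*v) A ` K \<and> (*v) A ` K \<subseteq> cball 0 (1 + r)" for r A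
  proof -
    have "cball 0 (1 - r) \<subseteq> (*v) A ` K \<longleftrightarrow> (\<forall>\<theta>\<in>sphere 0 1. 1 - r \<le> support_function K (transpose A *v \<theta>))" if "r \<le> r0"
      using ball_subset_linear_image_iff[OF K matrix_vector_mul_linear[of A], of "1 - r"] r0 that
      by (simp only: adjoint_matrix)
    moreover have "(*v) A ` K \<subseteq> cball 0 (1 + r) \<longleftrightarrow> (\<forall>x\<in>K. norm (A *v x) \<le> 1 + r)" by auto
    ultimately show ?thesis unfolding Z_def mem_Collect_eq fst_conv snd_conv by blast
  qed
  have lin_in_Z: "(r, matrix T) \<in> Z \<longleftrightarrow> 0 \<le> r \<and> r \<le> r0 \<and> cball 0 (1 - r) \<subseteq> T ` K \<and> T ` K \<subseteq> cball 0 (1 + r)"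
    if "linear T" for r T
  proof -
    have "(*v) (matrix T) = T" by (rule matrix_vector_mul(2)[OF that])
    then show ?thesis by (simp add: Z_iff)
  qed
  have contv: "continuous_on UNIV (\<lambda>z :: real \<times> (real ^ 'n ^ 'n). snd z *v x)" for x
    unfolding matrix_vector_mult_def by (intro continuous_intros)
  have contt: "continuous_on UNIV (\<lambda>z :: real \<times> (real ^ 'n ^ 'n). transpose (snd z) *v x)" for x
    unfolding transpose_def matrix_vector_mult_def by (simp, intro continuous_intros)
  have Zeq: "Z = {z. 0 \<le> fst z} \<inter> {z. fst z \<le> r0} \<inter> (\<Inter>x\<in>K. {z. norm (snd z *v x) \<le> 1 + fst z}) \<inter>
     (\<Inter>\<theta>\<in>sphere 0 1. {z. 1 - fst z \<le> support_function K (transpose (snd z) *v \<theta>)})"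
    by (auto simp: Z_def)
  have c1: "closed {z :: real \<times> (real ^ 'n ^ 'n). 1 - fst z \<le> support_function K (transpose (snd z) *v \<theta>)}" for \<theta>
  proof (rule closed_Collect_le)
    show "continuous_on UNIV (\<lambda>z :: real \<times> (real ^ 'n ^ 'n). 1 - fst z)" by (intro continuous_intros)
    show "continuous_on UNIV (\<lambda>z :: real \<times> (real ^ 'n ^ 'n). support_function K (transpose (snd z) *v \<theta>))"
      by (rule continuous_on_compose2[OF continuous_on_support_function[OF K, of UNIV] contt]) (rule subset_UNIV)
  qed
  have c2: "closed {z :: real \<times> (real ^ 'n ^ 'n). norm (snd z *v x) \<le> 1 + fst z}" for x
    by (intro closed_Collect_le continuous_intros contv)
  have "closed {z :: real \<times> (real ^ 'n ^ 'n). 0 \<le> fst z}" "closed {z :: real \<times> (real ^ 'n ^ 'n). fst z \<le> r0}"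
    by (intro closed_Collect_le continuous_intros)+
  then have "closed Z"
    unfolding Zeq by (intro closed_Int closed_INT ballI c1 c2)
  moreover have "bounded Z"
  proof -
    have bij: "bij T0" using r0 by (intro bij_if_ball_subset_image[OF T0(1,2)]) simp
    obtain M where M: "M > 0" "\<And>x. norm (T0 x) \<le> M * norm x"
      using linear_bounded_pos[OF T0(1)] by metis
    \<comment> \<open>\<open>T0\<close> maps the ball of radius \<delta> into the ball of radius 1 -
      r0, which lies in the image of \<open>K\<close>; injectivity puts the small ball into
      \<open>K\<close>. Every admissible matrix is then bounded on that ball by 1 + r \<le> 2, hence
      its entries by \<open>2 / \<delta>\<close>.\<close>
    define \<delta> where "\<delta> = (1 - r0) / M"
    have \<delta>: "\<delta> > 0" using M r0 by (simp add: \<delta>_def)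
    have inK: "x \<in> K" if "norm x \<le> \<delta>" for x
    proof -
      have "norm (T0 x) \<le> M * \<delta>" using M that by (intro order.trans[OF M(2)] mult_left_mono) auto
      then have "T0 x \<in> T0 ` K" using M by (intro subsetD[OF T0(2)]) (simp add: \<delta>_def)
      then show ?thesis using bij by (simp add: bij_def inj_image_mem_iff)
    qed
    have entry: "\<bar>A $ i $ j\<bar> \<le> 2 / \<delta>" if "(r, A) \<in> Z" for r A i j
    proof -
      have "norm (A *v (\<delta> *\<^sub>R axis j 1)) \<le> 1 + r"
        using that \<delta> unfolding Z_def by (auto intro!: inK simp: norm_axis_1)
      then have "\<delta> * norm (A *v axis j 1) \<le> 2"
        using that \<delta> r0 by (simp add: Z_def matrix_vector_mult_scaleR)
      moreover have "\<bar>A $ i $ j\<bar> \<le> norm (A *v axis j 1)"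
        using component_le_norm_cart[of "A *v axis j 1" i] by (simp add: matrix_vector_mult_basis column_def)
      ultimately have "\<delta> * \<bar>A $ i $ j\<bar> \<le> 2"
        using \<delta> by (meson mult_left_mono order.trans less_imp_le)
      then show ?thesis using \<delta> by (simp add: field_simps)
    qed
    have "norm z \<le> r0 + (\<Sum>i\<in>(UNIV::'n set). \<Sum>j\<in>(UNIV::'n set). 2 / \<delta>)" if z: "z \<in> Z" for z
    proof -
      obtain r A where [simp]: "z = (r, A)" by (cases z)
      have "norm A \<le> (\<Sum>i\<in>UNIV. norm (A $ i))" unfolding norm_vec_def by (rule L2_set_le_sum) simp
      also have "\<dots> \<le> (\<Sum>i\<in>(UNIV::'n set). \<Sum>j\<in>(UNIV::'n set). 2 / \<delta>)"
        using z by (intro sum_mono order.trans[OF norm_le_l1_cart] entry) auto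
      finally have "norm A \<le> (\<Sum>i\<in>(UNIV::'n set). \<Sum>j\<in>(UNIV::'n set). 2 / \<delta>)" .
      moreover have "norm r \<le> r0" using z by (auto simp: Z_def)
      ultimately show ?thesis using norm_Pair_le[of r A] by simp
    qed
    then show ?thesis unfolding bounded_iff by blast
  qed
  ultimately have "compact Z" by (simp add: compact_eq_bounded_closed)
  moreover have "Z \<noteq> {}" using lin_in_Z[OF T0(1), of r0] T0 r0 by auto
  moreover have "continuous_on Z fst" by (intro continuous_intros)
  ultimately obtain z where z: "z \<in> Z" "\<And>w. w \<in> Z \<Longrightarrow> fst z \<le> fst w"
    using continuous_attains_inf by metis
  obtain r A where zr: "z = (r, A)" by (cases z)
  show ?thesis
  proof (rule that[of r "(*v) A"])
    fix r' T' assume r': "0 \<le> r'" "linear T'" "cball 0 (1 - r') \<subseteq> T' ` K" "T' ` K \<subseteq> cball (0 :: real ^ 'n) (1 + r')"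
    show "r \<le> r'"
    proof (cases "r' \<le> r0")
      case True
      then show ?thesis using z(2)[of "(r', matrix T')"] lin_in_Z[OF r'(2), of r'] r' by (simp add: zr)
    next
      case False
      then show ?thesis using z(1) by (simp add: zr Z_iff)
    qed
  qed (use z(1) in \<open>simp_all add: zr Z_iff matrix_vector_mul_linear\<close>)
qed

text \<open>The infimum of an empty set of reals is unspecified, so some admissible ratio must be
  exhibited first; origin symmetry serves this by providing a ball around 0 inside \<open>K\<close>.
  A ratio below 1 + \<epsilon> gives 2 r < \<epsilon> (1 - r) \<le> \<epsilon>.\<close>

lemma banach_mazur_dist_ball_lt:
  fixes K :: "(real ^ 'n::finite) set"
  assumes K: "convex_body K" and sym: "origin_symmetric K" and d: "banach_mazur_dist (cball 0 1) K < 1 + \<epsilon>"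
  obtains r T where "0 \<le> r" "r < 1" "r < \<epsilon>" "linear T" "cball 0 (1 - r) \<subseteq> T ` K" "T ` K \<subseteq> cball (0 :: real ^ 'n) (1 + r)"
proof -
  let ?D = "{(1 + r) / (1 - r) | r. (1 + r) / (1 - r) \<ge> 1 \<and>
       (\<exists>T :: real ^ 'n ^ 'n. invertible T \<and>
          (\<lambda>x. (1 - r) *\<^sub>R x) ` cball 0 1 \<subseteq> (\<lambda>x. T *v x) ` K \<and>
          (\<lambda>x. T *v x) ` K \<subseteq> (\<lambda>x. (1 + r) *\<^sub>R x) ` cball 0 1)}"
  have img: "(\<lambda>x :: real ^ 'n. c *\<^sub>R x) ` cball 0 1 = cball 0 c" if "c > 0" for c
    using cball_scale[of c "0 :: real ^ 'n" 1] that by simp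
  have ne: "?D \<noteq> {}"
  proof -
    obtain x0 e where x0: "e > 0" "ball x0 e \<subseteq> K"
      using K by (auto simp: convex_body_def mem_interior)
    have vK: "convex K" using K by (simp add: convex_body_def)
    have "ball 0 e \<subseteq> K"
    proof
      fix y :: "real ^ 'n" assume y: "y \<in> ball 0 e"
      have "x0 + y \<in> K" "x0 - y \<in> K" using y by (auto intro!: subsetD[OF x0(2)] simp: dist_norm)
      moreover have "- (x0 - y) \<in> K" using calculation(2) sym unfolding origin_symmetric_def by blast
      \<comment> \<open>The midpoint of x0 + y and the reflected point -(x0 - y) is y, so the ball
        at \<open>x0\<close> moves to the origin.\<close>
      ultimately have "(1 / 2) *\<^sub>R (x0 + y) + (1 / 2) *\<^sub>R (- (x0 - y)) \<in> K"
        by (intro convexD[OF vK]) auto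
      moreover have "(1 / 2) *\<^sub>R (x0 + y) + (1 / 2) *\<^sub>R (- (x0 - y)) = y"
        by (simp add: algebra_simps flip: scaleR_add_left)
      ultimately show "y \<in> K" by simp
    qed
    then have small: "cball 0 (e / 2) \<subseteq> K" using x0(1) by (auto simp: subset_iff)
    have "bounded K" using K compact_imp_bounded unfolding convex_body_def by blast
    then obtain R where R: "\<And>x. x \<in> K \<Longrightarrow> norm x \<le> R" unfolding bounded_iff by blast
    define b where "b = max R e"
    have b: "b > 0" "\<And>x. x \<in> K \<Longrightarrow> norm x \<le> b" "e / 2 < b"
      using x0(1) R by (auto simp: b_def less_max_iff_disj intro: max.coboundedI1)
    \<comment> \<open>Division by \<open>b\<close> puts \<open>K\<close> into the unit ball, and it
      still contains the ball of radius e / (2 b) = 1 - r.\<close>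
    define r where "r = 1 - e / (2 * b)"
    have r: "0 \<le> r" "r < 1" using b x0(1) by (auto simp: r_def field_simps)
    define T :: "real ^ 'n ^ 'n" where "T = mat (1 / b)"
    have mv: "mat c *v x = c *\<^sub>R x" for c and x :: "real ^ 'n"
      by (simp add: mat_def matrix_vector_mult_def vec_eq_iff if_distrib if_distribR cong: if_cong)
    then have Tv: "T *v x = (1 / b) *\<^sub>R x" for x by (simp add: T_def)
    have "invertible T"
      unfolding invertible_def
      by (intro exI[of _ "mat b"]) (use b in \<open>simp add: T_def matrix_eq matrix_vector_mul_assoc[symmetric] mv\<close>)
    moreover have "cball 0 (1 - r) \<subseteq> (\<lambda>x. T *v x) ` K"
    proof
      fix x :: "real ^ 'n" assume "x \<in> cball 0 (1 - r)"
      then have "b *\<^sub>R x \<in> K" using b by (intro subsetD[OF small]) (simp add: r_def field_simps)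
      moreover have "x = T *v (b *\<^sub>R x)" using b by (simp add: Tv)
      ultimately show "x \<in> (\<lambda>x. T *v x) ` K" by blast
    qed
    moreover have "(\<lambda>x. T *v x) ` K \<subseteq> cball 0 (1 + r)"
    proof
      fix y assume "y \<in> (\<lambda>x. T *v x) ` K"
      then obtain x where "x \<in> K" "y = (1 / b) *\<^sub>R x" by (auto simp: Tv)
      then have "norm y \<le> 1" using b by (simp add: divide_le_eq)
      then show "y \<in> cball 0 (1 + r)" using r by simp
    qed
    moreover have "(1 + r) / (1 - r) \<ge> 1" using r by (simp add: le_divide_eq)
    ultimately have "(1 + r) / (1 - r) \<in> ?D" unfolding mem_Collect_eq using img[of "1 - r"] img[of "1 + r"] r
      by (intro exI[of _ r] conjI refl exI[of _ T]) simp_all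
    then show ?thesis by blast
  qed
  have "Inf ?D < 1 + \<epsilon>" using d by (simp only: banach_mazur_dist_def)
  from cInf_lessD[OF ne this] obtain r and T :: "real ^ 'n ^ 'n" where
    r: "(1 + r) / (1 - r) \<ge> 1" "(1 + r) / (1 - r) < 1 + \<epsilon>" and
    T: "(\<lambda>x. (1 - r) *\<^sub>R x) ` cball 0 1 \<subseteq> (\<lambda>x. T *v x) ` K" "(\<lambda>x. T *v x) ` K \<subseteq> (\<lambda>x. (1 + r) *\<^sub>R x) ` cball 0 1"
    by auto
  have r1: "r < 1" "r \<ge> 0" using r(1) by (auto simp: le_divide_eq split: if_splits)
  have "(1 + r) < (1 + \<epsilon>) * (1 - r)" using r(2) r1 by (simp add: divide_less_eq)
  then have "2 * r < \<epsilon> * (1 - r)" by (simp add: algebra_simps)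
  moreover have "\<epsilon> * (1 - r) \<le> \<epsilon> \<or> \<epsilon> < 0" using mult_left_mono[of "1 - r" 1 \<epsilon>] r1 by (cases "\<epsilon> < 0") auto
  moreover have "\<epsilon> \<ge> 0"
  proof (rule ccontr)
    assume "\<not> \<epsilon> \<ge> 0"
    then have "\<epsilon> * (1 - r) \<le> 0" using r1 by (simp add: mult_le_0_iff)
    with \<open>2 * r < \<epsilon> * (1 - r)\<close> r1 show False by linarith
  qed
  ultimately have "r < \<epsilon>" using r1 by linarith
  then show ?thesis
    by (rule that[OF r1(2,1) _ matrix_vector_mul_linear[of T]]) (use T img[of "1 - r"] img[of "1 + r"] r1 in auto)
qed

lemma ellipsoid_if_linear_image_eq_ball:
  fixes K :: "(real ^ 'n) set" and T :: "real ^ 'n \<Rightarrow> real ^ 'n"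
  assumes T: "linear T" "bij T" "T ` K = cball 0 1"
  shows "ellipsoid K"
proof -
  have lin: "linear (inv T)" by (rule inj_linear_imp_inv_linear[OF T(1) bij_is_inj[OF T(2)]])
  have "(*v) (matrix (inv T)) = inv T" by (rule matrix_vector_mul(2)[OF lin])
  moreover have "invertible (matrix (inv T))"
    using matrix_invertible[OF lin] T by (metis bij_is_inj bij_is_surj inv_o_cancel surj_iff)
  moreover have "K = inv T ` cball 0 1"
    using T(2) by (simp flip: T(3) add: image_comp bij_is_inj)
  ultimately show ?thesis unfolding ellipsoid_def by metis
qed

theorem theorem2:
  fixes p :: real
  assumes "CARD('n::finite) \<ge> 3" and "p > 1"
  shows "\<exists>\<epsilon>>0. \<forall>K :: (real ^ 'n) set.
           convex_body K \<and> origin_symmetric K \<and>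
           banach_mazur_dist (cball 0 1) K < 1 + \<epsilon> \<and>
           (\<exists>c :: real. (\<lambda>x. c *\<^sub>R x) ` p_centroid_body p K = K) \<longrightarrow>
           ellipsoid K"
proof -
  have n: "CARD('n) \<ge> 2" using assms(1) by simp
  obtain \<epsilon>0 where \<epsilon>0: "\<epsilon>0 > 0" and improve: "\<And>(K :: (real ^ 'n) set) r. near_ball K r \<Longrightarrow> moment_fixed p K \<Longrightarrow> r < \<epsilon>0 \<Longrightarrow>
    \<exists>T :: real ^ 'n \<Rightarrow> real ^ 'n. linear T \<and> cball 0 (1 - r / 2) \<subseteq> T ` K \<and> T ` K \<subseteq> cball 0 (1 + r / 2)"
    using near_ball_improvable[OF assms(2) n] by blast
  show ?thesis
  \<comment> \<open>The bound 1/4 is the range of \<open>near_ball\<close>, and \<epsilon>0 is the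
    threshold for improvement. The minimal \<open>r\<close> inherits both bounds from the starting
    position.\<close>
  proof (intro exI[of _ "min \<epsilon>0 (1 / 4)"] conjI allI impI)
    fix K :: "(real ^ 'n) set"
    assume "convex_body K \<and> origin_symmetric K \<and> banach_mazur_dist (cball 0 1) K < 1 + min \<epsilon>0 (1 / 4) \<and>
       (\<exists>c :: real. (\<lambda>x. c *\<^sub>R x) ` p_centroid_body p K = K)"
    then obtain c where K: "convex_body K" and sym: "origin_symmetric K"
      and bm: "banach_mazur_dist (cball 0 1) K < 1 + min \<epsilon>0 (1 / 4)"
      and c: "(\<lambda>x. c *\<^sub>R x) ` p_centroid_body p K = K" by blast
    obtain r0 T0 where r0: "0 \<le> r0" "r0 < min \<epsilon>0 (1 / 4)" and
      T0: "linear T0" "cball 0 (1 - r0) \<subseteq> T0 ` K" "T0 ` K \<subseteq> cball (0 :: real ^ 'n) (1 + r0)"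
      using banach_mazur_dist_ball_lt[OF K sym bm] by metis
    obtain r T where r: "0 \<le> r" "r \<le> r0" and
      T: "linear T" "cball 0 (1 - r) \<subseteq> T ` K" "T ` K \<subseteq> cball (0 :: real ^ 'n) (1 + r)" and
      min: "\<And>r' T'. 0 \<le> r' \<Longrightarrow> linear T' \<Longrightarrow> cball 0 (1 - r') \<subseteq> T' ` K \<Longrightarrow> T' ` K \<subseteq> cball (0 :: real ^ 'n) (1 + r') \<Longrightarrow> r \<le> r'"
      using minimal_position[OF K r0(1) _ T0] r0(2) by (metis less_imp_le min_less_iff_conj)
    have r1: "r \<le> 1 / 4" "r < \<epsilon>0" using r r0 by auto
    have bij: "bij T" using r1 by (intro bij_if_ball_subset_image[OF T(1,2)]) simp
    have "r = 0"
    proof (rule ccontr)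
      assume "r \<noteq> 0"
      then have r_pos: "r > 0" using r by simp
      have "convex_body (T ` K)" using r1 by (intro convex_body_linear_image[OF K T(1,2)]) simp
      then have nb: "near_ball (T ` K) r" using r_pos r1 T by (simp add: near_ball_def)
      have mf: "moment_fixed p (T ` K)" using assms(2) by (intro moment_fixed_linear_image[OF _ K c T(1) bij]) simp
      obtain S :: "real ^ 'n \<Rightarrow> real ^ 'n" where S: "linear S" "cball 0 (1 - r / 2) \<subseteq> S ` (T ` K)" "S ` (T ` K) \<subseteq> cball 0 (1 + r / 2)"
        using improve[OF nb mf r1(2)] by blast
      have "r \<le> r / 2"
        using r_pos S by (intro min[OF _ linear_compose[OF T(1) S(1)]]) (auto simp: image_comp)
      then show False using r_pos by simp
    qed
    then have "T ` K = cball 0 1" using T by auto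
    then show "ellipsoid K" by (rule ellipsoid_if_linear_image_eq_ball[OF T(1) bij])
  qed (use \<epsilon>0 in simp)
qed

end
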